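(* Let $n\ge1$ be an integer, $1<p<q<\infty$, $1<r<\infty$ and $1\le l\le\infty$. There exists a positive constant $C=C(n,q,p,r,l)$ such that, for every $u\in L^{p,\infty}(\mathbb{R}^n)$ for which the norm on the right-hand side of the respective inequality is finite, $$\|u\|_{L^{q,l}(\mathbb{R}^n)}\le C\,\|u\|_{L^{p,\infty}(\mathbb{R}^n)}^{\frac pq}\,\|\Lambda^{\frac nr}u\|_{L^{r,\infty}(\mathbb{R}^n)}^{1-\frac pq},$$ $$\|u\|_{L^{q,l}(\mathbb{R}^n)}\le C\,\|u\|_{L^{p,\infty}(\mathbb{R}^n)}^{\frac pq}\,\|u\|_{\dot F^{\frac nr}_{r,\infty,\infty}}^{1-\frac pq},$$ $$\|u\|_{L^{q,l}(\mathbb{R}^n)}\le C\,\|u\|_{L^{p,\infty}(\mathbb{R}^n)}^{\frac pq}\,\|u\|_{\dot B^{\frac nr}_{r,\infty,\infty}}^{1-\frac pq}.$$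
   Context: Lorentz spaces: for measurable $f$ on $\mathbb{R}^n$, let $f_*(\alpha)=|\{x:|f(x)|>\alpha\}|$ and $f^*(t)=\inf\{\alpha>0: f_*(\alpha)\le t\}$. For $p,q\in(0,\infty]$ put $\|f\|_{L^{p,q}(\mathbb{R}^n)}=\left(\int_0^\infty (t^{1/p}f^*(t))^q\,\frac{dt}{t}\right)^{1/q}$ if $q<\infty$ and $\|f\|_{L^{p,\infty}(\mathbb{R}^n)}=\sup_{t>0}t^{1/p}f^*(t)$; $L^{p,q}(\mathbb{R}^n)$ is the set of measurable $f$ for which this is finite. $\Lambda^s=(-\Delta)^{s/2}$ is defined by $\widehat{\Lambda^s f}(\xi)=|\xi|^s\widehat f(\xi)$. Littlewood–Paley decomposition: fix a nonnegative radial $\varphi\in C^\infty(\mathbb{R}^n)$ supported in $\{\frac34\le|\xi|\le\frac83\}$ with $\sum_{j\in\mathbb{Z}}\varphi(2^{-j}\xi)=1$ for all $\xi\neq0$, and set $\dot\Delta_jf=\varphi(2^{-j}D)f$, i.e. $\widehat{\dot\Delta_j f}(\xi)=\varphi(2^{-j}\xi)\widehat f(\xi)$. For $f\in\mathcal{S}'(\mathbb{R}^n)$ (modulo polynomials): $\|f\|_{\dot B^{s}_{r,\infty,\infty}}=\sup_{j\in\mathbb{Z}}2^{js}\|\dot\Delta_jf\|_{L^{r,\infty}(\mathbb{R}^n)}$ (homogeneous Besov–Lorentz norm) and $\|f\|_{\dot F^{s}_{r,\infty,\infty}}=\left\|\sup_{j\in\mathbb{Z}}2^{js}|\dot\Delta_jf|\right\|_{L^{r,\infty}(\mathbb{R}^n)}$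 (homogeneous Triebel–Lizorkin–Lorentz norm). *)

theory Defs
  imports "HOL-Analysis.Analysis"
begin

section \<open>Lorentz spaces\<close>

text \<open>Real powers on \<open>[0,\<infinity>]\<close>; only used with exponent \<open>a > 0\<close>, where \<open>\<infinity>\<^sup>a = \<infinity>\<close>.\<close>

definition ennreal_powr :: "ennreal \<Rightarrow> real \<Rightarrow> ennreal" where
  "ennreal_powr x a = (if x = \<infinity> then \<infinity> else ennreal (enn2real x powr a))"

text \<open>The following notions are defined for functions with values in \<open>[0,\<infinity>]\<close>, because the
  function \<open>sup\<^sub>j 2\<^bsup>js\<^esup> |\<Delta>\<^sub>j f|\<close> in the Triebel--Lizorkin--Lorentz norm may take the value \<open>\<infinity>\<close>.
  An infimum over the empty set is \<open>\<infinity>\<close>.\<close>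

definition distribution_fun :: "(real^'n \<Rightarrow> ennreal) \<Rightarrow> real \<Rightarrow> ennreal" where
  "distribution_fun F \<alpha> = emeasure lebesgue {x. F x > ennreal \<alpha>}"

definition decreasing_rearrangement :: "(real^'n \<Rightarrow> ennreal) \<Rightarrow> real \<Rightarrow> ennreal" where
  "decreasing_rearrangement F t = (INF \<alpha>\<in>{\<alpha>. \<alpha> > 0 \<and> distribution_fun F \<alpha> \<le> ennreal t}. ennreal \<alpha>)"

definition lorentz_ennorm :: "ennreal \<Rightarrow> ennreal \<Rightarrow> (real^'n \<Rightarrow> ennreal) \<Rightarrow> ennreal" where
  "lorentz_ennorm p q F =
    (if q = \<infinity>
     then (SUP t\<in>{0<..}. ennreal (t powr enn2real (1 / p)) * decreasing_rearrangement F t)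
     else ennreal_powr
       (\<integral>\<^sup>+t\<in>{0<..}. ennreal_powr
            (ennreal (t powr enn2real (1 / p)) * decreasing_rearrangement F t) (enn2real q)
          * ennreal (1 / t) \<partial>lborel)
       (1 / enn2real q))"

definition lorentz_norm :: "ennreal \<Rightarrow> ennreal \<Rightarrow> (real^'n \<Rightarrow> complex) \<Rightarrow> ennreal" where
  "lorentz_norm p q f = lorentz_ennorm p q (\<lambda>x. ennreal (norm (f x)))"

definition lorentz_space :: "ennreal \<Rightarrow> ennreal \<Rightarrow> (real^'n \<Rightarrow> complex) set" where
  "lorentz_space p q = {f. f \<in> borel_measurable lebesgue \<and> lorentz_norm p q f < \<infinity>}"


section \<open>Schwartz functions and the Fourier transform\<close>

definition partial_deriv :: "'n \<Rightarrow> (real^'n \<Rightarrow> 'b::real_normed_vector) \<Rightarrow> real^'n \<Rightarrow> 'b" where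
  "partial_deriv i f x = frechet_derivative f (at x) (axis i 1)"

definition iterated_partial :: "'n list \<Rightarrow> (real^'n \<Rightarrow> 'b::real_normed_vector) \<Rightarrow> real^'n \<Rightarrow> 'b" where
  "iterated_partial js f = foldr partial_deriv js f"

definition smooth :: "(real^'n \<Rightarrow> 'b::real_normed_vector) \<Rightarrow> bool" where
  "smooth f \<longleftrightarrow> (\<forall>js x. iterated_partial js f differentiable (at x))"

definition schwartz :: "(real^'n \<Rightarrow> complex) \<Rightarrow> bool" where
  "schwartz \<psi> \<longleftrightarrow> smooth \<psi> \<and>
    (\<forall>js (k::nat). bounded (range (\<lambda>x. (1 + norm x) ^ k *\<^sub>R iterated_partial js \<psi> x)))"

definition fourier :: "(real^'n \<Rightarrow> complex) \<Rightarrow> real^'n \<Rightarrow> complex" where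
  "fourier \<psi> \<xi> = (LINT x|lebesgue. cis (- (x \<bullet> \<xi>)) * \<psi> x)"

text \<open>Distributions are functionals on test functions; only their values on Schwartz functions
  matter. The functions satisfying \<open>tempered_fun\<close> are those that define a tempered distribution by
  integration: a measurable function whose product with every Schwartz function is integrable
  induces a continuous functional on the Schwartz space, by the closed graph theorem.\<close>

type_synonym 'n distr = "(real^'n \<Rightarrow> complex) \<Rightarrow> complex"

definition tempered_fun :: "(real^'n \<Rightarrow> complex) \<Rightarrow> bool" where
  "tempered_fun g \<longleftrightarrow> g \<in> borel_measurable lebesgue \<and>
    (\<forall>\<psi>. schwartz \<psi> \<longrightarrow> integrable lebesgue (\<lambda>x. g x * \<psi> x))"

definition distr_of :: "(real^'n \<Rightarrow> complex) \<Rightarrow> 'n::finite distr" where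
  "distr_of g \<psi> = (LINT x|lebesgue. g x * \<psi> x)"

definition fourier_distr :: "'n::finite distr \<Rightarrow> 'n distr" where
  "fourier_distr T \<psi> = T (fourier \<psi>)"


section \<open>The operator \<open>\<Lambda>\<^sup>s\<close>\<close>

text \<open>The symbol \<open>|\<xi>|\<^sup>s\<close> is smooth only away from the origin, so the defining identity between
  the Fourier transforms of \<open>\<Lambda>\<^sup>s T\<close> and \<open>T\<close> is an identity of distributions on
  \<open>\<real>\<^sup>n - {0}\<close>. Since the tempered distributions whose Fourier transform is supported at the
  origin are the polynomials, it determines \<open>\<Lambda>\<^sup>s T\<close> modulo polynomials.\<close>

definition test_fun_off_origin :: "(real^'n \<Rightarrow> complex) \<Rightarrow> bool" where
  "test_fun_off_origin \<psi> \<longleftrightarrow>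
    smooth \<psi> \<and> compact (closure {\<xi>. \<psi> \<xi> \<noteq> 0}) \<and> 0 \<notin> closure {\<xi>. \<psi> \<xi> \<noteq> 0}"

definition is_Lambda :: "real \<Rightarrow> 'n::finite distr \<Rightarrow> 'n distr \<Rightarrow> bool" where
  "is_Lambda s T S \<longleftrightarrow> (\<forall>\<psi>. test_fun_off_origin \<psi> \<longrightarrow>
    fourier_distr S \<psi> = fourier_distr T (\<lambda>\<xi>. complex_of_real (norm \<xi> powr s) * \<psi> \<xi>))"

text \<open>The norm of \<open>\<Lambda>\<^sup>s T\<close> in \<open>L\<^bsup>p,q\<^esup>\<close>. It is \<open>\<infinity>\<close> if \<open>\<Lambda>\<^sup>s T\<close> is not a function. For \<open>p < \<infinity>\<close>
  no nonzero polynomial belongs to \<open>L\<^bsup>p,q\<^esup>\<close>, so up to null sets at most one of the representatives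
  \<open>g\<close> has finite norm, and the infimum is the norm of that representative.\<close>

definition Lambda_lorentz_norm :: "real \<Rightarrow> ennreal \<Rightarrow> ennreal \<Rightarrow> 'n::finite distr \<Rightarrow> ennreal" where
  "Lambda_lorentz_norm s p q T =
    (INF g\<in>{g. tempered_fun g \<and> is_Lambda s T (distr_of g)}. lorentz_norm p q g)"


section \<open>Littlewood--Paley decomposition\<close>

definition littlewood_paley :: "(real^'n \<Rightarrow> real) \<Rightarrow> bool" where
  "littlewood_paley \<phi> \<longleftrightarrow>
    smooth \<phi> \<and>
    (\<forall>\<xi>. 0 \<le> \<phi> \<xi>) \<and>
    (\<forall>\<xi> \<eta>. norm \<xi> = norm \<eta> \<longrightarrow> \<phi> \<xi> = \<phi> \<eta>) \<and>
    closure {\<xi>. \<phi> \<xi> \<noteq> 0} \<subseteq> {\<xi>. 3/4 \<le> norm \<xi> \<and> norm \<xi> \<le> 8/3} \<and>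
    (\<forall>\<xi>. \<xi> \<noteq> 0 \<longrightarrow> ((\<lambda>j::int. \<phi> ((2 powi (- j)) *\<^sub>R \<xi>)) has_sum 1) UNIV)"

text \<open>For tempered \<open>T\<close> the distribution \<open>\<phi>(2\<^bsup>-j\<^esup>D) T\<close> is a smooth function; the choice below
  picks a function representing it, and any two such functions agree almost everywhere.\<close>

definition is_LP_block :: "(real^'n \<Rightarrow> real) \<Rightarrow> int \<Rightarrow> 'n::finite distr \<Rightarrow> 'n distr \<Rightarrow> bool" where
  "is_LP_block \<phi> j T S \<longleftrightarrow> (\<forall>\<psi>. schwartz \<psi> \<longrightarrow>
    fourier_distr S \<psi> =
      fourier_distr T (\<lambda>\<xi>. complex_of_real (\<phi> ((2 powi (- j)) *\<^sub>R \<xi>)) * \<psi> \<xi>))"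

definition LP_block :: "(real^'n \<Rightarrow> real) \<Rightarrow> int \<Rightarrow> 'n::finite distr \<Rightarrow> real^'n \<Rightarrow> complex" where
  "LP_block \<phi> j T = (SOME g. tempered_fun g \<and> is_LP_block \<phi> j T (distr_of g))"

definition besov_lorentz_norm :: "(real^'n \<Rightarrow> real) \<Rightarrow> real \<Rightarrow> real \<Rightarrow> 'n::finite distr \<Rightarrow> ennreal" where
  "besov_lorentz_norm \<phi> s r T =
    (SUP j::int. ennreal (2 powr (of_int j * s)) * lorentz_norm (ennreal r) \<infinity> (LP_block \<phi> j T))"

definition triebel_lizorkin_lorentz_norm ::
    "(real^'n \<Rightarrow> real) \<Rightarrow> real \<Rightarrow> real \<Rightarrow> 'n::finite distr \<Rightarrow> ennreal" where
  "triebel_lizorkin_lorentz_norm \<phi> s r T =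
    lorentz_ennorm (ennreal r) \<infinity>
      (\<lambda>x. SUP j::int. ennreal (2 powr (of_int j * s) * norm (LP_block \<phi> j T x)))"

end

theory Submission
  imports Defs "HOL-Probability.Probability"
begin

text \<open>Write \<open>K\<close> for the norm of \<open>u\<close> in \<open>L\<^bsup>p,\<infinity>\<^esup>\<close> and \<open>B\<close> for its Besov--Lorentz norm, which is dominated by
  the Triebel--Lizorkin--Lorentz norm and, up to a constant, by that of \<open>\<Lambda>\<^bsup>n/r\<^esup> u\<close>. For every integer \<open>j\<close> split
  \<open>u\<close> into its low frequencies and the blocks \<open>\<Delta>\<^sub>i u\<close> with \<open>i \<ge> j\<close>. The low frequencies are bounded by
  a multiple of \<open>2\<^bsup>jn/p\<^esup> K\<close>. Each block is bounded by a multiple of \<open>B\<close>, and its \<open>L\<^bsup>r,\<infinity>\<^esup>\<close> norm is at most \<open>2\<^bsup>-in/r\<^esup> B\<close>, so for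
  every \<open>m \<ge> r\<close> it exceeds \<open>\<alpha>\<close> on a set of measure at most a multiple of \<open>2\<^bsup>-in\<^esup> (B/\<alpha>)\<^sup>m\<close>; the blocks with
  \<open>i \<ge> j\<close> together satisfy the same estimate with \<open>i = j\<close>. Choosing \<open>j\<close> so that the low frequencies
  stay below \<open>\<alpha>/2\<close> shows that \<open>|u|\<close> exceeds \<open>\<alpha>\<close> on a set of measure at most a multiple of
  \<open>K\<^sup>p B\<^sup>m \<alpha>\<^bsup>-(p+m)\<^esup>\<close>, a bound in \<open>L\<^bsup>p+m,\<infinity>\<^esup>\<close>. Taking \<open>p + m > q\<close> and interpolating with \<open>L\<^bsup>p,\<infinity>\<^esup>\<close> gives \<open>L\<^bsup>q,l\<^esup>\<close>
  for every \<open>l\<close>.\<close>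

section \<open>Smooth functions\<close>

text \<open>The three norms enter through one mechanism: block j of u is a convolution of some g,
  with weak L^r bound 2^(-jn/r) B, with the 2^j-dilate of one fixed bounded integrable kernel. Here
  g is the block itself, or 2^(-jn/r) times Lambda^(n/r) u. This single representation yields both
  the sup bound and, by a weak Young inequality, the weak L^r bound. Raising the exponent from r to
  m is what reaches every q > p: with m = r alone the interpolation would stop at q < p + r. Two
  obstacles shape the proof. A weak L^p function need not be integrable, so every pairing with a
  kernel is split at a level: below it the function is bounded, above it integrable because p > 1.
  Moreover the blocks and Lambda^s u are known only through test functions, the blocks even by
  choice; testing with modulated multipliers turns these weak identities into pointwise ones between
  convolutions. Likewise u is recovered from its low frequencies only after integration against
  continuous cutoffs.\<close>

lemma partial_deriv_eqI:
  assumes "(f has_derivative f') (at x)"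
  shows "partial_deriv i f x = f' (axis i 1)"
  using frechet_derivative_at[OF assms] by (simp add: partial_deriv_def)

lemma partial_deriv_cong_open:
  assumes "open U" "x \<in> U" "\<And>y. y \<in> U \<Longrightarrow> f y = g y" "g differentiable (at x)"
  shows "f differentiable (at x)" "partial_deriv i f x = partial_deriv i g x"
proof -
  obtain D where D: "(g has_derivative D) (at x)" using assms(4) by (auto simp: differentiable_def)
  have "(f has_derivative D) (at x)"
    using has_derivative_transform_within_open[OF D assms(1,2)] assms(3) by auto
  then show "f differentiable (at x)" "partial_deriv i f x = partial_deriv i g x"
    using partial_deriv_eqI[OF D] partial_deriv_eqI by (auto simp: differentiable_def)
qed

text \<open>\<open>smooth\<close> quantifies over all words of partial derivatives. Instead of a
  formula for each word, it suffices to exhibit a class of differentiable functions that contains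
  \<open>f\<close> and is closed under one derivative. The smoothness proofs below only have to find
  this class.\<close>

lemma smooth_coinduct:
  assumes "P f" "\<And>f x. P f \<Longrightarrow> f differentiable (at x)" "\<And>f i. P f \<Longrightarrow> P (partial_deriv i f)"
  shows "smooth f"
proof -
  have "P (iterated_partial js f)" for js
    by (induction js) (auto simp: iterated_partial_def assms)
  then show ?thesis using assms(2) by (auto simp: smooth_def)
qed

lemma iterated_partial_partial_deriv:
  "iterated_partial js (partial_deriv i f) = iterated_partial (js @ [i]) f"
  by (simp add: iterated_partial_def)

lemma smooth_partial_deriv: "smooth f \<Longrightarrow> smooth (partial_deriv i f)"
  by (auto simp: smooth_def iterated_partial_partial_deriv)

lemma smooth_iterated_partial: "smooth f \<Longrightarrow> smooth (iterated_partial js f)"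
  by (induction js) (auto simp: iterated_partial_def smooth_partial_deriv)

lemma smooth_differentiable: "smooth f \<Longrightarrow> f differentiable (at x)"
  unfolding smooth_def by (drule spec[of _ "[]"]) (simp add: iterated_partial_def)

lemma smooth_has_derivative:
  "smooth f \<Longrightarrow> (f has_derivative frechet_derivative f (at x)) (at x)"
  using smooth_differentiable frechet_derivative_works by blast

lemma smooth_continuous_on: "smooth f \<Longrightarrow> continuous_on S f"
  by (meson differentiable_imp_continuous_within smooth_differentiable
      continuous_at_imp_continuous_on)

lemma smooth_borel_measurable: "smooth f \<Longrightarrow> f \<in> borel_measurable borel"
  by (simp add: borel_measurable_continuous_onI smooth_continuous_on)

lemma smooth_const: "smooth (\<lambda>x. c)"
proof (rule smooth_coinduct[where P = "\<lambda>h. \<exists>c. h = (\<lambda>x. c)"])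
  show "\<exists>c'. partial_deriv i f = (\<lambda>x. c')"
    if "\<exists>c. f = (\<lambda>x. c)" for f :: "real^'n \<Rightarrow> 'b" and i
  proof -
    have "(f has_derivative (\<lambda>_. 0)) (at x)" for x using that by auto
    then show ?thesis using partial_deriv_eqI by blast
  qed
qed auto

lemma smooth_component: "smooth (\<lambda>x::real^'n. x $ i)"
proof -
  have d: "((\<lambda>x::real^'n. x $ i) has_derivative (\<lambda>h. h $ i)) (at x)" for x
    by (auto intro!: derivative_eq_intros bounded_linear_imp_has_derivative)
  have "partial_deriv j (\<lambda>x::real^'n. x $ i) = (\<lambda>x. axis j 1 $ i)" for j
    using partial_deriv_eqI[OF d] by auto
  then have p: "smooth (partial_deriv j (\<lambda>x::real^'n. x $ i))" for j
    by (simp add: smooth_const)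
  show ?thesis
  \<comment> \<open>The class keeps the coordinate function beside all functions already known to be
    smooth, because a single derivative makes it constant.\<close>
  proof (rule smooth_coinduct[where P = "\<lambda>h. h = (\<lambda>x::real^'n. x $ i) \<or> smooth h"])
    show "h differentiable (at x)" if "h = (\<lambda>x::real^'n. x $ i) \<or> smooth h" for h x
      using that d[of x] smooth_differentiable[of h x] unfolding differentiable_def by blast
    show "partial_deriv j h = (\<lambda>x. x $ i) \<or> smooth (partial_deriv j h)"
      if "h = (\<lambda>x::real^'n. x $ i) \<or> smooth h" for h j
      using that p[of j] smooth_partial_deriv[of h j] by blast
  qed simp
qed

text \<open>By the product rule a derivative of a product is a sum of products, so neither operation
  alone gives a class closed under differentiation; the algebra generated by the smooth functions is
  closed.\<close>

inductive smooth_alg :: "(real^'n \<Rightarrow> 'b::real_normed_algebra) \<Rightarrow> bool" where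
  base: "smooth f \<Longrightarrow> smooth_alg f"
| add: "smooth_alg f \<Longrightarrow> smooth_alg g \<Longrightarrow> smooth_alg (\<lambda>x. f x + g x)"
| mult: "smooth_alg f \<Longrightarrow> smooth_alg g \<Longrightarrow> smooth_alg (\<lambda>x. f x * g x)"

lemma partial_deriv_add:
  assumes "f differentiable (at x)" "g differentiable (at x)"
  shows "partial_deriv i (\<lambda>x. f x + g x) x = partial_deriv i f x + partial_deriv i g x"
  using has_derivative_add[OF assms[unfolded frechet_derivative_works]]
  by (subst partial_deriv_eqI) (auto simp: partial_deriv_def)

lemma partial_deriv_diff:
  assumes "f differentiable (at x)" "g differentiable (at x)"
  shows "partial_deriv i (\<lambda>x. f x - g x) x = partial_deriv i f x - partial_deriv i g x"
  using has_derivative_diff[OF assms[unfolded frechet_derivative_works]]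
  by (subst partial_deriv_eqI) (auto simp: partial_deriv_def)

lemma partial_deriv_mult:
  fixes f g :: "real^'n \<Rightarrow> 'b::real_normed_algebra"
  assumes "f differentiable (at x)" "g differentiable (at x)"
  shows "partial_deriv i (\<lambda>x. f x * g x) x = f x * partial_deriv i g x + partial_deriv i f x * g x"
  using has_derivative_mult[OF assms[unfolded frechet_derivative_works]]
  by (subst partial_deriv_eqI) (auto simp: partial_deriv_def)

lemma smooth_alg_deriv:
  assumes "smooth_alg f"
  shows "(\<forall>x. f differentiable (at x)) \<and> (\<forall>i. smooth_alg (partial_deriv i f))"
  using assms
proof induction
  case (base f)
  then show ?case by (simp add: smooth_differentiable smooth_partial_deriv smooth_alg.base)
next
  case (add f g)
  have "partial_deriv i (\<lambda>x. f x + g x) = (\<lambda>x. partial_deriv i f x + partial_deriv i g x)" for i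
    using add.IH by (intro ext partial_deriv_add) auto
  then show ?case using add by (auto intro: smooth_alg.add)
next
  case (mult f g)
  have "partial_deriv i (\<lambda>x. f x * g x)
      = (\<lambda>x. f x * partial_deriv i g x + partial_deriv i f x * g x)" for i
    using mult.IH by (intro ext partial_deriv_mult) auto
  then show ?case using mult by (auto intro!: smooth_alg.add smooth_alg.mult)
qed

lemma smooth_alg_imp_smooth: "smooth_alg f \<Longrightarrow> smooth f"
  by (rule smooth_coinduct[where P = smooth_alg]) (use smooth_alg_deriv in blast)+

lemma smooth_add:
  fixes f g :: "real^'n \<Rightarrow> 'b::real_normed_algebra"
  shows "smooth f \<Longrightarrow> smooth g \<Longrightarrow> smooth (\<lambda>x. f x + g x)"
  by (rule smooth_alg_imp_smooth, rule smooth_alg.add) (rule smooth_alg.base; assumption)+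

lemma smooth_mult:
  fixes f g :: "real^'n \<Rightarrow> 'b::real_normed_algebra"
  shows "smooth f \<Longrightarrow> smooth g \<Longrightarrow> smooth (\<lambda>x. f x * g x)"
  by (rule smooth_alg_imp_smooth, rule smooth_alg.mult) (rule smooth_alg.base; assumption)+

lemma smooth_cmult:
  fixes f :: "real^'n \<Rightarrow> 'b::real_normed_algebra"
  shows "smooth f \<Longrightarrow> smooth (\<lambda>x. c * f x)"
  by (rule smooth_mult[OF smooth_const])

lemma smooth_diff:
  fixes f g :: "real^'n \<Rightarrow> 'b::real_normed_algebra_1"
  assumes "smooth f" "smooth g"
  shows "smooth (\<lambda>x. f x - g x)"
  using smooth_add[OF assms(1) smooth_cmult[OF assms(2), of "- 1"]] by simp

lemma smooth_sum:
  fixes f :: "'i \<Rightarrow> real^'n \<Rightarrow> 'b::real_normed_algebra"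
  assumes "\<And>i. i \<in> A \<Longrightarrow> smooth (f i)"
  shows "smooth (\<lambda>x. \<Sum>i\<in>A. f i x)"
  using assms
  by (induction A rule: infinite_finite_induct) (auto simp: smooth_const smooth_add)

lemma partial_deriv_dilation:
  assumes "f differentiable (at (c *\<^sub>R x))"
  shows "((\<lambda>x. a *\<^sub>R f (c *\<^sub>R x)) has_derivative
      (\<lambda>h. a *\<^sub>R frechet_derivative f (at (c *\<^sub>R x)) (c *\<^sub>R h))) (at x)"
    and "partial_deriv i (\<lambda>x. a *\<^sub>R f (c *\<^sub>R x)) x = (a * c) *\<^sub>R partial_deriv i f (c *\<^sub>R x)"
proof -
  have f: "(f has_derivative frechet_derivative f (at (c *\<^sub>R x))) (at (c *\<^sub>R x))"
    using assms by (simp add: frechet_derivative_works)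
  have "((\<lambda>x. c *\<^sub>R x) has_derivative (\<lambda>h. c *\<^sub>R h)) (at x)"
    by (auto intro!: derivative_eq_intros)
  from has_derivative_scaleR_right[OF has_derivative_compose[OF this f], of a]
  show *: "((\<lambda>x. a *\<^sub>R f (c *\<^sub>R x)) has_derivative
      (\<lambda>h. a *\<^sub>R frechet_derivative f (at (c *\<^sub>R x)) (c *\<^sub>R h))) (at x)" .
  show "partial_deriv i (\<lambda>x. a *\<^sub>R f (c *\<^sub>R x)) x = (a * c) *\<^sub>R partial_deriv i f (c *\<^sub>R x)"
    using linear_scale[OF has_derivative_linear[OF f], of c "axis i 1"] partial_deriv_eqI[OF *, of i]
    by (simp add: partial_deriv_def[of i f])
qed

lemma smooth_dilation:
  assumes "smooth f"
  shows "smooth (\<lambda>x. f (c *\<^sub>R x))"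
\<comment> \<open>The scalar \<open>a\<close> absorbs the factor \<open>c\<close> that the chain
  rule produces at every derivative.\<close>
proof (rule smooth_coinduct[where P = "\<lambda>h. \<exists>a f. smooth f \<and> h = (\<lambda>x. a *\<^sub>R f (c *\<^sub>R x))"])
  show "\<exists>a g. smooth g \<and> (\<lambda>x. f (c *\<^sub>R x)) = (\<lambda>x. a *\<^sub>R g (c *\<^sub>R x))"
    using assms by (intro exI[of _ 1]) auto
next
  fix h :: "real^'a \<Rightarrow> 'b" and x
  assume "\<exists>a f. smooth f \<and> h = (\<lambda>x. a *\<^sub>R f (c *\<^sub>R x))"
  then show "h differentiable at x"
    using partial_deriv_dilation(1) smooth_differentiable differentiable_def by blast
next
  fix h :: "real^'a \<Rightarrow> 'b" and i
  assume "\<exists>a f. smooth f \<and> h = (\<lambda>x. a *\<^sub>R f (c *\<^sub>R x))"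
  then obtain a g where g: "smooth g" "h = (\<lambda>x. a *\<^sub>R g (c *\<^sub>R x))" by blast
  then have "partial_deriv i h = (\<lambda>x. (a * c) *\<^sub>R partial_deriv i g (c *\<^sub>R x))"
    using partial_deriv_dilation(2) smooth_differentiable by blast
  then show "\<exists>a f. smooth f \<and> partial_deriv i h = (\<lambda>x. a *\<^sub>R f (c *\<^sub>R x))"
    using smooth_partial_deriv[OF g(1)] by blast
qed

lemma smooth_of_real:
  fixes f :: "real^'n \<Rightarrow> real"
  assumes "smooth f"
  shows "smooth (\<lambda>x. complex_of_real (f x))"
proof (rule smooth_coinduct[where P = "\<lambda>h. \<exists>f. smooth f \<and> h = (\<lambda>x. complex_of_real (f x))"])
  have d: "((\<lambda>x. complex_of_real (g x)) has_derivative
      (\<lambda>h. complex_of_real (frechet_derivative g (at x) h))) (at x)"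
    if "smooth g" for g :: "real^'n \<Rightarrow> real" and x
    using bounded_linear.has_derivative[OF bounded_linear_of_real smooth_has_derivative[OF that]] .
  show "\<exists>g. smooth g \<and> (\<lambda>x. complex_of_real (f x)) = (\<lambda>x. complex_of_real (g x))"
    using assms by blast
  fix h :: "real^'n \<Rightarrow> complex" assume "\<exists>f. smooth f \<and> h = (\<lambda>x. complex_of_real (f x))"
  then obtain g where g: "smooth g" "h = (\<lambda>x. complex_of_real (g x))" by blast
  show "h differentiable (at x)" for x
    using d[OF g(1), of x] unfolding g(2) differentiable_def by blast
  have "partial_deriv i h = (\<lambda>x. complex_of_real (partial_deriv i g x))" for i
    using partial_deriv_eqI[OF d[OF g(1)]] unfolding g(2) partial_deriv_def[of i g] by (rule ext)
  then show "\<exists>f. smooth f \<and> partial_deriv i h = (\<lambda>x. complex_of_real (f x))" for i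
    using smooth_partial_deriv[OF g(1)] by blast
qed

lemma cis_has_derivative:
  "((\<lambda>\<xi>::real^'n. c * cis (y \<bullet> \<xi>)) has_derivative (\<lambda>h. c * (of_real (y \<bullet> h) * (\<i> * cis (y \<bullet> \<xi>))))) (at \<xi>)"
proof -
  have "(cis has_vector_derivative \<i> * cis t) (at t)" for t
  proof -
    have "((\<lambda>z. exp (\<i> * z)) has_field_derivative \<i> * cis t) (at (of_real t))"
      by (auto intro!: derivative_eq_intros simp: cis_conv_exp)
    from has_vector_derivative_real_field[OF this] show ?thesis
      by (simp add: cis_conv_exp[abs_def])
  qed
  then have c: "(cis has_derivative (\<lambda>h. h *\<^sub>R (\<i> * cis t))) (at t)" for t
    by (simp add: has_vector_derivative_def)
  have "((\<lambda>\<xi>. y \<bullet> \<xi>) has_derivative (\<lambda>h. y \<bullet> h)) (at \<xi>)"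
    by (auto intro!: derivative_eq_intros)
  from has_derivative_mult_right[OF has_derivative_compose[OF this c], of c]
  show ?thesis by (simp add: scaleR_conv_of_real)
qed

lemma smooth_cis: "smooth (\<lambda>\<xi>::real^'n. cis (y \<bullet> \<xi>))"
proof (rule smooth_coinduct[where P = "\<lambda>h. \<exists>c. h = (\<lambda>\<xi>. c * cis (y \<bullet> \<xi>))"])
  show "\<exists>c. (\<lambda>\<xi>. cis (y \<bullet> \<xi>)) = (\<lambda>\<xi>. c * cis (y \<bullet> \<xi>))" by (intro exI[of _ 1]) simp
next
  show "h differentiable at x" if "\<exists>c. h = (\<lambda>\<xi>. c * cis (y \<bullet> \<xi>))" for h x
    using that cis_has_derivative differentiable_def by blast
next
  fix h i assume "\<exists>c. h = (\<lambda>\<xi>. c * cis (y \<bullet> \<xi>))"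
  then obtain c where "h = (\<lambda>\<xi>. c * cis (y \<bullet> \<xi>))" ..
  then have "partial_deriv i h \<xi> = c * (of_real (y \<bullet> axis i 1) * \<i>) * cis (y \<bullet> \<xi>)" for \<xi>
    using partial_deriv_eqI[OF cis_has_derivative, of i c y \<xi>] by (simp add: ac_simps)
  then show "\<exists>c. partial_deriv i h = (\<lambda>\<xi>. c * cis (y \<bullet> \<xi>))" by blast
qed

lemma smooth_norm_sq: "smooth (\<lambda>x::real^'n. (norm x)\<^sup>2)"
proof -
  have "(\<lambda>x::real^'n. (norm x)\<^sup>2) = (\<lambda>x. \<Sum>i\<in>UNIV. x $ i * x $ i)"
    by (simp add: power2_norm_eq_inner inner_vec_def)
  then show ?thesis by (simp add: smooth_sum smooth_mult smooth_component)
qed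

lemma partial_deriv_zero_outside:
  assumes "x \<notin> closure {x. f x \<noteq> 0}"
  shows "partial_deriv i f x = 0"
proof -
  have "partial_deriv i f x = partial_deriv i (\<lambda>_. 0) x"
    by (rule partial_deriv_cong_open[of "- closure {x. f x \<noteq> 0}"])
      (use assms closure_subset[of "{x. f x \<noteq> 0}"] in auto)
  then show ?thesis by (simp add: partial_deriv_eqI[OF has_derivative_const])
qed

lemma support_partial_deriv:
  "closure {x. partial_deriv i f x \<noteq> 0} \<subseteq> closure {x. f x \<noteq> 0}"
  by (rule closure_minimal) (use partial_deriv_zero_outside in auto)

lemma support_iterated_partial:
  "closure {x. iterated_partial js f x \<noteq> 0} \<subseteq> closure {x. f x \<noteq> 0}"
proof (induction js)
  case (Cons j js)
  then show ?case
    using support_partial_deriv[of j "iterated_partial js f"] by (simp add: iterated_partial_def)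
qed (simp add: iterated_partial_def)

text \<open>The i-th derivative of |x|^a f is |x|^(a-2) (a x_i f + |x|^2 f_i), with f_i the i-th
  partial of f, and the bracket is again smooth and zero near the origin. Hence these products, with
  a ranging over all reals, form a class closed under differentiation. The case of interest is a
  negative power times a Littlewood--Paley function.\<close>

lemma smooth_norm_powr_mult:
  fixes f :: "real^'n \<Rightarrow> real"
  assumes "smooth f" "0 \<notin> closure {x. f x \<noteq> 0}"
  shows "smooth (\<lambda>x. norm x powr a * f x)"
proof -
  let ?Q = "\<lambda>f::real^'n \<Rightarrow> real. smooth f \<and> 0 \<notin> closure {x. f x \<noteq> 0}"
  let ?g = "\<lambda>a i f (x::real^'n). a * (x $ i * f x) + (norm x)\<^sup>2 * partial_deriv i f x"
  have Qg: "?Q (?g a i f)" if "?Q f" for f a i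
  proof
    show "smooth (?g a i f)"
      using that
      by (intro smooth_add smooth_mult smooth_const smooth_component smooth_norm_sq)
        (auto intro: smooth_partial_deriv)
    have "closure {x. ?g a i f x \<noteq> 0} \<subseteq> closure {x. f x \<noteq> 0}"
    proof (rule closure_minimal)
      show "{x. ?g a i f x \<noteq> 0} \<subseteq> closure {x. f x \<noteq> 0}"
        using partial_deriv_zero_outside[of _ f i] closure_subset[of "{x. f x \<noteq> 0}"] by auto
    qed simp
    then show "0 \<notin> closure {x. ?g a i f x \<noteq> 0}" using that by auto
  qed
  have deriv: "(\<lambda>x. norm x powr a * f x) differentiable (at x) \<and>
    partial_deriv i (\<lambda>x. norm x powr a * f x) x = norm x powr (a - 2) * ?g a i f x"
    if "?Q f" for f a x i
  proof (cases "x = 0")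
    case True
    let ?U = "- closure {x. f x \<noteq> 0}"
    have 0: "norm y powr a * f y = 0" if "y \<in> ?U" for y
      using that closure_subset[of "{x. f x \<noteq> 0}"] by auto
    have "open ?U" "x \<in> ?U" using that True by auto
    from partial_deriv_cong_open[OF this 0 differentiable_const] True
    show ?thesis by (simp add: partial_deriv_eqI[OF has_derivative_const])
  next
    case False
    have n: "(norm has_derivative (\<lambda>h. h \<bullet> sgn x)) (at x)"
      using False by (rule has_derivative_norm)
    have p: "((\<lambda>x. norm x powr a) has_derivative (\<lambda>h. (h \<bullet> sgn x) * (a * norm x powr (a - 1)))) (at x)"
    proof -
      have "(*) (a * norm x powr (a - 1)) = (\<lambda>h. h * (a * norm x powr (a - 1)))"
        by auto
      then have "((\<lambda>t. t powr a) has_derivative (\<lambda>h. h * (a * norm x powr (a - 1)))) (at (norm x))"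
        using has_real_derivative_powr[of "norm x" a] False
        by (simp only: has_field_derivative_def zero_less_norm_iff) simp
      from has_derivative_compose[OF n this] show ?thesis .
    qed
    have m: "((\<lambda>x. norm x powr a * f x) has_derivative
        (\<lambda>h. norm x powr a * frechet_derivative f (at x) h
          + (h \<bullet> sgn x) * (a * norm x powr (a - 1)) * f x)) (at x)"
      using has_derivative_mult[OF p smooth_has_derivative] that by auto
    have s: "axis i 1 \<bullet> sgn x = x $ i / norm x"
      by (simp add: sgn_div_norm inner_axis' divide_inverse)
    have e1: "norm x powr a = norm x powr (a - 2) * (norm x)\<^sup>2"
      using False powr_add[of "norm x" "a - 2" 2] by simp
    have e2: "norm x powr (a - 1) / norm x = norm x powr (a - 2)"
      using False powr_diff[of "norm x" "a - 1" 1] by simp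
    have "partial_deriv i (\<lambda>x. norm x powr a * f x) x
        = norm x powr a * partial_deriv i f x + a * (x $ i * f x) * (norm x powr (a - 1) / norm x)"
      unfolding partial_deriv_eqI[OF m] s by (simp add: partial_deriv_def)
    then have "partial_deriv i (\<lambda>x. norm x powr a * f x) x = norm x powr (a - 2) * ?g a i f x"
      unfolding e1 e2 by (simp add: algebra_simps)
    then show ?thesis using m by (auto simp: differentiable_def)
  qed
  show ?thesis
  proof (rule smooth_coinduct[where P = "\<lambda>h. \<exists>a f. ?Q f \<and> h = (\<lambda>x. norm x powr a * f x)"])
    show "\<exists>b g. ?Q g \<and> (\<lambda>x. norm x powr a * f x) = (\<lambda>x. norm x powr b * g x)"
      by (rule exI[of _ a], rule exI[of _ f]) (simp add: assms)
  next
    fix h :: "real^'n \<Rightarrow> real" and x assume "\<exists>a f. ?Q f \<and> h = (\<lambda>x. norm x powr a * f x)"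
    then obtain a f where f: "?Q f" "h = (\<lambda>x. norm x powr a * f x)" by (elim exE conjE) simp
    show "h differentiable at x" unfolding f(2) using deriv[OF f(1)] by (rule conjunct1)
  next
    fix h :: "real^'n \<Rightarrow> real" and i assume "\<exists>a f. ?Q f \<and> h = (\<lambda>x. norm x powr a * f x)"
    then obtain a f where f: "?Q f" "h = (\<lambda>x. norm x powr a * f x)" by (elim exE conjE) simp
    have "partial_deriv i h = (\<lambda>x. norm x powr (a - 2) * ?g a i f x)"
      unfolding f(2) using deriv[OF f(1), of a _ i] by (intro ext) (rule conjunct2)
    then show "\<exists>a f. ?Q f \<and> partial_deriv i h = (\<lambda>x. norm x powr a * f x)"
      using Qg[OF f(1), of a i] by (intro exI[of _ "?g a i f"] exI[of _ "a - 2"]) (rule conjI)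
  qed
qed

text \<open>Since a < b, the open sets |x| < b and |x| > a cover the space, and on each of them
  \<open>h\<close> agrees with a smooth function. The companion \<open>f\<close> is existentially
  quantified in the coinduction class because it is differentiated along with
  \<open>h\<close>.\<close>

lemma smooth_glue_zero:
  fixes f h :: "real^'n \<Rightarrow> 'b::real_normed_vector"
  assumes f: "smooth f" and "a < b"
    and in_ball: "\<And>x. norm x < b \<Longrightarrow> h x = f x" and outside: "\<And>x. norm x > a \<Longrightarrow> h x = 0"
  shows "smooth h"
proof -
  let ?P = "\<lambda>h f. smooth f \<and> (\<forall>x. norm x < b \<longrightarrow> h x = f x) \<and> (\<forall>x. norm x > a \<longrightarrow> h x = 0)"
  have B: "open {x::real^'n. norm x < b}" and A: "open {x::real^'n. norm x > a}"
    by (auto intro!: open_Collect_less continuous_intros)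
  have inn: "h differentiable (at x)" "partial_deriv i h x = partial_deriv i f x"
    if "?P h f" "norm x < b"
    for f h :: "real^'n \<Rightarrow> 'b" and x i
    using partial_deriv_cong_open[OF B, of x h f] that smooth_differentiable[of f x] by auto
  have out: "h differentiable (at x)" "partial_deriv i h x = 0"
    if "?P h f" "norm x > a"
    for f h :: "real^'n \<Rightarrow> 'b" and x i
    using partial_deriv_cong_open[OF A, of x h "\<lambda>_. 0"] that
    by (auto simp: partial_deriv_eqI[OF has_derivative_const])
  show ?thesis
  proof (rule smooth_coinduct[where P = "\<lambda>h. \<exists>f. ?P h f"])
    show "\<exists>f. ?P h f" using f in_ball outside by (intro exI[of _ f]) auto
  next
    fix h :: "real^'n \<Rightarrow> 'b" and x
    assume "\<exists>f. ?P h f"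
    then obtain f where f: "?P h f" ..
    show "h differentiable (at x)"
      using inn(1)[OF f, of x] out(1)[OF f, of x] \<open>a < b\<close> by (cases "norm x < b") simp_all
  next
    fix h :: "real^'n \<Rightarrow> 'b" and i
    assume "\<exists>f. ?P h f"
    then obtain f where f: "?P h f" ..
    have "?P (partial_deriv i h) (partial_deriv i f)"
    proof (intro conjI allI impI)
      show "smooth (partial_deriv i f)" using f smooth_partial_deriv by (elim conjE)
    qed (rule inn(2)[OF f] out(2)[OF f], assumption)+
    then show "\<exists>f. ?P (partial_deriv i h) f" by (rule exI[of _ "partial_deriv i f"])
  qed
qed


section \<open>Schwartz functions\<close>

lemma schwartz_smooth: "schwartz f \<Longrightarrow> smooth f"
  by (simp add: schwartz_def)

lemma schwartz_partial_deriv: "schwartz f \<Longrightarrow> schwartz (partial_deriv i f)"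
  by (simp add: schwartz_def smooth_partial_deriv iterated_partial_partial_deriv)

lemma schwartz_bound:
  assumes "schwartz f"
  obtains C where "0 < C" "\<And>x. (1 + norm x) ^ k * norm (f x) \<le> C"
proof -
  have "bounded (range (\<lambda>x. (1 + norm x) ^ k *\<^sub>R iterated_partial [] f x))"
    using assms unfolding schwartz_def by blast
  then obtain C where "0 < C" "\<And>x. norm ((1 + norm x) ^ k *\<^sub>R f x) \<le> C"
    unfolding bounded_pos iterated_partial_def by auto
  then show thesis using that[of C] by simp
qed

lemma iterated_partial_diff:
  assumes "smooth f" "smooth g"
  shows "iterated_partial js (\<lambda>x. f x - g x) = (\<lambda>x. iterated_partial js f x - iterated_partial js g x)"
proof (induction js)
  case (Cons j js)
  have "smooth (iterated_partial js f)" "smooth (iterated_partial js g)"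
    using assms by (simp_all add: smooth_iterated_partial)
  then have "partial_deriv j (\<lambda>x. iterated_partial js f x - iterated_partial js g x)
     = (\<lambda>x. partial_deriv j (iterated_partial js f) x - partial_deriv j (iterated_partial js g) x)"
    by (intro ext partial_deriv_diff smooth_differentiable)
  then show ?case using Cons by (simp add: iterated_partial_def)
qed (simp add: iterated_partial_def)

lemma schwartz_diff:
  assumes "schwartz f" "schwartz g"
  shows "schwartz (\<lambda>x. f x - g x)"
proof -
  have "bounded (range (\<lambda>x. (1 + norm x) ^ k *\<^sub>R (iterated_partial js f x - iterated_partial js g x)))"
    for js k
  proof -
    have "bounded (range (\<lambda>x. (1 + norm x) ^ k *\<^sub>R iterated_partial js f x))"
      "bounded (range (\<lambda>x. (1 + norm x) ^ k *\<^sub>R iterated_partial js g x))"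
      using assms by (simp_all add: schwartz_def)
    from bounded_minus_comp[OF this] show ?thesis by (simp add: scaleR_diff_right)
  qed
  then show ?thesis using assms
    by (simp add: schwartz_def iterated_partial_diff smooth_diff)
qed

lemma schwartz_of_compact_support:
  assumes f: "smooth f" and c: "compact (closure {x. f x \<noteq> 0})"
  shows "schwartz f"
  unfolding schwartz_def
proof (intro conjI f allI)
  fix js and k :: nat
  let ?D = "\<lambda>x. (1 + norm x) ^ k *\<^sub>R iterated_partial js f x"
  let ?S = "closure {x. f x \<noteq> 0}"
  have "continuous_on ?S ?D"
    using smooth_continuous_on[OF smooth_iterated_partial[OF f]] by (intro continuous_intros)
  then have "bounded (insert 0 (?D ` ?S))"
    using compact_imp_bounded[OF compact_continuous_image[OF _ c]] by simp
  moreover have "?D x = 0" if "x \<notin> ?S" for x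
  proof -
    have "x \<notin> closure {x. iterated_partial js f x \<noteq> 0}"
      using that support_iterated_partial[of js f] by blast
    then show ?thesis using closure_subset[of "{x. iterated_partial js f x \<noteq> 0}"] by auto
  qed
  then have "range ?D \<subseteq> insert 0 (?D ` ?S)" by blast
  ultimately show "bounded (range ?D)" by (rule bounded_subset)
qed

section \<open>Integration on Euclidean space\<close>

lemma borel_measurable_cis [measurable]: "cis \<in> borel_measurable borel"
  by (intro borel_measurable_continuous_onI continuous_intros)

lemma lborel_Fubini:
  fixes f :: "'a::euclidean_space \<Rightarrow> 'b::euclidean_space \<Rightarrow> complex"
  assumes m [measurable]: "case_prod f \<in> borel_measurable (borel \<Otimes>\<^sub>M borel)"
    and fin: "(\<integral>\<^sup>+x. \<integral>\<^sup>+y. norm (f x y) \<partial>lborel \<partial>lborel) < \<infinity>"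
  shows "integrable lborel (\<lambda>x. LINT y|lborel. f x y)"
    and "integrable lborel (\<lambda>y. LINT x|lborel. f x y)"
    and "(LINT y|lborel. LINT x|lborel. f x y) = (LINT x|lborel. LINT y|lborel. f x y)"
proof -
  have mm: "case_prod f \<in> borel_measurable (lborel \<Otimes>\<^sub>M lborel)" by measurable
  have I: "integrable (lborel \<Otimes>\<^sub>M lborel) (case_prod f)"
  proof (rule integrableI_bounded[OF mm])
    have "(\<integral>\<^sup>+z. norm (case_prod f z) \<partial>(lborel \<Otimes>\<^sub>M lborel))
        = (\<integral>\<^sup>+x. \<integral>\<^sup>+y. norm (f x y) \<partial>lborel \<partial>lborel)"
      by (subst lborel.nn_integral_fst[symmetric]) (use mm in auto)
    then show "(\<integral>\<^sup>+z. norm (case_prod f z) \<partial>(lborel \<Otimes>\<^sub>M lborel)) < \<infinity>" using fin by simp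
  qed
  show "integrable lborel (\<lambda>x. LINT y|lborel. f x y)"
    using lborel_pair.integrable_fst[OF I] .
  show "integrable lborel (\<lambda>y. LINT x|lborel. f x y)"
    using lborel_pair.integrable_snd[OF I] .
  show "(LINT y|lborel. LINT x|lborel. f x y) = (LINT x|lborel. LINT y|lborel. f x y)"
    using lborel_pair.Fubini_integral[OF I] .
qed

lemma nn_integral_lborel_affine:
  fixes f :: "'a::euclidean_space \<Rightarrow> ennreal"
  assumes [measurable]: "f \<in> borel_measurable borel" and "c \<noteq> 0"
  shows "(\<integral>\<^sup>+x. f x \<partial>lborel) = ennreal (\<bar>c\<bar> ^ DIM('a)) * (\<integral>\<^sup>+x. f (t + c *\<^sub>R x) \<partial>lborel)"
proof -
  have "(\<integral>\<^sup>+x. f x \<partial>lborel)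
      = (\<integral>\<^sup>+x. f x \<partial>density (distr lborel borel (\<lambda>x. t + c *\<^sub>R x)) (\<lambda>_. \<bar>c\<bar> ^ DIM('a)))"
    using lborel_affine[OF assms(2), of t] by simp
  also have "\<dots> = ennreal (\<bar>c\<bar> ^ DIM('a)) * (\<integral>\<^sup>+x. f (t + c *\<^sub>R x) \<partial>lborel)"
    by (simp add: nn_integral_density nn_integral_distr nn_integral_cmult ennreal_power)
  finally show ?thesis .
qed

lemma integral_lborel_affine:
  fixes f :: "'a::euclidean_space \<Rightarrow> complex"
  assumes [measurable]: "f \<in> borel_measurable borel" and "c \<noteq> 0"
  shows "(LINT x|lborel. f x) = of_real (\<bar>c\<bar> ^ DIM('a)) * (LINT x|lborel. f (t + c *\<^sub>R x))"
proof -
  have "(LINT x|lborel. f x)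
      = (LINT x|density (distr lborel borel (\<lambda>x. t + c *\<^sub>R x)) (\<lambda>_. \<bar>c\<bar> ^ DIM('a)). f x)"
    using lborel_affine[OF assms(2), of t] by (simp add: ennreal_power)
  also have "\<dots> = of_real (\<bar>c\<bar> ^ DIM('a)) * (LINT x|lborel. f (t + c *\<^sub>R x))"
    by (simp add: integral_density integral_distr scaleR_conv_of_real)
  finally show ?thesis .
qed

lemma nn_integral_lborel_reflect:
  fixes f :: "'a::euclidean_space \<Rightarrow> ennreal"
  assumes "f \<in> borel_measurable borel"
  shows "(\<integral>\<^sup>+x. f (a - x) \<partial>lborel) = (\<integral>\<^sup>+x. f x \<partial>lborel)"
  using nn_integral_lborel_affine[OF assms, of "-1" a] by simp

lemma nn_integral_lborel_translate:
  fixes f :: "'a::euclidean_space \<Rightarrow> ennreal"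
  assumes "f \<in> borel_measurable borel"
  shows "(\<integral>\<^sup>+x. f (x - a) \<partial>lborel) = (\<integral>\<^sup>+x. f x \<partial>lborel)"
  using nn_integral_lborel_affine[OF assms, of 1 "-a"] by simp

lemma integral_lborel_translate:
  fixes f :: "'a::euclidean_space \<Rightarrow> complex"
  assumes "f \<in> borel_measurable borel"
  shows "(LINT x|lborel. f (x + a)) = (LINT x|lborel. f x)"
  using integral_lborel_affine[OF assms, of 1 a] by (simp add: add.commute)

section \<open>Products over the coordinates and an integrable weight\<close>

lemma nn_integral_lborel_vec_prod:
  fixes f :: "real \<Rightarrow> ennreal"
  assumes [measurable]: "f \<in> borel_measurable borel"
  shows "(\<integral>\<^sup>+x. (\<Prod>i\<in>UNIV. f ((x::real^'n) $ i)) \<partial>lborel) = (\<integral>\<^sup>+t. f t \<partial>lborel) ^ CARD('n)"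
proof -
  have B: "(Basis :: (real^'n) set) = range (\<lambda>i. axis i 1)" by (auto simp: Basis_vec_def)
  have inj: "inj (\<lambda>i::'n. axis i (1::real))" by (auto simp: inj_on_def axis_eq_axis)
  have "(\<integral>\<^sup>+x. (\<Prod>i\<in>UNIV. f ((x::real^'n) $ i)) \<partial>lborel)
      = (\<integral>\<^sup>+x. (\<Prod>b\<in>Basis. f ((x::real^'n) \<bullet> b)) \<partial>lborel)"
    unfolding B by (simp add: prod.reindex[OF inj] cart_eq_inner_axis)
  also have "\<dots> = (\<Prod>b\<in>(Basis::(real^'n) set). \<integral>\<^sup>+t. f t \<partial>lborel)"
    by (rule nn_integral_lborel_prod) auto
  finally show ?thesis by simp
qed

lemma integral_lborel_vec_prod:
  fixes f :: "'n::finite \<Rightarrow> real \<Rightarrow> complex"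
  assumes i: "\<And>i. integrable lborel (f i)"
  shows "(LINT x|lborel. (\<Prod>i\<in>UNIV. f i ((x::real^'n) $ i))) = (\<Prod>i\<in>UNIV. LINT t|lborel. f i t)"
proof -
  interpret product_sigma_finite "\<lambda>_::real^'n. lborel::real measure" by standard
  have B: "(Basis :: (real^'n) set) = range (\<lambda>i. axis i 1)" by (auto simp: Basis_vec_def)
  have inj: "inj (\<lambda>i::'n. axis i (1::real))" by (auto simp: inj_on_def axis_eq_axis)
  have [measurable]: "f i \<in> borel_measurable borel" for i using i[of i] by auto
  \<comment> \<open>The product measure is indexed by basis vectors, the factors by coordinates;
    \<open>g\<close> carries the latter over along \<open>axis i 1\<close>.\<close>
  define g where "g b = f (inv (\<lambda>i::'n. axis i (1::real)) b)" for b
  have g: "g (axis i 1) = f i" for i by (simp add: g_def inv_f_f[OF inj])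
  have m: "(\<lambda>f. \<Sum>b\<in>(Basis::(real^'n) set). f b *\<^sub>R b) \<in> (\<Pi>\<^sub>M b\<in>Basis. lborel) \<rightarrow>\<^sub>M borel"
    by measurable
  have "(LINT x|lborel. (\<Prod>i\<in>UNIV. f i ((x::real^'n) $ i)))
      = (LINT h|(\<Pi>\<^sub>M b\<in>(Basis::(real^'n) set). lborel). (\<Prod>i\<in>UNIV. f i ((\<Sum>b\<in>Basis. h b *\<^sub>R b) $ i)))"
    unfolding lborel_eq[where 'a = "real^'n"] by (subst integral_distr[OF m]) auto
  also have "\<dots> = (LINT h|(\<Pi>\<^sub>M b\<in>(Basis::(real^'n) set). lborel). (\<Prod>b\<in>Basis. g b (h b)))"
  proof (rule Bochner_Integration.integral_cong)
    fix h :: "real^'n \<Rightarrow> real"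
    have "(\<Sum>b\<in>Basis. h b *\<^sub>R b) $ i = h (axis i 1)" for i
      using inner_sum_left_Basis[of "axis i 1 :: real^'n" h]
      by (simp add: cart_eq_inner_axis axis_in_Basis_iff)
    then show "(\<Prod>i\<in>UNIV. f i ((\<Sum>b\<in>Basis. h b *\<^sub>R b) $ i)) = (\<Prod>b\<in>Basis. g b (h b))"
      unfolding B by (simp add: prod.reindex[OF inj] g)
  qed simp
  also have "\<dots> = (\<Prod>b\<in>Basis. LINT t|lborel. g b t)"
    by (rule product_integral_prod) (auto simp: g_def i)
  also have "\<dots> = (\<Prod>i\<in>UNIV. LINT t|lborel. f i t)"
    unfolding B by (simp add: prod.reindex[OF inj] g)
  finally show ?thesis .
qed

text \<open>The product form serves twice: its integral reduces to one variable, and each factor 1 +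
  x_i^2 of the reciprocal corresponds under the Fourier transform to subtracting a second partial
  derivative.\<close>

definition decay_weight :: "real^'n \<Rightarrow> real" where
  "decay_weight x = (\<Prod>i\<in>UNIV. inverse (1 + (x $ i)\<^sup>2))"

lemma borel_measurable_decay_weight [measurable]: "decay_weight \<in> borel_measurable borel"
  unfolding decay_weight_def[abs_def] by measurable

lemma integrable_decay_weight: "integrable lborel (decay_weight :: real^'n \<Rightarrow> real)"
proof (rule integrableI_bounded)
  have "integrable lborel (\<lambda>t::real. inverse (1 + t\<^sup>2))"
    using integrable_inverse_1_plus_square by (simp add: set_integrable_def)
  then have 1: "(\<integral>\<^sup>+t. ennreal (inverse (1 + t\<^sup>2)) \<partial>(lborel::real measure)) < \<infinity>"
    by (auto simp: integrable_iff_bounded add_nonneg_nonneg)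
  have "(\<integral>\<^sup>+x. ennreal (norm (decay_weight (x::real^'n))) \<partial>lborel)
      = (\<integral>\<^sup>+x. (\<Prod>i\<in>UNIV. ennreal (inverse (1 + ((x::real^'n) $ i)\<^sup>2))) \<partial>lborel)"
    by (intro nn_integral_cong)
      (simp add: decay_weight_def prod_ennreal add_nonneg_nonneg abs_prod)
  also have "\<dots> < \<infinity>"
    using 1 by (subst nn_integral_lborel_vec_prod) (auto simp: power_less_top_ennreal)
  finally show "(\<integral>\<^sup>+x. ennreal (norm (decay_weight (x::real^'n))) \<partial>lborel) < \<infinity>" .
qed simp

lemma decay_weight_eq: "decay_weight x = inverse (\<Prod>i\<in>UNIV. 1 + (x $ i)\<^sup>2)"
  using prod_inversef[of "\<lambda>i. 1 + (x $ i)\<^sup>2" UNIV] by (simp add: decay_weight_def o_def)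

lemma integrable_of_decay:
  fixes f :: "real^'n \<Rightarrow> complex"
  assumes "f \<in> borel_measurable borel" and b: "\<And>x. norm (f x) \<le> C * decay_weight x"
  shows "integrable lborel f"
proof (rule Bochner_Integration.integrable_bound)
  show "integrable lborel (\<lambda>x::real^'n. C * decay_weight x)"
    by (intro integrable_mult_right integrable_decay_weight)
  show "AE x in lborel. norm (f x) \<le> norm (C * decay_weight x)"
    using b by (intro AE_I2) (simp add: order_trans[OF _ abs_ge_self])
qed (use assms in simp)

text \<open>Links the weight to the Schwartz seminorms, which use powers of 1 + |x|: each of the n
  factors 1 + x_i^2 is at most (1 + |x|)^2.\<close>

lemma inverse_power_le_decay_weight: "inverse ((1 + norm x) ^ (2 * CARD('n))) \<le> decay_weight (x::real^'n)"
proof -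
  have "(\<Prod>i\<in>UNIV. (1 + (x $ i)\<^sup>2)) \<le> (\<Prod>i\<in>(UNIV::'n set). (1 + norm x)\<^sup>2)"
  proof (rule prod_mono, safe)
    fix i
    have "(x $ i)\<^sup>2 \<le> (norm x)\<^sup>2"
      using component_le_norm_cart[of x i] by (metis abs_ge_zero power2_abs power_mono)
    then show "1 + (x $ i)\<^sup>2 \<le> (1 + norm x)\<^sup>2"
      using norm_ge_zero[of x] by (simp add: power2_sum del: norm_ge_zero)
  qed simp
  also have "\<dots> = (1 + norm x) ^ (2 * CARD('n))" by (simp add: power_mult)
  finally show ?thesis
    unfolding decay_weight_eq
    by (intro le_imp_inverse_le) (auto intro!: prod_pos simp: add_pos_nonneg)
qed


section \<open>The Fourier transform on the Schwartz space\<close>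

lemma fourier_lborel:
  assumes [measurable]: "f \<in> borel_measurable borel"
  shows "fourier f \<xi> = (LINT x|lborel. cis (- (x \<bullet> \<xi>)) * f x)"
  unfolding fourier_def by (intro integral_completion) measurable

lemma schwartz_borel_measurable: "schwartz f \<Longrightarrow> f \<in> borel_measurable borel"
  by (simp add: smooth_borel_measurable schwartz_smooth)

lemma schwartz_decay:
  fixes f :: "real^'n \<Rightarrow> complex"
  assumes "schwartz f"
  obtains C where "0 < C" "\<And>x. norm (f x) \<le> C * inverse ((1 + norm x) ^ (2 * CARD('n)))"
    "\<And>x. norm (f x) \<le> C * decay_weight x"
proof -
  obtain C where C: "0 < C" "\<And>x. (1 + norm x) ^ (2 * CARD('n)) * norm (f x) \<le> C"
    by (rule schwartz_bound[OF assms, of "2 * CARD('n)"]) blast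
  have 1: "norm (f x) \<le> C * inverse ((1 + norm x) ^ (2 * CARD('n)))" for x
  proof -
    have "0 < (1 + norm x) ^ (2 * CARD('n))" by (simp add: add_pos_nonneg)
    then show ?thesis using C(2)[of x] by (simp add: field_simps)
  qed
  have "norm (f x) \<le> C * decay_weight x" for x
    using 1[of x] mult_left_mono[OF inverse_power_le_decay_weight[of x], of C] C(1) by linarith
  then show thesis using that[OF C(1) 1] by blast
qed

lemma schwartz_integrable:
  assumes "schwartz f"
  shows "integrable lborel f"
proof -
  obtain C where "\<And>x. norm (f x) \<le> C * decay_weight x" by (rule schwartz_decay[OF assms]) blast
  then show ?thesis by (rule integrable_of_decay[OF schwartz_borel_measurable[OF assms]])
qed

lemma integrable_cis_mult:
  fixes f :: "'a::euclidean_space \<Rightarrow> complex"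
  assumes "integrable lborel f" and [measurable]: "g \<in> borel_measurable borel"
  shows "integrable lborel (\<lambda>x. cis (g x) * f x)"
proof -
  have [measurable]: "f \<in> borel_measurable borel" using assms(1) by auto
  show ?thesis
    by (rule Bochner_Integration.integrable_bound[OF assms(1)]) (auto simp: norm_mult)
qed

section \<open>Derivatives and decay of Fourier transforms\<close>

lemma borel_measurable_fourier:
  assumes [measurable]: "f \<in> borel_measurable borel"
  shows "fourier f \<in> borel_measurable borel"
  unfolding fourier_lborel[OF assms, abs_def] by measurable

lemma norm_fourier_le:
  assumes [measurable]: "f \<in> borel_measurable borel"
  shows "norm (fourier f \<xi>) \<le> (LINT x|lborel. norm (f x))"
  unfolding fourier_lborel[OF assms]
  by (rule order_trans[OF integral_norm_bound]) (simp add: norm_mult)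

lemma fourier_diff:
  assumes "integrable lborel f" "integrable lborel g"
  shows "fourier (\<lambda>x. f x - g x) \<xi> = fourier f \<xi> - fourier g \<xi>"
proof -
  have [measurable]: "f \<in> borel_measurable borel" "g \<in> borel_measurable borel" using assms by auto
  have "integrable lborel (\<lambda>x. cis (- (x \<bullet> \<xi>)) * f x)" "integrable lborel (\<lambda>x. cis (- (x \<bullet> \<xi>)) * g x)"
    by (intro integrable_cis_mult assms; measurable)+
  then show ?thesis by (simp add: fourier_lborel right_diff_distrib)
qed

text \<open>An integrable majorant of the difference quotients that does not depend on the step, as
  dominated convergence in \<open>fourier_partial_deriv\<close> requires.\<close>

lemma schwartz_increment_bound:
  fixes f :: "real^'n \<Rightarrow> complex"
  assumes f: "schwartz f"
  obtains C where "0 < C"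
    "\<And>x t. 0 < t \<Longrightarrow> t \<le> 1 \<Longrightarrow> norm (f (x + t *\<^sub>R axis i 1) - f x) \<le> t * (C * decay_weight x)"
proof -
  let ?N = "2 * CARD('n)"
  obtain C where C: "0 < C"
    "\<And>x. norm (partial_deriv i f x) \<le> C * inverse ((1 + norm x) ^ (2 * CARD('n)))"
    using schwartz_decay[OF schwartz_partial_deriv[OF f]] by metis
  have "norm (f (x + t *\<^sub>R axis i 1) - f x) \<le> t * (C * 2 ^ ?N * decay_weight x)"
    if t: "0 < t" "t \<le> 1" for x :: "real^'n" and t
  proof -
    have d: "((\<lambda>s. f (x + s *\<^sub>R axis i 1)) has_derivative (\<lambda>h. h *\<^sub>R partial_deriv i f (x + s *\<^sub>R axis i 1))) (at s)"
      for s
    proof -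
      have 1: "((\<lambda>s. x + s *\<^sub>R axis i 1) has_derivative (\<lambda>h. h *\<^sub>R axis i 1)) (at s)"
        by (auto intro!: derivative_eq_intros)
      note 2 = smooth_has_derivative[OF schwartz_smooth[OF f], of "x + s *\<^sub>R axis i 1"]
      show ?thesis
        using has_derivative_compose[OF 1 2] linear_scale[OF has_derivative_linear[OF 2]]
        by (simp add: partial_deriv_def)
    qed
    have c: "continuous_on {0..t} (\<lambda>s. f (x + s *\<^sub>R axis i 1))"
      using d has_derivative_continuous by (intro continuous_at_imp_continuous_on) blast
    obtain s where s: "s \<in> {0<..<t}"
      "norm (f (x + t *\<^sub>R axis i 1) - f (x + 0 *\<^sub>R axis i 1)) \<le> norm ((t - 0) *\<^sub>R partial_deriv i f (x + s *\<^sub>R axis i 1))"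
      using mvt_general[OF t(1) c d] by blast
    let ?y = "x + s *\<^sub>R axis i 1"
    \<comment> \<open>As the step is at most 1, passing to the intermediate point changes 1 + |x| by
      a factor of at most 2. This costs 2^(2n) in the constant.\<close>
    have "norm x \<le> norm ?y + norm (s *\<^sub>R (axis i 1 :: real^'n))"
      by (metis add_diff_cancel_right' norm_triangle_ineq4)
    then have "1 + norm x \<le> 2 * (1 + norm ?y)"
      using s(1) t norm_ge_zero[of ?y] by (simp del: norm_ge_zero)
    then have "(1 + norm x) ^ ?N \<le> (2 * (1 + norm ?y)) ^ ?N"
      by (intro power_mono) auto
    then have "(1 + norm x) ^ ?N \<le> 2 ^ ?N * (1 + norm ?y) ^ ?N" by (simp only: power_mult_distrib)
    moreover have "0 < (1 + norm x) ^ ?N" "0 < (1 + norm ?y) ^ ?N" by (auto simp: add_pos_nonneg)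
    ultimately have "inverse ((1 + norm ?y) ^ ?N) \<le> 2 ^ ?N * inverse ((1 + norm x) ^ ?N)"
      by (simp add: divide_simps del: power_mult_distrib)
    then have "C * inverse ((1 + norm ?y) ^ ?N) \<le> C * (2 ^ ?N * decay_weight x)"
      using C(1) inverse_power_le_decay_weight[of x]
      by (intro mult_left_mono) (auto intro: order_trans mult_left_mono)
    then have "norm (partial_deriv i f ?y) \<le> C * 2 ^ ?N * decay_weight x"
      using C(2)[of ?y] by simp
    then have "t * norm (partial_deriv i f ?y) \<le> t * (C * 2 ^ ?N * decay_weight x)"
      using t by (intro mult_left_mono) auto
    moreover have "norm (f (x + t *\<^sub>R axis i 1) - f x) \<le> t * norm (partial_deriv i f ?y)"
      using s(2) t by simp
    ultimately show ?thesis by (rule order_trans[rotated])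
  qed
  then show thesis using that[of "C * 2 ^ ?N"] C(1) by simp
qed

text \<open>Difference quotients replace integration by parts: by translation invariance the
  transform of a quotient with step t is exactly (cis (t \<xi>_i) - 1) / t times the transform of
  \<open>f\<close>, and both sides converge as t tends to 0.\<close>

lemma fourier_partial_deriv:
  fixes f :: "real^'n \<Rightarrow> complex"
  assumes f: "schwartz f"
  shows "fourier (partial_deriv i f) \<xi> = \<i> * of_real (\<xi> $ i) * fourier f \<xi>"
proof -
  have [measurable]: "f \<in> borel_measurable borel" "partial_deriv i f \<in> borel_measurable borel"
    using f by (auto intro: schwartz_borel_measurable schwartz_partial_deriv)
  define e where "e = (axis i 1 :: real^'n)"
  define t where "t k = 1 / real (Suc k)" for k
  have t: "0 < t k" "t k \<le> 1" for k by (auto simp: t_def)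
  have tlim: "t \<longlonglongrightarrow> 0" using LIMSEQ_inverse_real_of_nat by (simp add: t_def[abs_def] inverse_eq_divide)
  then have tlim': "filterlim t (at 0) sequentially"
    using t(1) by (auto simp: filterlim_at intro!: always_eventually) (metis less_irrefl)
  obtain C where C: "0 < C"
    "\<And>x t. 0 < t \<Longrightarrow> t \<le> 1 \<Longrightarrow> norm (f (x + t *\<^sub>R e) - f x) \<le> t * (C * decay_weight x)"
    using schwartz_increment_bound[OF f, of i] unfolding e_def by metis
  define s where "s k x = cis (- (x \<bullet> \<xi>)) * ((f (x + t k *\<^sub>R e) - f x) /\<^sub>R t k)" for k x
  have fi: "integrable lborel f" using schwartz_integrable[OF f] .
  have int_s: "(LINT x|lborel. s k x) = (cis (t k * \<xi> $ i) - 1) / of_real (t k) * fourier f \<xi>" for k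
  proof -
    have "integrable lborel (\<lambda>x. f (x + t k *\<^sub>R e))"
    proof (rule integrableI_bounded)
      have "(\<integral>\<^sup>+x. norm (f (x + t k *\<^sub>R e)) \<partial>lborel) = (\<integral>\<^sup>+x. norm (f x) \<partial>lborel)"
        using nn_integral_lborel_translate[of "\<lambda>x. ennreal (norm (f x))" "- t k *\<^sub>R e"] by simp
      then show "(\<integral>\<^sup>+x. norm (f (x + t k *\<^sub>R e)) \<partial>lborel) < \<infinity>"
        using fi by (simp add: integrable_iff_bounded)
    qed measurable
    then have i: "integrable lborel (\<lambda>x. cis (- (x \<bullet> \<xi>)) * f (x + t k *\<^sub>R e))"
      "integrable lborel (\<lambda>x. cis (- (x \<bullet> \<xi>)) * f x)"
      using fi by (auto intro!: integrable_cis_mult)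
    have "(LINT x|lborel. cis (- (x \<bullet> \<xi>)) * f (x + t k *\<^sub>R e))
       = (LINT x|lborel. cis (t k * \<xi> $ i) * (cis (- ((x + t k *\<^sub>R e) \<bullet> \<xi>)) * f (x + t k *\<^sub>R e)))"
    proof (intro Bochner_Integration.integral_cong refl)
      fix x
      have "cis (t k * \<xi> $ i) * cis (- ((x + t k *\<^sub>R e) \<bullet> \<xi>)) = cis (- (x \<bullet> \<xi>))"
        by (simp add: cis_mult e_def inner_axis' inner_add_left)
      then show "cis (- (x \<bullet> \<xi>)) * f (x + t k *\<^sub>R e)
          = cis (t k * \<xi> $ i) * (cis (- ((x + t k *\<^sub>R e) \<bullet> \<xi>)) * f (x + t k *\<^sub>R e))"
        by (simp add: mult.assoc[symmetric])
    qed
    also have "\<dots> = cis (t k * \<xi> $ i) * (LINT x|lborel. cis (- (x \<bullet> \<xi>)) * f x)"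
      by (subst integral_lborel_translate[symmetric, of _ "t k *\<^sub>R e"]) (simp_all)
    finally have "(LINT x|lborel. cis (- (x \<bullet> \<xi>)) * f (x + t k *\<^sub>R e)) = cis (t k * \<xi> $ i) * fourier f \<xi>"
      by (simp add: fourier_lborel)
    then have "(LINT x|lborel. cis (- (x \<bullet> \<xi>)) * f (x + t k *\<^sub>R e) - cis (- (x \<bullet> \<xi>)) * f x)
        = (cis (t k * \<xi> $ i) - 1) * fourier f \<xi>"
      using i by (simp add: fourier_lborel left_diff_distrib)
    moreover have "s k x = (cis (- (x \<bullet> \<xi>)) * f (x + t k *\<^sub>R e) - cis (- (x \<bullet> \<xi>)) * f x) / of_real (t k)" for x
      by (simp add: s_def scaleR_conv_of_real divide_inverse algebra_simps)
    ultimately show ?thesis by simp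
  qed
  have "(\<lambda>k. LINT x|lborel. s k x) \<longlonglongrightarrow> (LINT x|lborel. cis (- (x \<bullet> \<xi>)) * partial_deriv i f x)"
  proof (rule integral_dominated_convergence)
    show "integrable lborel (\<lambda>x::real^'n. C * decay_weight x)"
      by (intro integrable_mult_right integrable_decay_weight)
    show "AE x in lborel. (\<lambda>k. s k x) \<longlonglongrightarrow> cis (- (x \<bullet> \<xi>)) * partial_deriv i f x"
    proof (rule AE_I2)
      fix x
      have 1: "((\<lambda>s. x + s *\<^sub>R e) has_derivative (\<lambda>h. h *\<^sub>R e)) (at 0)"
        by (auto intro!: derivative_eq_intros)
      have 2: "(f has_derivative frechet_derivative f (at x)) (at (x + 0 *\<^sub>R e))"
        using smooth_has_derivative[OF schwartz_smooth[OF f], of x] by simp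
      have "((\<lambda>s. f (x + s *\<^sub>R e)) has_vector_derivative partial_deriv i f x) (at 0)"
        using has_derivative_compose[OF 1 2] linear_scale[OF has_derivative_linear[OF 2]]
        by (simp add: partial_deriv_def has_vector_derivative_def e_def)
      then have "((\<lambda>h. norm (f (x + h *\<^sub>R e) - f x - h *\<^sub>R partial_deriv i f x) / \<bar>h\<bar>) \<longlongrightarrow> 0) (at 0)"
        by (simp add: has_vector_derivative_def has_derivative_at)
      moreover have "norm (f (x + h *\<^sub>R e) - f x - h *\<^sub>R partial_deriv i f x) / \<bar>h\<bar>
          = norm ((f (x + h *\<^sub>R e) - f x) /\<^sub>R h - partial_deriv i f x)" if "h \<noteq> 0" for h
      proof -
        have "(f (x + h *\<^sub>R e) - f x) /\<^sub>R h - partial_deriv i f x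
            = (f (x + h *\<^sub>R e) - f x - h *\<^sub>R partial_deriv i f x) /\<^sub>R h"
          using that by (simp add: scaleR_diff_right)
        then show ?thesis by (simp add: divide_inverse_commute)
      qed
      then have "\<forall>\<^sub>F h in at 0. norm (f (x + h *\<^sub>R e) - f x - h *\<^sub>R partial_deriv i f x) / \<bar>h\<bar>
          = norm ((f (x + h *\<^sub>R e) - f x) /\<^sub>R h - partial_deriv i f x)"
        by (auto simp: eventually_at_filter)
      ultimately have "((\<lambda>h. norm ((f (x + h *\<^sub>R e) - f x) /\<^sub>R h - partial_deriv i f x)) \<longlongrightarrow> 0) (at 0)"
        by (rule Lim_transform_eventually)
      then have lim: "((\<lambda>h. (f (x + h *\<^sub>R e) - f x) /\<^sub>R h) \<longlongrightarrow> partial_deriv i f x) (at 0)"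
        by (rule LIM_zero_cancel[OF tendsto_norm_zero_cancel])
      have "(\<lambda>k. (f (x + t k *\<^sub>R e) - f x) /\<^sub>R t k) \<longlonglongrightarrow> partial_deriv i f x"
        by (rule filterlim_compose[OF lim tlim'])
      then show "(\<lambda>k. s k x) \<longlonglongrightarrow> cis (- (x \<bullet> \<xi>)) * partial_deriv i f x"
        unfolding s_def by (intro tendsto_intros)
    qed
    show "AE x in lborel. norm (s k x) \<le> C * decay_weight x" for k
    proof (rule AE_I2)
      fix x
      have "norm (f (x + t k *\<^sub>R e) - f x) \<le> t k * (C * decay_weight x)"
        using C(2) t by blast
      moreover have "norm (s k x) = norm (f (x + t k *\<^sub>R e) - f x) / t k"
        using t(1)[of k] by (simp add: s_def norm_mult divide_inverse_commute)
      ultimately show "norm (s k x) \<le> C * decay_weight x"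
        using t(1)[of k] by (simp add: pos_divide_le_eq mult.commute)
    qed
    show "s k \<in> borel_measurable lborel" for k unfolding s_def[abs_def] by measurable
  qed measurable
  then have "(\<lambda>k. (cis (t k * \<xi> $ i) - 1) / of_real (t k) * fourier f \<xi>) \<longlonglongrightarrow> fourier (partial_deriv i f) \<xi>"
    by (simp add: int_s fourier_lborel)
  moreover have "(\<lambda>k. (cis (t k * \<xi> $ i) - 1) / of_real (t k) * fourier f \<xi>) \<longlonglongrightarrow> \<i> * of_real (\<xi> $ i) * fourier f \<xi>"
  proof -
    have "((\<lambda>z. exp (\<i> * of_real (\<xi> $ i) * z)) has_field_derivative \<i> * of_real (\<xi> $ i)) (at 0)"
      by (auto intro!: derivative_eq_intros)
    then have "((\<lambda>z. (exp (\<i> * of_real (\<xi> $ i) * z) - 1) / z) \<longlongrightarrow> \<i> * of_real (\<xi> $ i)) (at 0)"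
      by (simp add: has_field_derivative_iff)
    moreover have "filterlim (\<lambda>k. complex_of_real (t k)) (at 0) sequentially"
      using tendsto_of_real[OF tlim] t(1) 
      by (auto simp: filterlim_at intro!: always_eventually) (metis less_irrefl)
    ultimately have "(\<lambda>k. (exp (\<i> * of_real (\<xi> $ i) * of_real (t k)) - 1) / of_real (t k)) \<longlonglongrightarrow> \<i> * of_real (\<xi> $ i)"
      by (rule filterlim_compose)
    then have "(\<lambda>k. (cis (t k * \<xi> $ i) - 1) / of_real (t k)) \<longlonglongrightarrow> \<i> * of_real (\<xi> $ i)"
      by (simp add: cis_conv_exp ac_simps)
    then show ?thesis by (intro tendsto_intros)
  qed
  ultimately show ?thesis using LIMSEQ_unique by blast
qed

text \<open>Subtracting from \<open>f\<close> its second i-th partial multiplies the transform by 1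
  + \<xi>_i^2, and every transform of a Schwartz function is bounded. Induction on the set of
  coordinates gains one factor of the weight at a time, with \<open>f\<close> varying in the
  induction.\<close>

lemma schwartz_fourier_decay:
  fixes f :: "real^'n \<Rightarrow> complex"
  assumes "schwartz f"
  obtains C where "0 < C" "\<And>\<xi>. norm (fourier f \<xi>) \<le> C * decay_weight \<xi>"
proof -
  have fin: "\<exists>C. \<forall>\<xi>. (\<Prod>i\<in>A. 1 + (\<xi> $ i)\<^sup>2) * norm (fourier f \<xi>) \<le> C" if "finite A" "schwartz f"
    for A and f :: "real^'n \<Rightarrow> complex"
    using that
  proof (induction A arbitrary: f)
    case empty
    then show ?case using norm_fourier_le[OF schwartz_borel_measurable] by auto
  next
    case (insert i A)
    let ?g = "\<lambda>x. f x - partial_deriv i (partial_deriv i f) x"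
    have p: "schwartz (partial_deriv i f)" "schwartz (partial_deriv i (partial_deriv i f))"
      using insert.prems by (auto intro: schwartz_partial_deriv)
    then have "schwartz ?g" using schwartz_diff insert.prems by blast
    then obtain C where C: "\<And>\<xi>. (\<Prod>i\<in>A. 1 + (\<xi> $ i)\<^sup>2) * norm (fourier ?g \<xi>) \<le> C"
      using insert.IH by blast
    have "fourier ?g \<xi> = of_real (1 + (\<xi> $ i)\<^sup>2) * fourier f \<xi>" for \<xi>
      using p insert.prems
      by (simp add: fourier_diff schwartz_integrable fourier_partial_deriv algebra_simps power2_eq_square)
    then have "norm (fourier ?g \<xi>) = (1 + (\<xi> $ i)\<^sup>2) * norm (fourier f \<xi>)" for \<xi>
      by (simp only: norm_mult norm_of_real) simp
    then show ?case using C insert.hyps by (auto simp: mult_ac)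
  qed
  from fin[of UNIV f] assms obtain C
    where C: "\<And>\<xi>. (\<Prod>i\<in>UNIV. 1 + (\<xi> $ i)\<^sup>2) * norm (fourier f \<xi>) \<le> C" by auto
  have "norm (fourier f \<xi>) \<le> (\<bar>C\<bar> + 1) * decay_weight \<xi>" for \<xi>
  proof -
    have "0 < (\<Prod>i\<in>UNIV. 1 + (\<xi> $ i)\<^sup>2)" by (intro prod_pos) (auto simp: add_pos_nonneg)
    moreover have "(\<Prod>i\<in>UNIV. 1 + (\<xi> $ i)\<^sup>2) * norm (fourier f \<xi>) \<le> \<bar>C\<bar> + 1"
      using C[of \<xi>] by linarith
    ultimately show ?thesis
      unfolding decay_weight_eq
      by (simp only: divide_inverse[symmetric] pos_le_divide_eq mult.commute)
  qed
  then show thesis using that[of "\<bar>C\<bar> + 1"] by simp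
qed

lemma schwartz_fourier_integrable:
  fixes f :: "real^'n \<Rightarrow> complex"
  assumes "schwartz f"
  shows "integrable lborel (fourier f)"
proof -
  obtain C where C: "\<And>\<xi>. norm (fourier f \<xi>) \<le> C * decay_weight \<xi>"
    by (rule schwartz_fourier_decay[OF assms]) blast
  then show ?thesis
    by (rule integrable_of_decay[OF borel_measurable_fourier[OF schwartz_borel_measurable[OF assms]]])
qed

section \<open>Fourier inversion\<close>

text \<open>The standard Gaussian density. Written as a product of normal densities, it inherits its
  mass and its characteristic function from the one-variable normal distribution.\<close>

definition gauss :: "real^'n \<Rightarrow> real" where
  "gauss z = (\<Prod>i\<in>UNIV. std_normal_density (z $ i))"

lemma borel_measurable_gauss [measurable]: "gauss \<in> borel_measurable borel"
  unfolding gauss_def[abs_def] by measurable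

lemma sum_neg_half: "(\<Sum>i\<in>UNIV. - ((z::real^'n) $ i)\<^sup>2 / 2) = - (norm z)\<^sup>2 / 2"
proof -
  have "(\<Sum>i\<in>UNIV. (z $ i)\<^sup>2) = (norm z)\<^sup>2"
    unfolding power2_norm_eq_inner inner_vec_def by (simp add: power2_eq_square)
  then show ?thesis by (simp only: sum_negf sum_divide_distrib[symmetric])
qed

lemma exp_norm_eq_gauss: "exp (- (norm z)\<^sup>2 / 2) = sqrt (2 * pi) ^ CARD('n) * gauss (z :: real^'n)"
proof -
  have "gauss z = (\<Prod>i\<in>(UNIV::'n set). (1 / sqrt (2 * pi)) * exp (- (z $ i)\<^sup>2 / 2))"
    by (simp add: gauss_def std_normal_density_def)
  also have "\<dots> = (1 / sqrt (2 * pi)) ^ CARD('n) * exp (- (norm z)\<^sup>2 / 2)"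
    by (simp only: prod.distrib prod_constant exp_sum[OF finite, symmetric] sum_neg_half)
  finally show ?thesis by (simp add: power_divide)
qed

lemma gauss_nonneg: "0 \<le> gauss z"
  by (simp add: gauss_def prod_nonneg)

lemma nn_integral_gauss: "(\<integral>\<^sup>+z. ennreal (gauss (z :: real^'n)) \<partial>lborel) = 1"
proof -
  interpret prob_space std_normal_distribution
    by (rule prob_space_normal_density) simp
  have "(\<integral>\<^sup>+t. ennreal (std_normal_density t) \<partial>lborel) = 1"
    using emeasure_space_1 by (simp add: emeasure_density)
  moreover have "(\<integral>\<^sup>+z. ennreal (gauss (z :: real^'n)) \<partial>lborel)
    = (\<integral>\<^sup>+z. (\<Prod>i\<in>UNIV. ennreal (std_normal_density ((z :: real^'n) $ i))) \<partial>lborel)"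
    by (simp add: gauss_def prod_ennreal)
  ultimately show ?thesis by (subst (asm) nn_integral_lborel_vec_prod) auto
qed

lemma nn_integral_gauss_dilation:
  assumes "0 < \<epsilon>"
  shows "(\<integral>\<^sup>+z. ennreal (gauss (\<epsilon> *\<^sub>R (z :: real^'n))) \<partial>lborel) < \<infinity>"
  using assms
  by (subst nn_integral_lborel_affine[where c = "1 / \<epsilon>" and t = 0])
    (auto simp: nn_integral_gauss ennreal_mult_less_top)

lemma integrable_gauss: "integrable lborel (gauss :: real^'n \<Rightarrow> real)"
  by (rule integrableI_bounded) (simp_all add: gauss_nonneg nn_integral_gauss)

lemma integral_gauss: "(LINT z|lborel. gauss (z :: real^'n)) = 1"
  by (subst integral_eq_nn_integral) (simp_all add: gauss_nonneg nn_integral_gauss)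

lemma cis_inner: "cis (z \<bullet> w) = (\<Prod>i\<in>UNIV. cis (z $ i * w $ i))" for z w :: "real^'n"
  by (simp add: inner_vec_def cis_conv_exp sum_distrib_left exp_sum)

lemma gauss_char: "(LINT w|lborel. cis (z \<bullet> w) * of_real (gauss w)) = of_real (exp (- (norm (z :: real^'n))\<^sup>2 / 2))"
proof -
  have 1: "(LINT x|lborel. cis (t * x) * of_real (std_normal_density x)) = of_real (exp (- t\<^sup>2 / 2))" for t
  proof -
    have "char std_normal_distribution t = (LINT x|lborel. cis (t * x) * of_real (std_normal_density x))"
      by (simp add: char_def integral_density cis_conv_exp scaleR_conv_of_real mult.commute)
    then show ?thesis by (simp add: char_std_normal_distribution)
  qed
  have i: "integrable lborel (\<lambda>x. cis (t * x) * of_real (std_normal_density x))" for t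
    by (intro integrable_cis_mult integrable_of_real) auto
  have "(LINT w|lborel. cis (z \<bullet> w) * of_real (gauss w))
     = (LINT w|lborel. (\<Prod>i\<in>UNIV. cis (z $ i * w $ i) * of_real (std_normal_density (w $ i))))"
    by (simp add: cis_inner gauss_def prod.distrib)
  also have "\<dots> = (\<Prod>i\<in>UNIV. of_real (exp (- (z $ i)\<^sup>2 / 2)))"
    by (subst integral_lborel_vec_prod) (auto simp: i 1)
  also have "\<dots> = of_real (exp (- (norm z)\<^sup>2 / 2))"
    by (simp only: of_real_prod[symmetric] exp_sum[OF finite, symmetric] sum_neg_half)
  finally show ?thesis .
qed

text \<open>The substitution z = w / \<epsilon> gives the factor \<epsilon>^(-n). The exponential is
  (2 pi)^(n/2) \<open>gauss\<close>, and this conversion happens once before and once after taking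
  the characteristic function, whence (2 pi)^n.\<close>

lemma fourier_gauss_dilation:
  fixes v :: "real^'n"
  assumes "0 < \<epsilon>"
  shows "(LINT z|lborel. cis (z \<bullet> v) * of_real (exp (- (norm (\<epsilon> *\<^sub>R z))\<^sup>2 / 2)))
     = of_real ((1 / \<epsilon>) ^ CARD('n) * (2 * pi) ^ CARD('n) * gauss ((1 / \<epsilon>) *\<^sub>R v))"
proof -
  let ?s = "sqrt (2 * pi) ^ CARD('n)"
  have "(LINT z|lborel. cis (z \<bullet> v) * of_real (exp (- (norm (\<epsilon> *\<^sub>R z))\<^sup>2 / 2)))
     = of_real ((1 / \<epsilon>) ^ CARD('n))
       * (LINT w|lborel. cis ((0 + (1 / \<epsilon>) *\<^sub>R w) \<bullet> v) * of_real (exp (- (norm (\<epsilon> *\<^sub>R (0 + (1 / \<epsilon>) *\<^sub>R w)))\<^sup>2 / 2)))"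
    using assms by (subst integral_lborel_affine[where c = "1 / \<epsilon>" and t = 0]) (auto simp: power_divide)
  also have "(LINT w|lborel. cis ((0 + (1 / \<epsilon>) *\<^sub>R w) \<bullet> v) * of_real (exp (- (norm (\<epsilon> *\<^sub>R (0 + (1 / \<epsilon>) *\<^sub>R w)))\<^sup>2 / 2)))
     = (LINT w|lborel. of_real ?s * (cis (((1 / \<epsilon>) *\<^sub>R v) \<bullet> w) * of_real (gauss w)))"
  proof (intro Bochner_Integration.integral_cong refl)
    fix w :: "real^'n"
    have "\<epsilon> *\<^sub>R (0 + (1 / \<epsilon>) *\<^sub>R w) = w" using assms by simp
    then show "cis ((0 + (1 / \<epsilon>) *\<^sub>R w) \<bullet> v) * of_real (exp (- (norm (\<epsilon> *\<^sub>R (0 + (1 / \<epsilon>) *\<^sub>R w)))\<^sup>2 / 2))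
      = of_real ?s * (cis (((1 / \<epsilon>) *\<^sub>R v) \<bullet> w) * of_real (gauss w))"
      by (simp only: exp_norm_eq_gauss) (simp add: inner_commute)
  qed
  also have "\<dots> = of_real ?s * of_real (?s * gauss ((1 / \<epsilon>) *\<^sub>R v))"
    by (simp only: integral_mult_right_zero gauss_char exp_norm_eq_gauss)
  also have "\<dots> = of_real ((2 * pi) ^ CARD('n) * gauss ((1 / \<epsilon>) *\<^sub>R v))"
  proof -
    have "?s * ?s = (2 * pi) ^ CARD('n)" by (simp only: power_mult_distrib[symmetric] real_sqrt_mult_self) simp
    then have "?s * (?s * gauss ((1 / \<epsilon>) *\<^sub>R v)) = (2 * pi) ^ CARD('n) * gauss ((1 / \<epsilon>) *\<^sub>R v)"
      by (simp only: mult.assoc[symmetric])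
    then show ?thesis by (simp only: of_real_mult[symmetric])
  qed
  finally show ?thesis by (simp only: of_real_mult mult.assoc)
qed

text \<open>Damping the outer integral by a wide Gaussian makes Fubini applicable; the inner integral is
  then a narrow Gaussian, an approximate identity.\<close>

theorem fourier_inversion:
  fixes f :: "real^'n \<Rightarrow> complex"
  assumes f: "integrable lborel f" and cont: "continuous_on UNIV f" and bound: "\<And>x. norm (f x) \<le> M"
    and h: "integrable lborel (\<lambda>z. LINT \<eta>|lborel. cis (z \<bullet> \<eta>) * f \<eta>)" (is "integrable lborel ?h")
  shows "(LINT z|lborel. cis (- (z \<bullet> \<xi>)) * (LINT \<eta>|lborel. cis (z \<bullet> \<eta>) * f \<eta>)) = of_real ((2 * pi) ^ CARD('n)) * f \<xi>"
proof -
  have [measurable]: "f \<in> borel_measurable borel" using f by auto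
  let ?g = "\<lambda>\<epsilon> z::real^'n. complex_of_real (exp (- (norm (\<epsilon> *\<^sub>R z))\<^sup>2 / 2))"
  have damped: "(LINT z|lborel. cis (- (z \<bullet> \<xi>)) * (?g \<epsilon> z * ?h z))
      = of_real ((2 * pi) ^ CARD('n)) * (LINT v|lborel. of_real (gauss v) * f (\<xi> + \<epsilon> *\<^sub>R v))"
    if \<epsilon>: "0 < \<epsilon>" for \<epsilon>
  proof -
    let ?F = "\<lambda>z \<eta>. cis (z \<bullet> (\<eta> - \<xi>)) * ?g \<epsilon> z * f \<eta>"
    have e: "exp (- ((norm (\<epsilon> *\<^sub>R z))\<^sup>2 / 2)) = sqrt (2 * pi) ^ CARD('n) * gauss (\<epsilon> *\<^sub>R z)" for z :: "real^'n"
      using exp_norm_eq_gauss[of "\<epsilon> *\<^sub>R z"] by simp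
    have fin: "(\<integral>\<^sup>+z. \<integral>\<^sup>+\<eta>. norm (?F z \<eta>) \<partial>lborel \<partial>lborel) < \<infinity>"
    proof -
      have "(\<integral>\<^sup>+z. \<integral>\<^sup>+\<eta>. norm (?F z \<eta>) \<partial>lborel \<partial>lborel)
         = (\<integral>\<^sup>+z. ennreal (sqrt (2 * pi) ^ CARD('n) * gauss (\<epsilon> *\<^sub>R (z::real^'n))) * (\<integral>\<^sup>+\<eta>. norm (f \<eta>) \<partial>lborel) \<partial>lborel)"
        by (intro nn_integral_cong)
          (simp add: norm_mult norm_power e gauss_nonneg ennreal_mult nn_integral_cmult del: norm_scaleR)
      also have "\<dots> = ennreal (sqrt (2 * pi) ^ CARD('n)) * (\<integral>\<^sup>+z. ennreal (gauss (\<epsilon> *\<^sub>R (z::real^'n))) \<partial>lborel)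
          * (\<integral>\<^sup>+\<eta>. norm (f \<eta>) \<partial>lborel)"
        by (simp add: nn_integral_multc nn_integral_cmult ennreal_mult gauss_nonneg)
      also have "\<dots> < \<infinity>"
        using nn_integral_gauss_dilation[OF \<epsilon>, where 'n = 'n] f
        by (auto simp: ennreal_mult_less_top integrable_iff_bounded)
      finally show ?thesis .
    qed
    have "(LINT z|lborel. cis (- (z \<bullet> \<xi>)) * (?g \<epsilon> z * ?h z)) = (LINT z|lborel. LINT \<eta>|lborel. ?F z \<eta>)"
    proof (intro Bochner_Integration.integral_cong refl)
      fix z :: "real^'n"
      have "cis (- (z \<bullet> \<xi>)) * (?g \<epsilon> z * ?h z)
         = (LINT \<eta>|lborel. cis (- (z \<bullet> \<xi>)) * (?g \<epsilon> z * (cis (z \<bullet> \<eta>) * f \<eta>)))"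
        by (simp only: integral_mult_right_zero)
      also have "\<dots> = (LINT \<eta>|lborel. ?F z \<eta>)"
      proof (intro Bochner_Integration.integral_cong refl)
        fix \<eta>
        have "cis (- (z \<bullet> \<xi>)) * cis (z \<bullet> \<eta>) = cis (z \<bullet> (\<eta> - \<xi>))"
          by (simp add: cis_mult inner_diff_right)
        moreover have "a * (b * (c * d)) = (a * c) * b * d" for a b c d :: complex by simp
        ultimately show "cis (- (z \<bullet> \<xi>)) * (?g \<epsilon> z * (cis (z \<bullet> \<eta>) * f \<eta>)) = ?F z \<eta>" by (simp only:)
      qed
      finally show "cis (- (z \<bullet> \<xi>)) * (?g \<epsilon> z * ?h z) = (LINT \<eta>|lborel. ?F z \<eta>)" .
    qed
    also have "\<dots> = (LINT \<eta>|lborel. LINT z|lborel. ?F z \<eta>)"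
      by (rule lborel_Fubini(3)[symmetric, OF _ fin]) measurable
    also have "\<dots> = (LINT \<eta>|lborel. of_real ((1 / \<epsilon>) ^ CARD('n) * (2 * pi) ^ CARD('n))
        * (of_real (gauss ((1 / \<epsilon>) *\<^sub>R (\<eta> - \<xi>))) * f \<eta>))"
      unfolding integral_mult_left_zero fourier_gauss_dilation[OF \<epsilon>] by (simp only: of_real_mult mult.assoc)
    also have "\<dots> = of_real ((1 / \<epsilon>) ^ CARD('n) * (2 * pi) ^ CARD('n))
        * (LINT \<eta>|lborel. of_real (gauss ((1 / \<epsilon>) *\<^sub>R (\<eta> - \<xi>))) * f \<eta>)"
      by (simp only: integral_mult_right_zero)
    \<comment> \<open>Substitution \<eta> = \<xi> + \<epsilon> v. Its Jacobian \<epsilon>^n cancels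
      the factor \<epsilon>^(-n) of the narrow Gaussian.\<close>
    also have "(LINT \<eta>|lborel. of_real (gauss ((1 / \<epsilon>) *\<^sub>R (\<eta> - \<xi>))) * f \<eta>)
        = of_real (\<epsilon> ^ CARD('n)) * (LINT v|lborel. of_real (gauss v) * f (\<xi> + \<epsilon> *\<^sub>R v))"
      using \<epsilon> by (subst integral_lborel_affine[where c = \<epsilon> and t = \<xi>]) auto
    also have "of_real ((1 / \<epsilon>) ^ CARD('n) * (2 * pi) ^ CARD('n))
        * (of_real (\<epsilon> ^ CARD('n)) * (LINT v|lborel. of_real (gauss v) * f (\<xi> + \<epsilon> *\<^sub>R v)))
      = of_real ((1 / \<epsilon>) ^ CARD('n) * \<epsilon> ^ CARD('n)) * (of_real ((2 * pi) ^ CARD('n))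
        * (LINT v|lborel. of_real (gauss v) * f (\<xi> + \<epsilon> *\<^sub>R v)))"
      by (simp only: of_real_mult mult_ac)
    also have "(1 / \<epsilon>) ^ CARD('n) * \<epsilon> ^ CARD('n) = 1"
      using \<epsilon> by (simp add: power_divide)
    finally show ?thesis by (simp only: of_real_1 mult_1)
  qed
  define \<epsilon> where "\<epsilon> k = 1 / real (Suc k)" for k
  have \<epsilon>0: "0 < \<epsilon> k" for k by (simp add: \<epsilon>_def)
  have \<epsilon>lim: "\<epsilon> \<longlonglongrightarrow> 0" using LIMSEQ_inverse_real_of_nat by (simp add: \<epsilon>_def[abs_def] inverse_eq_divide)
  have "(\<lambda>k. LINT z|lborel. cis (- (z \<bullet> \<xi>)) * (?g (\<epsilon> k) z * ?h z))
     \<longlonglongrightarrow> (LINT z|lborel. cis (- (z \<bullet> \<xi>)) * ?h z)"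
  proof (rule integral_dominated_convergence)
    show "integrable lborel (\<lambda>z. norm (?h z))" using h by simp
    show "AE z in lborel. (\<lambda>k. cis (- (z \<bullet> \<xi>)) * (?g (\<epsilon> k) z * ?h z)) \<longlonglongrightarrow> cis (- (z \<bullet> \<xi>)) * ?h z"
    proof (rule AE_I2)
      fix z :: "real^'n"
      have "(\<lambda>k. ?g (\<epsilon> k) z) \<longlonglongrightarrow> of_real (exp (- (norm (0 *\<^sub>R z))\<^sup>2 / 2))"
        by (intro tendsto_intros \<epsilon>lim) simp
      then have "(\<lambda>k. ?g (\<epsilon> k) z) \<longlonglongrightarrow> 1" by simp
      then have "(\<lambda>k. cis (- (z \<bullet> \<xi>)) * (?g (\<epsilon> k) z * ?h z)) \<longlonglongrightarrow> cis (- (z \<bullet> \<xi>)) * (1 * ?h z)"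
        by (intro tendsto_mult tendsto_const)
      then show "(\<lambda>k. cis (- (z \<bullet> \<xi>)) * (?g (\<epsilon> k) z * ?h z)) \<longlonglongrightarrow> cis (- (z \<bullet> \<xi>)) * ?h z" by simp
    qed
    show "AE z in lborel. norm (cis (- (z \<bullet> \<xi>)) * (?g (\<epsilon> k) z * ?h z)) \<le> norm (?h z)" for k
    proof (rule AE_I2)
      fix z :: "real^'n"
      have "norm (?g (\<epsilon> k) z) \<le> 1" by (simp only: norm_of_real) simp
      then have "norm (?g (\<epsilon> k) z) * norm (?h z) \<le> 1 * norm (?h z)" by (intro mult_right_mono) auto
      then show "norm (cis (- (z \<bullet> \<xi>)) * (?g (\<epsilon> k) z * ?h z)) \<le> norm (?h z)"
        by (simp only: norm_mult norm_cis mult_1)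
    qed
  qed measurable
  then have L: "(\<lambda>k. of_real ((2 * pi) ^ CARD('n)) * (LINT v|lborel. of_real (gauss v) * f (\<xi> + \<epsilon> k *\<^sub>R v)))
     \<longlonglongrightarrow> (LINT z|lborel. cis (- (z \<bullet> \<xi>)) * ?h z)"
    by (simp only: damped[OF \<epsilon>0])
  have "(\<lambda>k. LINT v|lborel. of_real (gauss v) * f (\<xi> + \<epsilon> k *\<^sub>R v))
     \<longlonglongrightarrow> (LINT v|lborel. of_real (gauss (v::real^'n)) * f \<xi>)"
  proof (rule integral_dominated_convergence)
    show "integrable lborel (\<lambda>z::real^'n. gauss z * M)" by (intro integrable_mult_left integrable_gauss)
    show "AE v in lborel. (\<lambda>k. complex_of_real (gauss v) * f (\<xi> + \<epsilon> k *\<^sub>R v)) \<longlonglongrightarrow> of_real (gauss v) * f \<xi>"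
    proof (rule AE_I2)
      fix v :: "real^'n"
      have "(\<lambda>k. \<xi> + \<epsilon> k *\<^sub>R v) \<longlonglongrightarrow> \<xi> + 0 *\<^sub>R v" by (intro tendsto_intros \<epsilon>lim)
      then have "(\<lambda>k. f (\<xi> + \<epsilon> k *\<^sub>R v)) \<longlonglongrightarrow> f \<xi>"
        using cont by (intro isCont_tendsto_compose[of \<xi> f]) (auto simp: continuous_on_eq_continuous_at)
      then show "(\<lambda>k. complex_of_real (gauss v) * f (\<xi> + \<epsilon> k *\<^sub>R v)) \<longlonglongrightarrow> of_real (gauss v) * f \<xi>"
        by (intro tendsto_intros)
    qed
    show "AE v in lborel. norm (complex_of_real (gauss v) * f (\<xi> + \<epsilon> k *\<^sub>R v)) \<le> gauss v * M" for k
      by (intro AE_I2) (simp add: norm_mult gauss_nonneg mult_left_mono bound)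
  qed measurable
  then have "(\<lambda>k. LINT v|lborel. of_real (gauss v) * f (\<xi> + \<epsilon> k *\<^sub>R v)) \<longlonglongrightarrow> f \<xi>"
    by (simp add: integral_complex_of_real integral_gauss)
  then have "(\<lambda>k. of_real ((2 * pi) ^ CARD('n)) * (LINT v|lborel. of_real (gauss v) * f (\<xi> + \<epsilon> k *\<^sub>R v)))
     \<longlonglongrightarrow> of_real ((2 * pi) ^ CARD('n)) * f \<xi>"
    by (intro tendsto_intros)
  then show ?thesis using L LIMSEQ_unique by blast
qed

section \<open>The inverse transform and convolution kernels\<close>

definition inverse_fourier :: "(real^'n \<Rightarrow> complex) \<Rightarrow> real^'n \<Rightarrow> complex" where
  "inverse_fourier f x = of_real (1 / (2 * pi) ^ CARD('n)) * (LINT \<xi>|lborel. cis (x \<bullet> \<xi>) * f \<xi>)"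

lemma inverse_fourier_eq:
  fixes f :: "real^'n \<Rightarrow> complex"
  assumes "f \<in> borel_measurable borel"
  shows "inverse_fourier f x = of_real (1 / (2 * pi) ^ CARD('n)) * fourier f (- x)"
  by (simp add: inverse_fourier_def fourier_lborel[OF assms] inner_commute)

lemma inverse_fourier_dilation:
  fixes f :: "real^'n \<Rightarrow> complex"
  assumes [measurable]: "f \<in> borel_measurable borel" and "0 < c"
  shows "inverse_fourier (\<lambda>\<xi>. f ((1 / c) *\<^sub>R \<xi>)) x = of_real (c ^ CARD('n)) * inverse_fourier f (c *\<^sub>R x)"
  unfolding inverse_fourier_def using assms(2)
  by (subst integral_lborel_affine[where c = c and t = 0]) (auto simp: ac_simps)

text \<open>The bridge from distributions to functions: applying a distribution to the transform of
  this modulated multiplier evaluates, at the point \<open>x\<close>, its convolution with the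
  kernel of the multiplier.\<close>

lemma fourier_modulate:
  fixes f :: "real^'n \<Rightarrow> complex"
  assumes [measurable]: "f \<in> borel_measurable borel"
  shows "fourier (\<lambda>\<xi>. of_real (1 / (2 * pi) ^ CARD('n)) * (cis (x \<bullet> \<xi>) * f \<xi>)) y = inverse_fourier f (x - y)"
proof -
  have eq: "cis (- (\<xi> \<bullet> y)) * (of_real (1 / (2 * pi) ^ CARD('n)) * (cis (x \<bullet> \<xi>) * f \<xi>))
      = of_real (1 / (2 * pi) ^ CARD('n)) * (cis ((x - y) \<bullet> \<xi>) * f \<xi>)" for \<xi>
  proof -
    have "cis (- (\<xi> \<bullet> y)) * cis (x \<bullet> \<xi>) = cis ((x - y) \<bullet> \<xi>)"
      by (simp add: cis_mult inner_diff_left inner_diff_right inner_commute)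
    moreover have "a * (b * (c * d)) = b * ((a * c) * d)" for a b c d :: complex by simp
    ultimately show ?thesis by (simp only:)
  qed
  have "(\<lambda>\<xi>. of_real (1 / (2 * pi) ^ CARD('n)) * (cis (x \<bullet> \<xi>) * f \<xi>)) \<in> borel_measurable borel"
    by measurable
  then show ?thesis
    by (simp only: fourier_lborel eq inverse_fourier_def integral_mult_right_zero)
qed

lemma inverse_fourier_borel_measurable:
  assumes [measurable]: "f \<in> borel_measurable borel"
  shows "inverse_fourier f \<in> borel_measurable borel"
  unfolding inverse_fourier_def[abs_def] by measurable

lemma schwartz_inverse_fourier_integrable:
  fixes f :: "real^'n \<Rightarrow> complex"
  assumes "schwartz f"
  shows "integrable lborel (inverse_fourier f)"
proof -
  have [measurable]: "f \<in> borel_measurable borel" using schwartz_borel_measurable[OF assms] .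
  obtain C where C: "\<And>\<xi>. norm (fourier f \<xi>) \<le> C * decay_weight \<xi>"
    by (rule schwartz_fourier_decay[OF assms]) blast
  have "norm (inverse_fourier f x) \<le> (1 / (2 * pi) ^ CARD('n) * C) * decay_weight x" for x
  proof -
    have "decay_weight (- x) = decay_weight x" by (simp add: decay_weight_def)
    then show ?thesis using C[of "- x"]
      by (simp add: inverse_fourier_eq norm_mult norm_divide norm_power divide_right_mono)
  qed
  from integrable_of_decay[OF inverse_fourier_borel_measurable this] show ?thesis by simp
qed

lemma schwartz_inverse_fourier_bounded:
  fixes f :: "real^'n \<Rightarrow> complex"
  assumes "schwartz f"
  obtains M where "0 < M" "\<And>x. norm (inverse_fourier f x) \<le> M"
proof -
  have m: "f \<in> borel_measurable borel" using schwartz_borel_measurable[OF assms] .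
  let ?c = "1 / (2 * pi) ^ CARD('n)"
  \<comment> \<open>The added 1 keeps the bound positive even when \<open>f\<close>
    vanishes.\<close>
  have "norm (inverse_fourier f x) \<le> ?c * (LINT x|lborel. norm (f x)) + 1" for x
  proof -
    have "norm (inverse_fourier f x) = ?c * norm (fourier f (- x))"
      using m by (simp add: inverse_fourier_eq norm_mult norm_divide norm_power)
    also have "\<dots> \<le> ?c * (LINT x|lborel. norm (f x))"
      by (intro mult_left_mono norm_fourier_le m) simp
    finally show ?thesis by simp
  qed
  moreover have "0 < ?c * (LINT x|lborel. norm (f x)) + 1"
    by (intro add_nonneg_pos mult_nonneg_nonneg integral_nonneg_AE) auto
  ultimately show thesis using that by blast
qed

lemma schwartz_fourier_inverse_fourier:
  fixes f :: "real^'n \<Rightarrow> complex"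
  assumes "schwartz f"
  shows "(LINT z|lborel. cis (- (z \<bullet> \<xi>)) * inverse_fourier f z) = f \<xi>"
proof -
  let ?c = "complex_of_real (1 / (2 * pi) ^ CARD('n))"
  have c: "?c * of_real ((2 * pi) ^ CARD('n)) = 1" "of_real ((2 * pi) ^ CARD('n)) * ?c = 1" by auto
  obtain M where "\<And>x. (1 + norm x) ^ 0 * norm (f x) \<le> M" by (rule schwartz_bound[OF assms, of 0]) blast
  then have M: "norm (f x) \<le> M" for x by simp
  have "integrable lborel (\<lambda>z. of_real ((2 * pi) ^ CARD('n)) * inverse_fourier f z)"
    by (intro integrable_mult_right schwartz_inverse_fourier_integrable assms)
  then have h: "integrable lborel (\<lambda>z. LINT \<eta>|lborel. cis (z \<bullet> \<eta>) * f \<eta>)"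
    unfolding inverse_fourier_def mult.assoc[symmetric] c(2) by simp
  have "(LINT z|lborel. cis (- (z \<bullet> \<xi>)) * inverse_fourier f z)
     = (LINT z|lborel. ?c * (cis (- (z \<bullet> \<xi>)) * (LINT \<eta>|lborel. cis (z \<bullet> \<eta>) * f \<eta>)))"
    by (simp only: inverse_fourier_def mult.left_commute)
  also have "\<dots> = ?c * (of_real ((2 * pi) ^ CARD('n)) * f \<xi>)"
    by (simp only: integral_mult_right_zero
        fourier_inversion[OF schwartz_integrable[OF assms] smooth_continuous_on[OF schwartz_smooth[OF assms]] M h])
  also have "\<dots> = f \<xi>" by (simp only: mult.assoc[symmetric] c(1) mult_1)
  finally show ?thesis .
qed

section \<open>Weak Lebesgue spaces\<close>

text \<open>The weak L^p condition with constant \<open>K\<close>, in terms of the distribution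
  function. Values in [0, \<infinity>] admit infinite sums and integrals of absolute values; Borel
  measurability makes product measures available.\<close>

definition weak_bound :: "real \<Rightarrow> real \<Rightarrow> ('a::euclidean_space \<Rightarrow> ennreal) \<Rightarrow> bool" where
  "weak_bound p K F \<longleftrightarrow> F \<in> borel_measurable borel \<and>
    (\<forall>\<alpha>>0. emeasure lborel {x. ennreal \<alpha> < F x} \<le> ennreal ((K / \<alpha>) powr p))"

lemma weak_boundD:
  assumes "weak_bound p K F"
  shows "F \<in> borel_measurable borel"
    and "0 < \<alpha> \<Longrightarrow> emeasure lborel {x. ennreal \<alpha> < F x} \<le> ennreal ((K / \<alpha>) powr p)"
  using assms by (auto simp: weak_bound_def)

text \<open>Twice the sum over i of 2^(i (1 - p)), the cost of summing a weak L^p function over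
  dyadic levels. The series converges exactly when p > 1.\<close>

definition tail_const :: "real \<Rightarrow> real" where
  "tail_const p = 2 / (1 - 2 powr (1 - p))"

lemma tail_const_pos: "1 < p \<Longrightarrow> 0 < tail_const p"
  by (simp add: tail_const_def powr_less_one)

lemma le_suminf_ennreal: "f i \<le> (\<Sum>i. f i :: ennreal)"
  using sum_le_suminf[of f "{i}"] by simp

text \<open>One term already dominates: for the least i with z at most 2^(i+1) \<tau>, the level 2^i
  \<tau> still lies below \<open>y\<close>. The argument runs over finite z < y because
  \<open>y\<close> may be infinite.\<close>

lemma truncation_le_dyadic_sum:
  assumes "0 < \<tau>" "ennreal \<tau> < y"
  shows "y \<le> (\<Sum>i. ennreal (2 * 2 ^ i * \<tau>) * indicator {z. ennreal (2 ^ i * \<tau>) < z} y)" (is "_ \<le> suminf ?f")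
proof (rule dense_le)
  fix z assume z: "z < y"
  then obtain t where t: "z = ennreal t" "0 \<le> t" by (cases z) auto
  have "\<exists>i. t \<le> 2 * 2 ^ i * \<tau>"
  proof -
    obtain i where "t / \<tau> < 2 ^ i" using real_arch_pow[of 2 "t / \<tau>"] by auto
    then have "t \<le> 2 ^ i * \<tau>" using assms by (simp add: pos_divide_less_eq)
    also have "\<dots> \<le> 2 * 2 ^ i * \<tau>" using assms by simp
    finally show ?thesis ..
  qed
  then obtain i where i: "t \<le> 2 * 2 ^ i * \<tau>" and least: "\<And>j. j < i \<Longrightarrow> \<not> t \<le> 2 * 2 ^ j * \<tau>"
    by (meson exists_least_iff)
  have "ennreal (2 ^ i * \<tau>) < y"
  proof (cases i)
    case 0
    then show ?thesis using assms by simp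
  next
    case (Suc j)
    then have "2 ^ i * \<tau> \<le> t" using least[of j] by simp
    then show ?thesis using z t by (metis ennreal_leI le_less_trans)
  qed
  then have "?f i = ennreal (2 * 2 ^ i * \<tau>)" by simp
  then have "z \<le> ?f i" using i t by (simp add: ennreal_leI)
  also have "\<dots> \<le> suminf ?f" by (rule le_suminf_ennreal)
  finally show "z \<le> suminf ?f" .
qed

text \<open>A weak L^p function may fail to be integrable, but for p > 1 its part above a positive
  level is: the dyadic layer at 2^i \<tau> contributes at most a multiple of (2^i \<tau>)^(1-p), a
  convergent geometric series.\<close>

lemma weak_bound_tail_integral:
  fixes F :: "'a::euclidean_space \<Rightarrow> ennreal"
  assumes F: "weak_bound p K F" and p: "1 < p" and K: "0 < K" and \<tau>: "0 < \<tau>"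
  shows "(\<integral>\<^sup>+x. F x * indicator {x. ennreal \<tau> < F x} x \<partial>lborel) \<le> ennreal (tail_const p * K powr p * \<tau> powr (1 - p))"
proof -
  note [measurable] = weak_boundD(1)[OF F]
  let ?A = "\<lambda>i::nat. {x. ennreal (2 ^ i * \<tau>) < F x}"
  have "(\<integral>\<^sup>+x. F x * indicator {x. ennreal \<tau> < F x} x \<partial>lborel)
      \<le> (\<integral>\<^sup>+x. (\<Sum>i. ennreal (2 * 2 ^ i * \<tau>) * indicator (?A i) x) \<partial>lborel)"
  proof (rule nn_integral_mono)
    fix x
    show "F x * indicator {x. ennreal \<tau> < F x} x \<le> (\<Sum>i. ennreal (2 * 2 ^ i * \<tau>) * indicator (?A i) x)"
      using truncation_le_dyadic_sum[OF \<tau>, of "F x"] by (auto simp: indicator_def)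
  qed
  also have "\<dots> = (\<Sum>i. ennreal (2 * 2 ^ i * \<tau>) * emeasure lborel (?A i))"
    by (subst nn_integral_suminf) (auto simp: nn_integral_cmult_indicator)
  also have "\<dots> \<le> (\<Sum>i. ennreal (2 * K powr p * \<tau> powr (1 - p) * (2 powr (1 - p)) ^ i))"
  proof (rule suminf_le)
    fix i
    have "ennreal (2 * 2 ^ i * \<tau>) * emeasure lborel (?A i)
        \<le> ennreal (2 * 2 ^ i * \<tau>) * ennreal ((K / (2 ^ i * \<tau>)) powr p)"
      using \<tau> by (intro mult_left_mono weak_boundD(2)[OF F]) auto
    also have "\<dots> = ennreal (2 * 2 ^ i * \<tau> * (K / (2 ^ i * \<tau>)) powr p)"
      using \<tau> by (simp add: ennreal_mult)
    also have "2 * 2 ^ i * \<tau> * (K / (2 ^ i * \<tau>)) powr p = 2 * K powr p * \<tau> powr (1 - p) * (2 powr (1 - p)) ^ i"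
    proof -
      have "(2 ^ i * \<tau>) * (K / (2 ^ i * \<tau>)) powr p = K powr p * (2 ^ i * \<tau>) powr (1 - p)"
        using K \<tau> by (simp add: powr_divide powr_diff)
      also have "(2 ^ i * \<tau>) powr (1 - p) = \<tau> powr (1 - p) * (2 powr (1 - p)) ^ i"
        using \<tau> by (simp add: powr_mult powr_realpow[symmetric] powr_powr mult.commute)
      finally show ?thesis by simp
    qed
    finally show "ennreal (2 * 2 ^ i * \<tau>) * emeasure lborel (?A i)
      \<le> ennreal (2 * K powr p * \<tau> powr (1 - p) * (2 powr (1 - p)) ^ i)" .
  qed auto
  also have "\<dots> = ennreal (2 * K powr p * \<tau> powr (1 - p) * (1 / (1 - 2 powr (1 - p))))"
  proof (rule suminf_ennreal_eq)
    have "(\<lambda>i. (2 powr (1 - p)) ^ i) sums (1 / (1 - 2 powr (1 - p)))"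
      using p by (intro geometric_sums) (simp add: powr_less_one)
    then show "(\<lambda>i. 2 * K powr p * \<tau> powr (1 - p) * (2 powr (1 - p)) ^ i)
        sums (2 * K powr p * \<tau> powr (1 - p) * (1 / (1 - 2 powr (1 - p))))"
      by (rule sums_mult)
  qed auto
  finally show ?thesis by (simp add: tail_const_def ac_simps)
qed

section \<open>Pairings and convolutions of weak L^p functions\<close>

lemma nn_integral_split_level:
  fixes F G :: "'a::euclidean_space \<Rightarrow> ennreal"
  assumes [measurable]: "F \<in> borel_measurable borel" "G \<in> borel_measurable borel"
  shows "(\<integral>\<^sup>+y. F y * G y \<partial>lborel)
    \<le> ennreal \<tau> * (\<integral>\<^sup>+y. G y \<partial>lborel) + (\<integral>\<^sup>+y. F y * indicator {x. ennreal \<tau> < F x} y * G y \<partial>lborel)"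
proof -
  have "(\<integral>\<^sup>+y. F y * G y \<partial>lborel)
      \<le> (\<integral>\<^sup>+y. ennreal \<tau> * G y + F y * indicator {x. ennreal \<tau> < F x} y * G y \<partial>lborel)"
    by (intro nn_integral_mono) (auto simp: indicator_def not_less intro: mult_right_mono)
  also have "\<dots> = ennreal \<tau> * (\<integral>\<^sup>+y. G y \<partial>lborel) + (\<integral>\<^sup>+y. F y * indicator {x. ennreal \<tau> < F x} y * G y \<partial>lborel)"
    by (simp add: nn_integral_add nn_integral_cmult)
  finally show ?thesis .
qed

text \<open>Below the level, \<open>F\<close> is bounded and the mass of \<open>G\<close> counts;
  above it, \<open>F\<close> is integrable and the supremum of \<open>G\<close> counts. The level
  stays free: it is optimized for convolutions, taken equal to 1 for mere finiteness, and sent to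
  infinity for limits.\<close>

lemma weak_bound_pairing:
  fixes F G :: "'a::euclidean_space \<Rightarrow> ennreal"
  assumes F: "weak_bound p K F" and p: "1 < p" and K: "0 < K" and \<tau>: "0 < \<tau>"
    and [measurable]: "G \<in> borel_measurable borel" and M: "\<And>y. G y \<le> ennreal M" and "0 \<le> M"
  shows "(\<integral>\<^sup>+y. F y * G y \<partial>lborel)
    \<le> ennreal \<tau> * (\<integral>\<^sup>+y. G y \<partial>lborel) + ennreal (M * (tail_const p * K powr p * \<tau> powr (1 - p)))"
proof -
  note [measurable] = weak_boundD(1)[OF F]
  have "(\<integral>\<^sup>+y. F y * indicator {x. ennreal \<tau> < F x} y * G y \<partial>lborel)
      \<le> (\<integral>\<^sup>+y. ennreal M * (F y * indicator {x. ennreal \<tau> < F x} y) \<partial>lborel)"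
  proof (rule nn_integral_mono)
    fix y
    show "F y * indicator {x. ennreal \<tau> < F x} y * G y \<le> ennreal M * (F y * indicator {x. ennreal \<tau> < F x} y)"
      using mult_left_mono[OF M[of y], of "F y * indicator {x. ennreal \<tau> < F x} y"]
      by (simp add: mult.commute)
  qed
  also have "\<dots> = ennreal M * (\<integral>\<^sup>+y. F y * indicator {x. ennreal \<tau> < F x} y \<partial>lborel)"
    by (simp add: nn_integral_cmult)
  also have "\<dots> \<le> ennreal M * ennreal (tail_const p * K powr p * \<tau> powr (1 - p))"
    by (intro mult_left_mono weak_bound_tail_integral F p K \<tau>) auto
  also have "\<dots> = ennreal (M * (tail_const p * K powr p * \<tau> powr (1 - p)))"
    using \<open>0 \<le> M\<close> tail_const_pos[OF p] by (simp add: ennreal_mult)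
  finally show ?thesis
    using nn_integral_split_level[of F G \<tau>] by (meson add_left_mono assms(5) order_trans weak_boundD(1)[OF F])
qed

text \<open>The level \<open>c\<^bsup>n/p\<^esup> K\<close> balances the two terms of the previous bound.\<close>

lemma weak_bound_conv_dilation:
  fixes F :: "real^'n \<Rightarrow> ennreal"
  assumes F: "weak_bound p K F" and p: "1 < p" and K: "0 < K" and c: "0 < c"
    and [measurable]: "k \<in> borel_measurable borel" and M: "\<And>y. k y \<le> ennreal M" and "0 \<le> M"
    and A: "(\<integral>\<^sup>+y. k y \<partial>lborel) \<le> ennreal A" and "0 \<le> A"
  shows "(\<integral>\<^sup>+y. F y * (ennreal (c ^ CARD('n)) * k (c *\<^sub>R (x - y))) \<partial>lborel)
    \<le> ennreal ((A + M * tail_const p) * (K * c powr (real CARD('n) / p)))"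
proof -
  let ?n = "CARD('n)" let ?l = "K * c powr (real CARD('n) / p)"
  let ?G = "\<lambda>y. ennreal (c ^ CARD('n)) * k (c *\<^sub>R (x - y))"
  have l: "0 < ?l" using K c by simp
  have "(\<integral>\<^sup>+y. ?G y \<partial>lborel) = (\<integral>\<^sup>+y. ennreal (c ^ CARD('n)) * k (c *\<^sub>R y) \<partial>lborel)"
    by (rule nn_integral_lborel_reflect[of "\<lambda>y. ennreal (c ^ CARD('n)) * k (c *\<^sub>R y)" x]) measurable
  also have "\<dots> = (\<integral>\<^sup>+y. k y \<partial>lborel)"
    using c by (subst nn_integral_lborel_affine[where c = c and t = 0 and f = k]) (auto simp: nn_integral_cmult)
  finally have G: "(\<integral>\<^sup>+y. ?G y \<partial>lborel) \<le> ennreal A" using A by simp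
  have "?G y \<le> ennreal (c ^ ?n * M)" for y
    using c mult_left_mono[OF M[of "c *\<^sub>R (x - y)"], of "ennreal (c ^ ?n)"] \<open>0 \<le> M\<close> by (simp add: ennreal_mult)
  then have Gle: "\<And>y. ?G y \<le> ennreal (c ^ ?n * M)" .
  have "(\<integral>\<^sup>+y. F y * ?G y \<partial>lborel)
      \<le> ennreal ?l * (\<integral>\<^sup>+y. ?G y \<partial>lborel) + ennreal (c ^ ?n * M * (tail_const p * K powr p * ?l powr (1 - p)))"
  proof (rule weak_bound_pairing[OF F p K l _ Gle])
    show "?G \<in> borel_measurable borel" by measurable
  qed (use c \<open>0 \<le> M\<close> in simp)
  also have "\<dots> \<le> ennreal ?l * ennreal A + ennreal (c ^ ?n * M * (tail_const p * K powr p * ?l powr (1 - p)))"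
    by (intro add_right_mono mult_left_mono G) auto
  also have "c ^ ?n * M * (tail_const p * K powr p * ?l powr (1 - p)) = M * tail_const p * ?l"
  proof -
    have "K powr p * ?l powr (1 - p) * c ^ ?n = ?l"
    proof -
      have 1: "?l powr (1 - p) = K powr (1 - p) * c powr (real ?n / p * (1 - p))"
        using K c by (simp add: powr_mult powr_powr)
      have 2: "K powr p * K powr (1 - p) = K" using K by (simp add: powr_add[symmetric])
      have "real ?n / p * (1 - p) + real ?n = real ?n / p" using p by (simp add: field_simps)
      then have 3: "c powr (real ?n / p * (1 - p)) * c ^ ?n = c powr (real ?n / p)"
        using c by (simp add: powr_realpow[symmetric] powr_add[symmetric])
      have "K powr p * ?l powr (1 - p) * c ^ ?n
          = (K powr p * K powr (1 - p)) * (c powr (real ?n / p * (1 - p)) * c ^ ?n)"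
        unfolding 1 by (simp only: mult_ac)
      then show ?thesis unfolding 2 3 .
    qed
    moreover have "c ^ ?n * M * (tail_const p * K powr p * ?l powr (1 - p))
        = M * tail_const p * (K powr p * ?l powr (1 - p) * c ^ ?n)" by (simp only: mult_ac)
    ultimately show ?thesis by simp
  qed
  also have "ennreal ?l * ennreal A + ennreal (M * tail_const p * ?l) = ennreal ((A + M * tail_const p) * ?l)"
    using K c \<open>0 \<le> A\<close> \<open>0 \<le> M\<close> tail_const_pos[OF p]
    by (simp add: ennreal_mult'[symmetric] ennreal_plus[symmetric] algebra_simps del: ennreal_plus)
  finally show ?thesis .
qed

text \<open>The weak-type form of Young's inequality. Truncating \<open>F\<close> at \<tau> =
  \<alpha> / (2 A) leaves a bounded part whose convolution is at most \<alpha>/2, so where the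
  convolution exceeds \<alpha> the tail contributes at least \<alpha>/2. Markov's inequality and
  Fubini reduce this to the integral of the tail.\<close>

lemma weak_young:
  fixes F k :: "'a::euclidean_space \<Rightarrow> ennreal"
  assumes F: "weak_bound p K F" and p: "1 < p" and K: "0 < K"
    and [measurable]: "k \<in> borel_measurable borel"
    and A: "(\<integral>\<^sup>+y. k y \<partial>lborel) \<le> ennreal A" and "0 < A"
  shows "weak_bound p (tail_const p powr (1 / p) * (2 * A) * K) (\<lambda>x. \<integral>\<^sup>+y. F y * k (x - y) \<partial>lborel)"
  unfolding weak_bound_def
proof (intro conjI allI impI)
  note [measurable] = weak_boundD(1)[OF F]
  show "(\<lambda>x. \<integral>\<^sup>+y. F y * k (x - y) \<partial>lborel) \<in> borel_measurable borel" by measurable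
  fix \<alpha> :: real assume \<alpha>: "0 < \<alpha>"
  define \<tau> where "\<tau> = \<alpha> / (2 * A)"
  have \<tau>: "0 < \<tau>" "\<tau> * A = \<alpha> / 2" using \<alpha> \<open>0 < A\<close> by (auto simp: \<tau>_def)
  define H where "H y = F y * indicator {x. ennreal \<tau> < F x} y" for y
  have [measurable]: "H \<in> borel_measurable borel" unfolding H_def[abs_def] by measurable
  let ?J = "\<lambda>x. \<integral>\<^sup>+y. H y * k (x - y) \<partial>lborel"
  have k: "(\<integral>\<^sup>+y. k (x - y) \<partial>lborel) = (\<integral>\<^sup>+y. k y \<partial>lborel)" for x
    by (rule nn_integral_lborel_reflect) simp
  have le: "(\<integral>\<^sup>+y. F y * k (x - y) \<partial>lborel) \<le> ennreal (\<alpha> / 2) + ?J x" for x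
  proof -
    have "(\<integral>\<^sup>+y. F y * k (x - y) \<partial>lborel) \<le> ennreal \<tau> * (\<integral>\<^sup>+y. k (x - y) \<partial>lborel) + ?J x"
      using nn_integral_split_level[of F "\<lambda>y. k (x - y)" \<tau>] by (simp add: H_def)
    also have "\<dots> \<le> ennreal \<tau> * ennreal A + ?J x"
      unfolding k by (intro add_right_mono mult_left_mono A) auto
    finally show ?thesis using \<tau> \<open>0 < A\<close> by (simp add: ennreal_mult'[symmetric])
  qed
  have "{x. ennreal \<alpha> < (\<integral>\<^sup>+y. F y * k (x - y) \<partial>lborel)} \<subseteq> {x \<in> space lborel. 1 \<le> ennreal (2 / \<alpha>) * ?J x}"
  proof safe
    fix x assume x: "ennreal \<alpha> < (\<integral>\<^sup>+y. F y * k (x - y) \<partial>lborel)"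
    have "ennreal (\<alpha> / 2) \<le> ?J x"
    proof (rule ccontr)
      assume "\<not> ennreal (\<alpha> / 2) \<le> ?J x"
      then have "ennreal (\<alpha> / 2) + ?J x \<le> ennreal (\<alpha> / 2) + ennreal (\<alpha> / 2)"
        by (intro add_left_mono) auto
      also have "\<dots> = ennreal \<alpha>" using \<alpha> by (simp add: ennreal_plus[symmetric] del: ennreal_plus)
      finally show False using x le[of x] by (meson leD order_trans)
    qed
    then have "ennreal (2 / \<alpha>) * ennreal (\<alpha> / 2) \<le> ennreal (2 / \<alpha>) * ?J x" by (intro mult_left_mono) auto
    then show "1 \<le> ennreal (2 / \<alpha>) * ?J x" using \<alpha> by (simp add: ennreal_mult'[symmetric])
  qed simp
  then have "emeasure lborel {x. ennreal \<alpha> < (\<integral>\<^sup>+y. F y * k (x - y) \<partial>lborel)}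
     \<le> emeasure lborel {x \<in> space lborel. 1 \<le> ennreal (2 / \<alpha>) * ?J x}"
    by (intro emeasure_mono) measurable
  also have "\<dots> \<le> ennreal (2 / \<alpha>) * (\<integral>\<^sup>+x. ?J x * indicator (space lborel) x \<partial>lborel)"
    by (rule nn_integral_Markov_inequality) measurable
  also have "(\<integral>\<^sup>+x. ?J x * indicator (space lborel) x \<partial>lborel) = (\<integral>\<^sup>+x. ?J x \<partial>lborel)" by simp
  also have "\<dots> = (\<integral>\<^sup>+y. \<integral>\<^sup>+x. H y * k (x - y) \<partial>lborel \<partial>lborel)"
    by (rule lborel_pair.Fubini'[of "\<lambda>y x. H y * k (x - y)"]) measurable
  also have "\<dots> = (\<integral>\<^sup>+y. H y * (\<integral>\<^sup>+x. k x \<partial>lborel) \<partial>lborel)"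
    by (intro nn_integral_cong) (simp add: nn_integral_cmult nn_integral_lborel_translate)
  also have "\<dots> = (\<integral>\<^sup>+y. H y \<partial>lborel) * (\<integral>\<^sup>+x. k x \<partial>lborel)"
    by (simp add: nn_integral_multc)
  also have "ennreal (2 / \<alpha>) * ((\<integral>\<^sup>+y. H y \<partial>lborel) * (\<integral>\<^sup>+x. k x \<partial>lborel))
     \<le> ennreal (2 / \<alpha>) * (ennreal (tail_const p * K powr p * \<tau> powr (1 - p)) * ennreal A)"
    unfolding H_def by (intro mult_left_mono mult_mono A weak_bound_tail_integral F p K \<tau>) auto
  also have "\<dots> = ennreal ((2 / \<alpha>) * (tail_const p * K powr p * \<tau> powr (1 - p) * A))"
    using \<alpha> \<open>0 < A\<close> tail_const_pos[OF p] by (simp add: ennreal_mult'[symmetric])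
  also have "(2 / \<alpha>) * (tail_const p * K powr p * \<tau> powr (1 - p) * A)
     = (tail_const p powr (1 / p) * (2 * A) * K / \<alpha>) powr p"
  proof -
    have "(tail_const p powr (1 / p) * (2 * A) * K / \<alpha>) = tail_const p powr (1 / p) * (K / \<tau>)"
      using \<alpha> \<open>0 < A\<close> by (simp add: \<tau>_def)
    then have e1: "(tail_const p powr (1 / p) * (2 * A) * K / \<alpha>) powr p = tail_const p * (K powr p / \<tau> powr p)"
      using tail_const_pos[OF p] p K \<tau> by (simp add: powr_mult powr_divide powr_powr)
    have "\<tau> powr (1 - p) = \<tau> / \<tau> powr p" using \<tau> by (simp add: powr_diff)
    then have e2: "(2 / \<alpha>) * (tail_const p * K powr p * \<tau> powr (1 - p) * A)
        = tail_const p * (K powr p / \<tau> powr p) * ((2 / \<alpha>) * (\<tau> * A))" by (simp add: mult_ac)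
    have e3: "(2 / \<alpha>) * (\<tau> * A) = 1" using \<tau>(2) \<alpha> by simp
    show ?thesis unfolding e1 e2 e3 by simp
  qed
  finally show "emeasure lborel {x. ennreal \<alpha> < (\<integral>\<^sup>+y. F y * k (x - y) \<partial>lborel)}
    \<le> ennreal ((tail_const p powr (1 / p) * (2 * A) * K / \<alpha>) powr p)" .
qed

text \<open>Boundedness trades for integrability: for \<alpha> > B the set is empty, and for
  \<alpha> at most B the ratio B / \<alpha> is at least 1, so its exponent may be raised. The factor
  \<open>s\<close> keeps track of how much smaller the weak constant is than the supremum; for block
  j it will be 2^(jn/r).\<close>

lemma weak_bound_raise_exponent:
  assumes F: "weak_bound r K F" and "r \<le> m" and bd: "\<And>x. F x \<le> ennreal B" and "s * K \<le> B" and "0 < K" "0 < s" "0 < \<alpha>" "0 < r"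
  shows "emeasure lborel {x. ennreal \<alpha> < F x} \<le> ennreal (s powr (- r) * (B / \<alpha>) powr m)"
proof (cases "\<alpha> \<le> B")
  case True
  have B: "0 < B" using assms by (meson less_le_trans mult_pos_pos)
  have "K / \<alpha> \<le> (1 / s) * (B / \<alpha>)"
    using assms by (simp add: field_simps)
  then have "(K / \<alpha>) powr r \<le> ((1 / s) * (B / \<alpha>)) powr r"
    using assms by (intro powr_mono2) auto
  also have "\<dots> = s powr (- r) * (B / \<alpha>) powr r"
    using assms B by (simp add: powr_mult powr_minus divide_inverse inverse_powr)
  also have "\<dots> \<le> s powr (- r) * (B / \<alpha>) powr m"
    using assms True by (intro mult_left_mono powr_mono) auto
  finally show ?thesis
    using weak_boundD(2)[OF F \<open>0 < \<alpha>\<close>] by (meson ennreal_leI order_trans)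
next
  case False
  then have "{x. ennreal \<alpha> < F x} = {}"
    using bd by (auto simp: not_less) (meson ennreal_leI linear order_trans)
  then show ?thesis by simp
qed

text \<open>A union bound with geometrically shrinking thresholds: a sum exceeding \<alpha> forces
  some term to exceed its share \<beta>_i, where the shares add up to \<alpha>.\<close>

lemma weak_bound_geometric_sum:
  fixes \<theta> m :: real
  assumes \<theta>: "0 < \<theta>" "\<theta> < 1" and m: "0 < m"
  obtains C where "0 < C"
    "\<And>(F :: nat \<Rightarrow> 'a::euclidean_space \<Rightarrow> ennreal) a B \<alpha>.
      (\<And>i. F i \<in> borel_measurable borel) \<Longrightarrow> 0 \<le> a \<Longrightarrow> 0 < B \<Longrightarrow> 0 < \<alpha> \<Longrightarrow>
      (\<And>i \<beta>. 0 < \<beta> \<Longrightarrow> emeasure lborel {x. ennreal \<beta> < F i x} \<le> ennreal (a * \<theta> ^ i * (B / \<beta>) powr m)) \<Longrightarrow>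
      emeasure lborel {x. ennreal \<alpha> < (\<Sum>i. F i x)} \<le> ennreal (C * a * (B / \<alpha>) powr m)"
proof -
  \<comment> \<open>The exponent makes \<rho>^m the square root of \<theta>. Half of the decay pays
    for the lowered thresholds, the other half makes the sum of the measures converge.\<close>
  define \<rho> where "\<rho> = \<theta> powr (1 / (2 * m))"
  have \<rho>: "0 < \<rho>" "\<rho> < 1" using \<theta> m powr_less_mono2[of "1 / (2 * m)" \<theta> 1] by (auto simp: \<rho>_def)
  have \<rho>m: "\<rho> powr m = sqrt \<theta>" using \<theta> m by (simp add: \<rho>_def powr_powr powr_half_sqrt)
  define C where "C = (1 - \<rho>) powr (- m) * (1 / (1 - sqrt \<theta>))"
  have sq: "0 < sqrt \<theta>" "sqrt \<theta> < 1" using \<theta> by auto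
  have "emeasure lborel {x. ennreal \<alpha> < (\<Sum>i. F i x)} \<le> ennreal (C * a * (B / \<alpha>) powr m)"
    if [measurable]: "\<And>i. F i \<in> borel_measurable borel" and a: "0 \<le> a" and B: "0 < B" and \<alpha>: "0 < \<alpha>"
      and F: "\<And>i \<beta>. 0 < \<beta> \<Longrightarrow> emeasure lborel {x. ennreal \<beta> < F i x} \<le> ennreal (a * \<theta> ^ i * (B / \<beta>) powr m)"
    for F :: "nat \<Rightarrow> 'a \<Rightarrow> ennreal" and a B \<alpha>
  proof -
    define \<beta> where "\<beta> i = (1 - \<rho>) * \<rho> ^ i * \<alpha>" for i
    have \<beta>: "0 < \<beta> i" for i using \<rho> \<alpha> by (simp add: \<beta>_def)
    have "(\<lambda>i. (1 - \<rho>) * \<alpha> * \<rho> ^ i) sums ((1 - \<rho>) * \<alpha> * (1 / (1 - \<rho>)))"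
      using \<rho> by (intro sums_mult geometric_sums) auto
    then have "\<beta> sums \<alpha>" using \<rho> by (simp add: \<beta>_def[abs_def] mult_ac)
    then have sum\<beta>: "(\<Sum>i. ennreal (\<beta> i)) = ennreal \<alpha>"
      using \<beta> by (intro suminf_ennreal_eq) (auto simp: less_imp_le)
    have "{x. ennreal \<alpha> < (\<Sum>i. F i x)} \<subseteq> (\<Union>i. {x. ennreal (\<beta> i) < F i x})"
    proof
      fix x assume x: "x \<in> {x. ennreal \<alpha> < (\<Sum>i. F i x)}"
      show "x \<in> (\<Union>i. {x. ennreal (\<beta> i) < F i x})"
      proof (rule ccontr)
        assume "x \<notin> (\<Union>i. {x. ennreal (\<beta> i) < F i x})"
        then have "(\<Sum>i. F i x) \<le> (\<Sum>i. ennreal (\<beta> i))" by (intro suminf_le) (auto simp: not_less)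
        then show False using x sum\<beta> by simp
      qed
    qed
    then have "emeasure lborel {x. ennreal \<alpha> < (\<Sum>i. F i x)} \<le> emeasure lborel (\<Union>i. {x. ennreal (\<beta> i) < F i x})"
      by (intro emeasure_mono) measurable
    also have "\<dots> \<le> (\<Sum>i. emeasure lborel {x. ennreal (\<beta> i) < F i x})"
      by (intro emeasure_subadditive_countably) auto
    also have "\<dots> \<le> (\<Sum>i. ennreal (a * \<theta> ^ i * (B / \<beta> i) powr m))"
      using F[OF \<beta>] by (intro suminf_le) auto
    also have "\<dots> = ennreal (a * (1 - \<rho>) powr (- m) * (B / \<alpha>) powr m * (1 / (1 - sqrt \<theta>)))"
    proof (rule suminf_ennreal_eq)
      have "a * \<theta> ^ i * (B / \<beta> i) powr m = a * (1 - \<rho>) powr (- m) * (B / \<alpha>) powr m * sqrt \<theta> ^ i" for i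
      proof -
        have "(\<rho> ^ i) powr m = (\<rho> powr m) ^ i"
          using \<rho> by (simp add: powr_realpow[symmetric] powr_powr mult.commute)
        then have 1: "(\<rho> ^ i) powr m = sqrt \<theta> ^ i" using \<rho>m by simp
        have "B / \<beta> i = (B / \<alpha>) / ((1 - \<rho>) * \<rho> ^ i)" by (simp add: \<beta>_def)
        then have "(B / \<beta> i) powr m = (B / \<alpha>) powr m / ((1 - \<rho>) powr m * sqrt \<theta> ^ i)"
          using \<rho> B \<alpha> 1 by (simp add: powr_divide powr_mult)
        moreover have "\<theta> ^ i = sqrt \<theta> ^ i * sqrt \<theta> ^ i"
          using \<theta> by (simp add: power_mult_distrib[symmetric])
        ultimately show ?thesis using sq by (simp add: powr_minus divide_inverse)
      qed
      then show "(\<lambda>i. a * \<theta> ^ i * (B / \<beta> i) powr m) sums (a * (1 - \<rho>) powr (- m) * (B / \<alpha>) powr m * (1 / (1 - sqrt \<theta>)))"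
        using sq by (simp only:) (intro sums_mult geometric_sums, simp)
      show "0 \<le> a * \<theta> ^ i * (B / \<beta> i) powr m" for i using a \<theta> by simp
    qed
    finally show ?thesis by (simp add: C_def mult_ac)
  qed
  moreover have "0 < C" using \<rho> sq by (simp add: C_def)
  ultimately show thesis using that by blast
qed

section \<open>Approximate identities\<close>

text \<open>The positive and negative parts of \<open>v\<close>, as densities, define measures that
  agree and are finite on boxes, an intersection-stable generator; hence the densities agree.
  Because \<open>ennreal\<close> sends negative reals to 0,
  \<open>ennreal (v x) = ennreal (- v x)\<close> forces v x = 0.\<close>

lemma AE_eq_zero_of_box_integrals:
  fixes v :: "'a::euclidean_space \<Rightarrow> real"
  assumes [measurable]: "v \<in> borel_measurable borel"
    and int: "\<And>a b. integrable lborel (\<lambda>x. v x * indicator (box a b) x)"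
    and zero: "\<And>a b. (LINT x|lborel. v x * indicator (box a b) x) = 0"
  shows "AE x in lborel. v x = 0"
proof -
  let ?P = "density lborel (\<lambda>x. ennreal (v x))" and ?N = "density lborel (\<lambda>x. ennreal (- v x))"
  have box: "emeasure ?P (box a b) = emeasure ?N (box a b) \<and> emeasure ?P (box a b) \<noteq> \<infinity>" for a b
  proof -
    let ?g = "\<lambda>x. v x * indicator (box a b) x"
    have e: "emeasure ?P (box a b) = (\<integral>\<^sup>+x. ennreal (?g x) \<partial>lborel)"
      "emeasure ?N (box a b) = (\<integral>\<^sup>+x. ennreal (- ?g x) \<partial>lborel)"
      by (auto simp: emeasure_density indicator_def intro!: nn_integral_cong)
    have fin: "(\<integral>\<^sup>+x. ennreal (?g x) \<partial>lborel) \<noteq> \<infinity>" "(\<integral>\<^sup>+x. ennreal (- ?g x) \<partial>lborel) \<noteq> \<infinity>"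
      using real_integrable_def[of lborel ?g] int[of a b] by auto
    have "enn2real (\<integral>\<^sup>+x. ennreal (?g x) \<partial>lborel) = enn2real (\<integral>\<^sup>+x. ennreal (- ?g x) \<partial>lborel)"
      using real_lebesgue_integral_def[OF int[of a b]] zero[of a b] by simp
    then have "(\<integral>\<^sup>+x. ennreal (?g x) \<partial>lborel) = (\<integral>\<^sup>+x. ennreal (- ?g x) \<partial>lborel)"
    proof -
      have "X = ennreal (enn2real X)" if "X \<noteq> \<infinity>" for X using that by (simp add: less_top)
      from this[OF fin(1)] this[OF fin(2)] show ?thesis
        using \<open>enn2real _ = enn2real _\<close> by simp
    qed
    then show ?thesis using e fin by simp
  qed
  have "?P = ?N"
  proof (rule measure_eqI_generator_eq)
    let ?E = "range (\<lambda>(a, b). box a b::'a set)"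
    show "Int_stable ?E" by (auto simp: Int_stable_def box_Int_box)
    show "?E \<subseteq> Pow UNIV" "sets ?P = sigma_sets UNIV ?E" "sets ?N = sigma_sets UNIV ?E"
      by (simp_all add: borel_eq_box)
    let ?A = "\<lambda>n::nat. box (- (real n *\<^sub>R One)) (real n *\<^sub>R One) :: 'a set"
    show "range ?A \<subseteq> ?E" "(\<Union>i. ?A i) = UNIV" unfolding UN_box_eq_UNIV by auto
    show "emeasure ?P (?A i) \<noteq> \<infinity>" for i using box by blast
    show "emeasure ?P X = emeasure ?N X" if "X \<in> ?E" for X using that box by auto
  qed
  then have "AE x in lborel. ennreal (v x) = ennreal (- v x)"
    by (intro sigma_finite_measure.density_unique[OF lborel.sigma_finite_measure_axioms]) auto
  then show ?thesis
  proof (rule AE_mp, intro AE_I2 impI)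
    fix x assume "ennreal (v x) = ennreal (- v x)"
    then show "v x = 0" by (cases "0 \<le> v x") (auto simp: ennreal_neg ennreal_eq_0_iff)
  qed
qed

text \<open>A class just rich enough to approximate indicators of boxes from below. Continuity makes
  small translations harmless, and the bound and the support provide domination.\<close>

definition cutoff :: "real \<Rightarrow> ('a::euclidean_space \<Rightarrow> real) \<Rightarrow> bool" where
  "cutoff R f \<longleftrightarrow> continuous_on UNIV f \<and> (\<forall>x. 0 \<le> f x \<and> f x \<le> 1) \<and> (\<forall>x. R < norm x \<longrightarrow> f x = 0)"

text \<open>On a box the functions min 1 (k dist(x, complement)) are cutoffs converging pointwise to
  the indicator, so dominated convergence transfers the vanishing integrals to boxes, for real and
  imaginary parts.\<close>

lemma AE_eq_zero_of_cutoff_integrals: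
  fixes w :: "'a::euclidean_space \<Rightarrow> complex"
  assumes [measurable]: "w \<in> borel_measurable borel"
    and int: "\<And>R f. cutoff R f \<Longrightarrow> integrable lborel (\<lambda>x. w x * of_real (f x))"
    and zero: "\<And>R f. cutoff R f \<Longrightarrow> (LINT x|lborel. w x * of_real (f x)) = 0"
  shows "AE x in lborel. w x = 0"
proof -
  have box: "integrable lborel (\<lambda>x. w x * indicator (box a b) x) \<and> (LINT x|lborel. w x * indicator (box a b) x) = 0"
    for a b :: 'a
  proof -
    let ?U = "box a b"
    obtain R where R: "\<And>x. x \<in> ?U \<Longrightarrow> norm x \<le> R" using bounded_box[of a b] by (auto simp: bounded_iff)
    \<comment> \<open>Being 1 on the box, \<open>f0\<close> turns integrability against cutoffs into
      an integrable majorant there.\<close>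
    define f0 where "f0 x = max 0 (min 1 (R + 1 - norm x))" for x :: 'a
    have "cutoff (R + 1) f0" by (auto simp: cutoff_def f0_def intro!: continuous_intros)
    note f0 = int[OF this]
    have f01: "f0 x = 1" if "x \<in> ?U" for x using R[OF that] by (simp add: f0_def)
    have f00: "0 \<le> f0 x" for x by (simp add: f0_def)
    \<comment> \<open>\<open>infdist\<close> from the empty set is 0, so a nonempty complement is
      required for the distance to be positive inside the box.\<close>
    have ne: "- ?U \<noteq> {}" using bounded_box[of a b] not_bounded_UNIV by (metis Compl_empty_eq double_complement)
    define f where "f k x = min 1 (real k * infdist x (- ?U))" for k x
    have f_out: "f k x = 0" if "x \<notin> ?U" for k x using that by (simp add: f_def)
    have f_cut: "cutoff R (f k)" for k
      unfolding cutoff_def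
    proof (intro conjI allI impI)
      show "continuous_on UNIV (f k)" unfolding f_def by (intro continuous_intros)
      show "0 \<le> f k x" "f k x \<le> 1" for x by (auto simp: f_def infdist_nonneg)
      show "f k x = 0" if "R < norm x" for x using R[of x] that by (intro f_out) auto
    qed
    have dom: "norm (w x * of_real (f k x)) \<le> norm (w x * of_real (f0 x))" for k x
    proof (cases "x \<in> ?U")
      case True
      have "\<bar>f k x\<bar> \<le> 1" using f_cut[of k] by (auto simp: cutoff_def)
      then show ?thesis using f01[OF True] by (simp add: norm_mult mult_left_le)
    qed (simp add: f_out)
    have lim: "(\<lambda>k. w x * complex_of_real (f k x)) \<longlonglongrightarrow> w x * indicator ?U x" for x
    proof (cases "x \<in> ?U")
      case True
      have "0 < infdist x (- ?U)"
        using True ne in_closed_iff_infdist_zero[of "- ?U" x] infdist_nonneg[of x "- ?U"]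
        by (auto simp: open_box closed_Compl less_le)
      then obtain k0 where "1 < real k0 * infdist x (- ?U)" using reals_Archimedean3 by blast
      then have "f k x = 1" if "k0 \<le> k" for k
      proof -
        have "real k0 * infdist x (- ?U) \<le> real k * infdist x (- ?U)"
          using that by (intro mult_right_mono infdist_nonneg) auto
        then show ?thesis using \<open>1 < real k0 * infdist x (- ?U)\<close> by (simp add: f_def)
      qed
      then have "\<forall>\<^sub>F k in sequentially. w x * complex_of_real (f k x) = w x * indicator ?U x"
        using True by (intro eventually_sequentiallyI[of k0]) simp
      then show ?thesis by (rule tendsto_eventually)
    qed (simp add: f_out)
    have fm: "f k \<in> borel_measurable borel" for k
      using f_cut[of k] by (auto simp: cutoff_def intro: borel_measurable_continuous_onI)
    have "(\<lambda>k. LINT x|lborel. w x * of_real (f k x)) \<longlonglongrightarrow> (LINT x|lborel. w x * indicator ?U x)"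
      and I: "integrable lborel (\<lambda>x. w x * indicator ?U x)"
    proof -
      note [measurable] = fm
      have m: "(\<lambda>x. w x * indicator ?U x) \<in> borel_measurable lborel"
        "\<And>k. (\<lambda>x. w x * complex_of_real (f k x)) \<in> borel_measurable lborel" by measurable
      show "(\<lambda>k. LINT x|lborel. w x * of_real (f k x)) \<longlonglongrightarrow> (LINT x|lborel. w x * indicator ?U x)"
        by (rule integral_dominated_convergence[OF m integrable_norm[OF f0]]) (use lim dom in auto)
      show "integrable lborel (\<lambda>x. w x * indicator ?U x)"
        by (rule integrable_dominated_convergence[where s = "\<lambda>k x. w x * of_real (f k x)", OF m integrable_norm[OF f0]]) (use lim dom in auto)
    qed
    then show ?thesis using zero[OF f_cut] by (auto simp: LIMSEQ_const_iff)
  qed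
  have R: "Re (w x * indicator (box a b) x) = Re (w x) * indicator (box a b) x"
    and Im: "Im (w x * indicator (box a b) x) = Im (w x) * indicator (box a b) x" for x a b
    by (auto simp: indicator_def)
  have "integrable lborel (\<lambda>x. Re (w x) * indicator (box a b) x)"
    "integrable lborel (\<lambda>x. Im (w x) * indicator (box a b) x)" for a b
    using integrable_Re[OF conjunct1[OF box]] integrable_Im[OF conjunct1[OF box]]
    by (simp_all only: R Im)
  moreover have "(LINT x|lborel. Re (w x) * indicator (box a b) x) = 0"
    "(LINT x|lborel. Im (w x) * indicator (box a b) x) = 0" for a b
    using integral_Re[OF conjunct1[OF box[of a b]]] integral_Im[OF conjunct1[OF box[of a b]]]
      conjunct2[OF box[of a b]]
    by (simp_all only: R Im zero_complex.simps)
  ultimately have "AE x in lborel. Re (w x) = 0" "AE x in lborel. Im (w x) = 0"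
    by (auto intro!: AE_eq_zero_of_box_integrals)
  then show ?thesis by eventually_elim (simp add: complex_eq_iff)
qed

lemma cutoffD:
  assumes "cutoff R f"
  shows "continuous_on UNIV f" "0 \<le> f x" "f x \<le> 1" "R < norm x \<Longrightarrow> f x = 0"
    "f \<in> borel_measurable borel"
  using assms by (auto simp: cutoff_def intro: borel_measurable_continuous_onI)

lemma nn_integral_cutoff_le:
  fixes f :: "'a::euclidean_space \<Rightarrow> real"
  assumes f: "cutoff R f"
  shows "(\<integral>\<^sup>+x. ennreal (f x) \<partial>lborel) \<le> emeasure lborel (cball 0 R :: 'a set)"
proof -
  have "(\<integral>\<^sup>+x. ennreal (f x) \<partial>lborel) \<le> (\<integral>\<^sup>+x. indicator (cball 0 R :: 'a set) x \<partial>lborel)"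
    using cutoffD[OF f] by (intro nn_integral_mono) (auto simp: indicator_def not_le)
  then show ?thesis by simp
qed

lemma cutoff_translation_continuous:
  fixes f :: "'a::euclidean_space \<Rightarrow> real"
  assumes f: "cutoff R f" and z: "z \<longlonglongrightarrow> 0" and b: "\<And>N. norm (z N) \<le> b"
  shows "(\<lambda>N. \<integral>\<^sup>+y. ennreal \<bar>f (y + z N) - f y\<bar> \<partial>lborel) \<longlonglongrightarrow> 0"
proof -
  note [measurable] = cutoffD(5)[OF f]
  have [measurable]: "cball (0::'a) (R + b) \<in> sets borel" by simp
  have "(\<lambda>N. \<integral>\<^sup>+y. ennreal \<bar>f (y + z N) - f y\<bar> \<partial>lborel) \<longlonglongrightarrow> (\<integral>\<^sup>+y. 0 \<partial>(lborel::'a measure))"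
  proof (rule nn_integral_dominated_convergence[where w = "indicator (cball 0 (R + b))"])
    show "AE y in lborel. ennreal \<bar>f (y + z N) - f y\<bar> \<le> indicator (cball 0 (R + b)) y" for N
    proof (rule AE_I2)
      fix y
      show "ennreal \<bar>f (y + z N) - f y\<bar> \<le> indicator (cball 0 (R + b)) y"
      proof (cases "norm y \<le> R + b")
        case True
        have "\<bar>f (y + z N) - f y\<bar> \<le> 1" using cutoffD(2,3)[OF f, of y] cutoffD(2,3)[OF f, of "y + z N"] by linarith
        then show ?thesis using True by simp
      next
        case False
        have "norm y \<le> norm (y + z N) + norm (z N)"
          by (metis add_diff_cancel_right' norm_triangle_ineq4)
        then have "R < norm y" "R < norm (y + z N)"
          using False b[of N] norm_ge_zero[of "z N"] by linarith+
        then show ?thesis using cutoffD(4)[OF f] by simp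
      qed
    qed
    show "AE y in lborel. (\<lambda>N. ennreal \<bar>f (y + z N) - f y\<bar>) \<longlonglongrightarrow> 0"
    proof (rule AE_I2)
      fix y
      have "(\<lambda>N. y + z N) \<longlonglongrightarrow> y + 0" by (intro tendsto_intros z)
      then have "(\<lambda>N. f (y + z N)) \<longlonglongrightarrow> f y"
        using cutoffD(1)[OF f] by (intro isCont_tendsto_compose[of y f]) (auto simp: continuous_on_eq_continuous_at)
      then have "(\<lambda>N. \<bar>f (y + z N) - f y\<bar>) \<longlonglongrightarrow> \<bar>f y - f y\<bar>" by (intro tendsto_intros)
      then have "(\<lambda>N. ennreal \<bar>f (y + z N) - f y\<bar>) \<longlonglongrightarrow> ennreal \<bar>f y - f y\<bar>" by (intro tendsto_ennrealI)
      then show "(\<lambda>N. ennreal \<bar>f (y + z N) - f y\<bar>) \<longlonglongrightarrow> 0" by simp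
    qed
    show "(\<integral>\<^sup>+y. indicator (cball 0 (R + b) :: 'a set) y \<partial>lborel) < \<infinity>"
      using emeasure_lborel_cball_finite[of "0::'a" "R + b"] by simp
  qed measurable
  then show ?thesis by simp
qed

section \<open>Convolution with dilated kernels\<close>

definition dilated_kernel :: "real \<Rightarrow> (real^'n \<Rightarrow> complex) \<Rightarrow> real^'n \<Rightarrow> complex" where
  "dilated_kernel c k x = of_real (c ^ CARD('n)) * k (c *\<^sub>R x)"

definition conv :: "(real^'n \<Rightarrow> complex) \<Rightarrow> (real^'n \<Rightarrow> complex) \<Rightarrow> real^'n \<Rightarrow> complex" where
  "conv u k x = (LINT y|lborel. u y * k (x - y))"

lemma borel_measurable_dilated_kernel [measurable]:
  assumes [measurable]: "k \<in> borel_measurable borel"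
  shows "dilated_kernel c k \<in> borel_measurable borel"
  unfolding dilated_kernel_def[abs_def] by measurable

lemma borel_measurable_conv:
  assumes [measurable]: "u \<in> borel_measurable borel" "k \<in> borel_measurable borel"
  shows "conv u k \<in> borel_measurable borel"
  unfolding conv_def[abs_def] by measurable

lemma conv_dilated_kernel_bound:
  fixes u k :: "real^'n \<Rightarrow> complex"
  assumes F: "weak_bound p K (\<lambda>x. ennreal (norm (u x)))" and p: "1 < p" and K: "0 < K" and c: "0 < c"
    and [measurable]: "k \<in> borel_measurable borel" and M: "\<And>y. norm (k y) \<le> M"
    and A: "(\<integral>\<^sup>+y. ennreal (norm (k y)) \<partial>lborel) \<le> ennreal A" and "0 \<le> A"
  shows "(\<integral>\<^sup>+y. ennreal (norm (u y * dilated_kernel c k (x - y))) \<partial>lborel)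
    \<le> ennreal ((A + M * tail_const p) * (K * c powr (real CARD('n) / p)))"
proof -
  have "0 \<le> M" using M[of 0] norm_ge_zero[of "k 0"] by linarith
  then have "(\<integral>\<^sup>+y. ennreal (norm (u y)) * (ennreal (c ^ CARD('n)) * ennreal (norm (k (c *\<^sub>R (x - y))))) \<partial>lborel)
    \<le> ennreal ((A + M * tail_const p) * (K * c powr (real CARD('n) / p)))"
    using M by (intro weak_bound_conv_dilation[OF F p K c _ _ _ A \<open>0 \<le> A\<close>]) (auto intro: ennreal_leI)
  then show ?thesis
    using c by (simp add: dilated_kernel_def norm_mult norm_power ennreal_mult)
qed

lemma conv_integrable:
  fixes u k :: "real^'n \<Rightarrow> complex"
  assumes F: "weak_bound p K (\<lambda>x. ennreal (norm (u x)))" and p: "1 < p" and K: "0 < K" and c: "0 < c"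
    and [measurable]: "u \<in> borel_measurable borel" "k \<in> borel_measurable borel" and M: "\<And>y. norm (k y) \<le> M"
    and A: "(\<integral>\<^sup>+y. ennreal (norm (k y)) \<partial>lborel) \<le> ennreal A" and "0 \<le> A"
  shows "integrable lborel (\<lambda>y. u y * dilated_kernel c k (x - y))"
    and "norm (conv u (dilated_kernel c k) x) \<le> (A + M * tail_const p) * (K * c powr (real CARD('n) / p))"
proof -
  note b = conv_dilated_kernel_bound[OF F p K c assms(6) M A \<open>0 \<le> A\<close>]
  have "(\<integral>\<^sup>+y. ennreal (norm (u y * dilated_kernel c k (x - y))) \<partial>lborel) < \<infinity>"
    using b[of x] by (simp add: less_top[symmetric]) (metis ennreal_less_top le_less_trans less_irrefl)
  then show I: "integrable lborel (\<lambda>y. u y * dilated_kernel c k (x - y))"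
    by (intro integrableI_bounded) measurable
  have "0 \<le> M" using M[of 0] norm_ge_zero[of "k 0"] by linarith
  then have "0 \<le> (A + M * tail_const p) * (K * c powr (real CARD('n) / p))"
    using K \<open>0 \<le> A\<close> tail_const_pos[OF p] by simp
  moreover have "ennreal (norm (conv u (dilated_kernel c k) x))
      \<le> ennreal ((A + M * tail_const p) * (K * c powr (real CARD('n) / p)))"
    unfolding conv_def using integral_norm_bound_ennreal[OF I] b[of x] by (rule order_trans)
  ultimately show "norm (conv u (dilated_kernel c k) x) \<le> (A + M * tail_const p) * (K * c powr (real CARD('n) / p))"
    by (simp add: ennreal_le_iff)
qed

text \<open>Against a function in weak \<open>L\<^sup>p\<close>, convergence in \<open>L\<^sup>1\<close> of a uniformly bounded sequence suffices:
  split the function at a high level.\<close>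

lemma approximate_identity_pairing:
  fixes u k :: "real^'n \<Rightarrow> complex"
  assumes F: "weak_bound p K (\<lambda>x. ennreal (norm (u x)))" and p: "1 < p" and K: "0 < K"
    and [measurable]: "u \<in> borel_measurable borel" "k \<in> borel_measurable borel" and M: "\<And>y. norm (k y) \<le> M"
    and k: "integrable lborel k" "(LINT y|lborel. k y) = 1"
    and f: "cutoff R f"
    and c: "0 < \<delta>" "\<And>N. \<delta> \<le> c N" "filterlim c at_top sequentially"
  shows "integrable lborel (\<lambda>y. u y * of_real (f y))"
    and "(\<lambda>N. LINT x|lborel. conv u (dilated_kernel (c N) k) x * of_real (f x))
      \<longlonglongrightarrow> (LINT y|lborel. u y * of_real (f y))"
proof -
  note [measurable] = cutoffD(5)[OF f]
  have fin: "emeasure lborel (cball 0 R :: (real^'n) set) < \<infinity>" by (rule emeasure_lborel_cball_finite)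
  define A where "A = (LINT y|lborel. norm (k y))"
  have A0: "0 \<le> A" by (simp add: A_def)
  have A: "(\<integral>\<^sup>+y. ennreal (norm (k y)) \<partial>lborel) = ennreal A"
    using k(1) by (simp add: A_def nn_integral_eq_integral)
  have c0: "0 < c N" for N using c(1) c(2)[of N] by linarith
  have fle: "ennreal (norm (f y)) \<le> 1" for y using cutoffD(2,3)[OF f, of y] by simp
  have uf: "(\<integral>\<^sup>+y. ennreal (norm (u y * of_real (f y))) \<partial>lborel) < \<infinity>"
  proof -
    have "(\<integral>\<^sup>+y. ennreal (norm (u y)) * ennreal (f y) \<partial>lborel)
      \<le> ennreal 1 * (\<integral>\<^sup>+y. ennreal (f y) \<partial>lborel) + ennreal (1 * (tail_const p * K powr p * 1 powr (1 - p)))"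
      using cutoffD(3)[OF f] by (intro weak_bound_pairing[OF F p K]) (auto intro: ennreal_leI)
    also have "\<dots> < \<infinity>"
      using nn_integral_cutoff_le[OF f] fin by (auto simp: ennreal_add_less_top intro: le_less_trans)
    finally show ?thesis using cutoffD(2)[OF f] by (simp add: norm_mult ennreal_mult)
  qed
  then show ufi: "integrable lborel (\<lambda>y. u y * of_real (f y))" by (intro integrableI_bounded) measurable
  \<comment> \<open>The cutoff averaged at scale 1 / c N. Fubini moves the kernel from
    \<open>u\<close> onto \<open>f\<close>, so only the convergence of \<open>g N\<close> to
    \<open>f\<close> in L^1 remains, with the uniform bound \<open>A\<close> on the
    difference.\<close>
  define g where "g N y = (LINT w|lborel. k w * of_real (f (y + (1 / c N) *\<^sub>R w)))" for N y
  have [measurable]: "g N \<in> borel_measurable borel" for N unfolding g_def[abs_def] by measurable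
  have kf: "integrable lborel (\<lambda>w. k w * of_real (f (h w)))" if [measurable]: "h \<in> borel_measurable borel"
    for h :: "real^'n \<Rightarrow> real^'n"
  proof (rule Bochner_Integration.integrable_bound[OF k(1)])
    show "AE w in lborel. norm (k w * of_real (f (h w))) \<le> norm (k w)"
      using cutoffD(2,3)[OF f] by (intro AE_I2) (simp add: norm_mult mult_left_le)
  qed measurable
  have "integrable lborel (\<lambda>y. u y * g N y) \<and>
     (LINT x|lborel. conv u (dilated_kernel (c N) k) x * of_real (f x)) = (LINT y|lborel. u y * g N y)" for N
  proof -
    let ?F = "\<lambda>x y. u y * dilated_kernel (c N) k (x - y) * of_real (f x)"
    let ?B = "(A + M * tail_const p) * (K * c N powr (real CARD('n) / p))"
    have "(\<integral>\<^sup>+x. \<integral>\<^sup>+y. norm (?F x y) \<partial>lborel \<partial>lborel) \<le> (\<integral>\<^sup>+x. ennreal ?B * ennreal (f x) \<partial>lborel)"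
    proof (rule nn_integral_mono)
      fix x
      have "(\<integral>\<^sup>+y. norm (?F x y) \<partial>lborel) = (\<integral>\<^sup>+y. ennreal (norm (u y * dilated_kernel (c N) k (x - y))) \<partial>lborel) * ennreal (f x)"
        using cutoffD(2)[OF f] by (simp add: norm_mult[of _ "of_real (f x)"] ennreal_mult nn_integral_multc del: norm_mult)
      also have "\<dots> \<le> ennreal ?B * ennreal (f x)"
        using conv_dilated_kernel_bound[OF F p K c0 assms(5) M _ A0, of N x] A
        by (intro mult_right_mono) auto
      finally show "(\<integral>\<^sup>+y. norm (?F x y) \<partial>lborel) \<le> ennreal ?B * ennreal (f x)" .
    qed
    also have "\<dots> < \<infinity>"
      using nn_integral_cutoff_le[OF f] fin
      by (auto simp: nn_integral_cmult ennreal_mult_less_top intro: le_less_trans)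
    finally have fin: "(\<integral>\<^sup>+x. \<integral>\<^sup>+y. norm (?F x y) \<partial>lborel \<partial>lborel) < \<infinity>" .
    have m: "case_prod ?F \<in> borel_measurable (borel \<Otimes>\<^sub>M borel)" by measurable
    have g: "(LINT x|lborel. ?F x y) = u y * g N y" for y
    proof -
      have "(LINT x|lborel. ?F x y) = u y * (LINT x|lborel. dilated_kernel (c N) k (x - y) * of_real (f x))"
        by (simp add: mult.assoc)
      also have "(LINT x|lborel. dilated_kernel (c N) k (x - y) * of_real (f x)) = g N y"
        using c0[of N] by (subst integral_lborel_affine[where c = "1 / c N" and t = y])
          (auto simp: g_def dilated_kernel_def power_divide mult.assoc)
      finally show ?thesis .
    qed
    have "(LINT x|lborel. conv u (dilated_kernel (c N) k) x * of_real (f x)) = (LINT x|lborel. LINT y|lborel. ?F x y)"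
      by (simp add: conv_def)
    then show ?thesis using lborel_Fubini(2,3)[OF m fin] by (simp add: g)
  qed
  then have ugi: "integrable lborel (\<lambda>y. u y * g N y)"
    and swap: "(LINT x|lborel. conv u (dilated_kernel (c N) k) x * of_real (f x)) = (LINT y|lborel. u y * g N y)" for N
    by auto
  define E where "E N = (\<integral>\<^sup>+y. ennreal (norm (g N y - of_real (f y))) \<partial>lborel)" for N
  have gf: "g N y - of_real (f y) = (LINT w|lborel. k w * of_real (f (y + (1 / c N) *\<^sub>R w) - f y))" for N y
  proof -
    have "of_real (f y) = (LINT w|lborel. k w * of_real (f y))" using k(2) by simp
    then show ?thesis
      using Bochner_Integration.integral_diff[OF kf[of "\<lambda>w. y + (1 / c N) *\<^sub>R w"] kf[of "\<lambda>w. y"]]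
      by (simp add: g_def right_diff_distrib)
  qed
  have gf_int: "integrable lborel (\<lambda>w. k w * of_real (f (y + (1 / c N) *\<^sub>R w) - f y))" for N y
    using Bochner_Integration.integrable_diff[OF kf[of "\<lambda>w. y + (1 / c N) *\<^sub>R w"] kf[of "\<lambda>w. y"]]
    by (simp add: right_diff_distrib)
  have nk: "norm (k w * of_real (a - b)) = norm (k w) * \<bar>a - b\<bar>" for w a b by (simp only: norm_mult norm_of_real)
  have gf_bound: "norm (g N y - of_real (f y)) \<le> A" for N y
  proof -
    have "norm (g N y - of_real (f y)) \<le> (LINT w|lborel. norm (k w * of_real (f (y + (1 / c N) *\<^sub>R w) - f y)))"
      unfolding gf by (rule integral_norm_bound)
    also have "\<dots> \<le> (LINT w|lborel. norm (k w))"
    proof (rule integral_mono)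
      show "norm (k w * of_real (f (y + (1 / c N) *\<^sub>R w) - f y)) \<le> norm (k w)" for w
      proof -
        have "\<bar>f (y + (1 / c N) *\<^sub>R w) - f y\<bar> \<le> 1"
          using cutoffD(2,3)[OF f, of y] cutoffD(2,3)[OF f, of "y + (1 / c N) *\<^sub>R w"] by linarith
        then show ?thesis unfolding nk by (simp add: mult_left_le)
      qed
    qed (use gf_int k(1) in auto)
    finally show ?thesis by (simp add: A_def)
  qed
  have "E \<longlonglongrightarrow> 0"
  proof -
    let ?T = "\<lambda>N w. \<integral>\<^sup>+y. ennreal \<bar>f (y + (1 / c N) *\<^sub>R w) - f y\<bar> \<partial>lborel"
    have inv: "(\<lambda>N. 1 / c N) \<longlonglongrightarrow> 0"
      using tendsto_inverse_0_at_top[OF c(3)] by (simp add: inverse_eq_divide)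
    have EN: "E N \<le> (\<integral>\<^sup>+w. ennreal (norm (k w)) * ?T N w \<partial>lborel)" for N
    proof -
      have "E N \<le> (\<integral>\<^sup>+y. \<integral>\<^sup>+w. ennreal (norm (k w)) * ennreal \<bar>f (y + (1 / c N) *\<^sub>R w) - f y\<bar> \<partial>lborel \<partial>lborel)"
        unfolding E_def
      proof (rule nn_integral_mono)
        fix y
        show "ennreal (norm (g N y - of_real (f y)))
          \<le> (\<integral>\<^sup>+w. ennreal (norm (k w)) * ennreal \<bar>f (y + (1 / c N) *\<^sub>R w) - f y\<bar> \<partial>lborel)"
          using integral_norm_bound_ennreal[OF gf_int[of y N]] unfolding gf nk by (simp add: ennreal_mult)
      qed
      also have "\<dots> = (\<integral>\<^sup>+w. \<integral>\<^sup>+y. ennreal (norm (k w)) * ennreal \<bar>f (y + (1 / c N) *\<^sub>R w) - f y\<bar> \<partial>lborel \<partial>lborel)"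
        by (rule lborel_pair.Fubini'[of "\<lambda>w y. ennreal (norm (k w)) * ennreal \<bar>f (y + (1 / c N) *\<^sub>R w) - f y\<bar>"]) measurable
      also have "\<dots> = (\<integral>\<^sup>+w. ennreal (norm (k w)) * ?T N w \<partial>lborel)"
        by (simp add: nn_integral_cmult)
      finally show ?thesis .
    qed
    have "(\<lambda>N. \<integral>\<^sup>+w. ennreal (norm (k w)) * ?T N w \<partial>lborel) \<longlonglongrightarrow> (\<integral>\<^sup>+w. 0 \<partial>(lborel :: (real^'n) measure))"
    proof (rule nn_integral_dominated_convergence[where w = "\<lambda>w. ennreal (norm (k w)) * (2 * emeasure lborel (cball 0 R :: (real^'n) set))"])
      show "AE w in lborel. ennreal (norm (k w)) * ?T N w \<le> ennreal (norm (k w)) * (2 * emeasure lborel (cball 0 R :: (real^'n) set))" for N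
      proof (intro AE_I2 mult_left_mono)
        fix w :: "real^'n"
        have "?T N w \<le> (\<integral>\<^sup>+y. ennreal (f (y + (1 / c N) *\<^sub>R w)) + ennreal (f y) \<partial>lborel)"
          using cutoffD(2)[OF f] by (intro nn_integral_mono) (auto simp: ennreal_plus[symmetric] abs_le_iff intro!: ennreal_leI simp del: ennreal_plus)
        also have "\<dots> = (\<integral>\<^sup>+y. ennreal (f (y + (1 / c N) *\<^sub>R w)) \<partial>lborel) + (\<integral>\<^sup>+y. ennreal (f y) \<partial>lborel)"
          by (rule nn_integral_add) measurable
        also have "(\<integral>\<^sup>+y. ennreal (f (y + (1 / c N) *\<^sub>R w)) \<partial>lborel) = (\<integral>\<^sup>+y. ennreal (f y) \<partial>lborel)"
          using nn_integral_lborel_translate[of "\<lambda>y. ennreal (f y)" "- (1 / c N) *\<^sub>R w"] by simp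
        also have "(\<integral>\<^sup>+y. ennreal (f y) \<partial>lborel) + (\<integral>\<^sup>+y. ennreal (f y) \<partial>lborel) \<le> 2 * emeasure lborel (cball 0 R :: (real^'n) set)"
          using add_mono[OF nn_integral_cutoff_le[OF f] nn_integral_cutoff_le[OF f]] by (simp add: mult_2)
        finally show "?T N w \<le> 2 * emeasure lborel (cball 0 R :: (real^'n) set)" .
      qed simp
      show "AE w in lborel. (\<lambda>N. ennreal (norm (k w)) * ?T N w) \<longlonglongrightarrow> 0"
      proof (rule AE_I2)
        fix w :: "real^'n"
        have "(\<lambda>N. (1 / c N) *\<^sub>R w) \<longlonglongrightarrow> 0 *\<^sub>R w" by (intro tendsto_intros inv)
        then have z: "(\<lambda>N. (1 / c N) *\<^sub>R w) \<longlonglongrightarrow> 0" by simp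
        \<comment> \<open>The lower bound \<delta> on the dilations keeps the shifts bounded for
          fixed w, so that all translates of \<open>f\<close> live in one ball.\<close>
        have b: "norm ((1 / c N) *\<^sub>R w) \<le> norm w / \<delta>" for N
          using c(1) c(2)[of N] c0[of N] by (simp add: frac_le)
        have "(\<lambda>N. ennreal (norm (k w)) * ?T N w) \<longlonglongrightarrow> ennreal (norm (k w)) * 0"
          by (intro ennreal_tendsto_cmult cutoff_translation_continuous[OF f z b]) simp
        then show "(\<lambda>N. ennreal (norm (k w)) * ?T N w) \<longlonglongrightarrow> 0" by simp
      qed
      show "(\<integral>\<^sup>+w. ennreal (norm (k w)) * (2 * emeasure lborel (cball 0 R :: (real^'n) set)) \<partial>lborel) < \<infinity>"
        using fin by (simp add: nn_integral_multc A ennreal_mult_less_top)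
    qed measurable
    then have "(\<lambda>N. \<integral>\<^sup>+w. ennreal (norm (k w)) * ?T N w \<partial>lborel) \<longlonglongrightarrow> 0" by simp
    then show ?thesis
      by (rule tendsto_sandwich[where f = "\<lambda>_. 0", rotated 3]) (use EN in auto)
  qed
  show "(\<lambda>N. LINT x|lborel. conv u (dilated_kernel (c N) k) x * of_real (f x))
      \<longlonglongrightarrow> (LINT y|lborel. u y * of_real (f y))"
  proof (rule tendstoI)
    fix e :: real assume e: "0 < e"
    let ?C = "A * (tail_const p * K powr p)"
    \<comment> \<open>First the splitting level \<open>t\<close> is fixed so that the part of
      \<open>u\<close> above it contributes less than e/2 for every N; only then is N taken so large
      that t E(N) is less than e/2.\<close>
    have "((\<lambda>t. ?C * t powr (1 - p)) \<longlongrightarrow> ?C * 0) at_top"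
      using p by (intro tendsto_intros tendsto_neg_powr filterlim_ident) auto
    then have "\<forall>\<^sub>F t in at_top. ?C * t powr (1 - p) < e / 2"
      using e by (intro order_tendstoD(2)[where y = "?C * 0"]) auto
    then have "\<forall>\<^sub>F t in at_top. 0 < t \<and> ?C * t powr (1 - p) < e / 2"
      using eventually_gt_at_top[of "0::real"] by eventually_elim auto
    then obtain t where t: "0 < t" "?C * t powr (1 - p) < e / 2"
      by (auto dest: eventually_happens)
    have "\<forall>\<^sub>F N in sequentially. E N < ennreal (e / (2 * t))"
      using e t by (intro order_tendstoD(2)[OF \<open>E \<longlonglongrightarrow> 0\<close>]) simp
    then show "\<forall>\<^sub>F N in sequentially. dist (LINT x|lborel. conv u (dilated_kernel (c N) k) x * of_real (f x))
        (LINT y|lborel. u y * of_real (f y)) < e"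
    proof eventually_elim
      fix N assume N: "E N < ennreal (e / (2 * t))"
      have I: "integrable lborel (\<lambda>y. u y * (g N y - of_real (f y)))"
        using Bochner_Integration.integrable_diff[OF ugi[of N] ufi] by (simp add: right_diff_distrib)
      have "(LINT x|lborel. conv u (dilated_kernel (c N) k) x * of_real (f x)) - (LINT y|lborel. u y * of_real (f y))
          = (LINT y|lborel. u y * (g N y - of_real (f y)))" (is "?d = _")
        using Bochner_Integration.integral_diff[OF ugi[of N] ufi] by (simp add: swap right_diff_distrib)
      then have "ennreal (norm ?d) \<le> (\<integral>\<^sup>+y. ennreal (norm (u y)) * ennreal (norm (g N y - of_real (f y))) \<partial>lborel)"
        using integral_norm_bound_ennreal[OF I] by (simp add: norm_mult ennreal_mult)
      also have "\<dots> \<le> ennreal t * E N + ennreal (A * (tail_const p * K powr p * t powr (1 - p)))"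
        unfolding E_def using A0 by (intro weak_bound_pairing[OF F p K t(1)]) (auto intro: ennreal_leI gf_bound)
      also have "\<dots> \<le> ennreal t * ennreal (e / (2 * t)) + ennreal (A * (tail_const p * K powr p * t powr (1 - p)))"
        using N by (intro add_right_mono mult_left_mono) auto
      also have "\<dots> = ennreal (e / 2 + ?C * t powr (1 - p))"
        using t e A0 tail_const_pos[OF p] by (simp add: ennreal_mult'[symmetric] ennreal_plus[symmetric] mult.assoc del: ennreal_plus)
      also have "\<dots> < ennreal e" using t(2) e by (intro ennreal_lessI) auto
      finally show "dist (LINT x|lborel. conv u (dilated_kernel (c N) k) x * of_real (f x))
        (LINT y|lborel. u y * of_real (f y)) < e"
        by (simp add: dist_norm ennreal_less_iff)
    qed
  qed
qed

section \<open>The distribution of a function from its Littlewood--Paley pieces\<close>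

lemma weak_bound_AE_finite:
  fixes F :: "'a::euclidean_space \<Rightarrow> ennreal"
  assumes F: "weak_bound p K F" and "0 < p" and "0 < K"
  shows "AE x in lborel. F x < \<infinity>"
proof -
  note [measurable] = weak_boundD(1)[OF F]
  have "emeasure lborel {x. F x = \<infinity>} \<le> ennreal ((K / t) powr p)" if "0 < t" for t
  proof -
    have "emeasure lborel {x. F x = \<infinity>} \<le> emeasure lborel {x. ennreal t < F x}"
      by (intro emeasure_mono) auto
    then show ?thesis using weak_boundD(2)[OF F that] by simp
  qed
  then have "\<forall>\<^sub>F t in at_top. emeasure lborel {x. F x = \<infinity>} \<le> ennreal ((K / t) powr p)"
    by (rule eventually_mono[OF eventually_gt_at_top[of "0::real"]])
  moreover have "((\<lambda>t. ennreal ((K / t) powr p)) \<longlongrightarrow> ennreal 0) at_top"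
  proof (rule tendsto_ennrealI)
    have "((\<lambda>t. K powr p * t powr (- p)) \<longlongrightarrow> K powr p * 0) at_top"
      using \<open>0 < p\<close> by (intro tendsto_intros tendsto_neg_powr filterlim_ident) auto
    then have "((\<lambda>t. K powr p * t powr (- p)) \<longlongrightarrow> 0) at_top" by simp
    moreover have "\<forall>\<^sub>F t in at_top. K powr p * t powr (- p) = (K / t) powr p"
      using eventually_gt_at_top[of "0::real"]
      by eventually_elim (use \<open>0 < K\<close> in \<open>simp add: powr_divide powr_minus_divide\<close>)
    ultimately show "((\<lambda>t. (K / t) powr p) \<longlongrightarrow> 0) at_top" by (rule Lim_transform_eventually)
  qed
  ultimately have "emeasure lborel {x. F x = \<infinity>} \<le> ennreal 0"
    by (intro tendsto_lowerbound) auto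
  then have "{x. F x = \<infinity>} \<in> null_sets lborel" by auto
  from AE_not_in[OF this] show ?thesis by (simp add: less_top)
qed

text \<open>What the distribution estimate uses of Fourier analysis: \<open>k\<close> is the
  low-frequency kernel, \<open>h\<close> is its increment between consecutive dyadic scales, and
  \<open>h'\<close> recovers the pieces of \<open>u\<close> from the functions that carry the weak
  L^r bound.\<close>

locale littlewood_paley_kernels =
  fixes k h h' :: "real^'n \<Rightarrow> complex" and Mk Mh' :: real
  assumes k: "integrable lborel k" "\<And>x. norm (k x) \<le> Mk" "(LINT x|lborel. k x) = 1"
    and h: "integrable lborel h"
    and h': "integrable lborel h'" "\<And>x. norm (h' x) \<le> Mh'"
    and telescope: "\<And>c x. 0 < c \<Longrightarrow> dilated_kernel (2 * c) k x - dilated_kernel c k x = dilated_kernel c h x"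
begin

lemma measurable_kernels [measurable]:
  "k \<in> borel_measurable borel" "h \<in> borel_measurable borel" "h' \<in> borel_measurable borel"
  using k(1) h h'(1) by auto

definition "Ak = (LINT x|lborel. norm (k x))"
text \<open>The added 1 supplies the positive mass that \<open>weak_young\<close> assumes.\<close>

definition "Ah' = (LINT x|lborel. norm (h' x)) + 1"

lemma kernel_mass:
  "0 \<le> Ak" "(\<integral>\<^sup>+x. ennreal (norm (k x)) \<partial>lborel) \<le> ennreal Ak"
  "0 < Ah'" "(\<integral>\<^sup>+x. ennreal (norm (h' x)) \<partial>lborel) \<le> ennreal Ah'"
proof -
  show "0 \<le> Ak" by (simp add: Ak_def)
  have "0 \<le> (LINT x|lborel. norm (h' x))" by simp
  then show "0 < Ah'" unfolding Ah'_def by linarith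
  show "(\<integral>\<^sup>+x. ennreal (norm (k x)) \<partial>lborel) \<le> ennreal Ak"
    using k(1) by (simp add: Ak_def nn_integral_eq_integral)
  show "(\<integral>\<^sup>+x. ennreal (norm (h' x)) \<partial>lborel) \<le> ennreal Ah'"
    using h'(1) by (simp add: Ah'_def nn_integral_eq_integral ennreal_leI)
qed

definition low_part :: "(real^'n \<Rightarrow> complex) \<Rightarrow> int \<Rightarrow> real^'n \<Rightarrow> complex" where
  "low_part u j = conv u (dilated_kernel (2 powr real_of_int j) k)"

definition piece :: "(real^'n \<Rightarrow> complex) \<Rightarrow> int \<Rightarrow> real^'n \<Rightarrow> complex" where
  "piece u j = conv u (dilated_kernel (2 powr real_of_int j) h)"

lemma piece_measurable: "u \<in> borel_measurable borel \<Longrightarrow> piece u j \<in> borel_measurable borel"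
  unfolding piece_def by (intro borel_measurable_conv borel_measurable_dilated_kernel) auto

lemma low_part_measurable: "u \<in> borel_measurable borel \<Longrightarrow> low_part u j \<in> borel_measurable borel"
  unfolding low_part_def by (intro borel_measurable_conv borel_measurable_dilated_kernel) auto

context
  fixes p K :: real and u :: "real^'n \<Rightarrow> complex"
  assumes u [measurable]: "u \<in> borel_measurable borel"
    and wu: "weak_bound p K (\<lambda>x. ennreal (norm (u x)))" and p: "1 < p" and K: "0 < K"
begin

lemma low_part_bound:
  "norm (low_part u j x) \<le> (Ak + Mk * tail_const p) * (K * (2 powr real_of_int j) powr (real CARD('n) / p))"
  unfolding low_part_def
  by (rule conv_integrable(2)[OF wu p K _ u _ k(2) kernel_mass(2,1)]) auto

lemma low_part_Suc: "low_part u (j + 1) x = low_part u j x + piece u j x"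
proof -
  let ?c = "2 powr real_of_int j"
  have c: "2 powr real_of_int (j + 1) = 2 * ?c" by (simp add: powr_add)
  have i: "integrable lborel (\<lambda>y. u y * dilated_kernel (2 * ?c) k (x - y))"
    "integrable lborel (\<lambda>y. u y * dilated_kernel ?c k (x - y))"
    by (intro conv_integrable(1)[OF wu p K _ u _ k(2) kernel_mass(2,1)]; simp)+
  have "low_part u (j + 1) x - low_part u j x
      = (LINT y|lborel. u y * dilated_kernel (2 * ?c) k (x - y) - u y * dilated_kernel ?c k (x - y))"
    unfolding low_part_def conv_def c using i by simp
  also have "\<dots> = piece u j x"
    unfolding piece_def conv_def
    by (intro Bochner_Integration.integral_cong refl) (simp add: telescope[symmetric] right_diff_distrib)
  finally show ?thesis by (simp add: algebra_simps)
qed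

lemma low_part_add: "low_part u (j + int N) x = low_part u j x + (\<Sum>i<N. piece u (j + int i) x)"
proof (induction N)
  case (Suc N)
  have "low_part u (j + int (Suc N)) x = low_part u ((j + int N) + 1) x" by (simp add: ac_simps)
  then show ?case using Suc low_part_Suc[of "j + int N" x] by simp
qed simp

text \<open>The bound on the sum of absolute pieces makes it finite almost everywhere and integrable
  against cutoffs. Hence the low parts at scales j + N converge almost everywhere to a function v,
  with domination. The same low parts are convolutions with an approximate identity, so against
  cutoffs they also converge to \<open>u\<close>; therefore u = v almost everywhere.\<close>

lemma AE_norm_le_low_part_plus_pieces:
  fixes j :: int
  assumes W: "weak_bound m L (\<lambda>x. \<Sum>i. ennreal (norm (piece u (j + int i) x)))" and m: "1 < m" and L: "0 < L"
  shows "AE x in lborel. ennreal (norm (u x)) \<le> ennreal (norm (low_part u j x)) + (\<Sum>i. ennreal (norm (piece u (j + int i) x)))"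
proof -
  let ?W = "\<lambda>x. \<Sum>i. ennreal (norm (piece u (j + int i) x))"
  note [measurable] = piece_measurable[OF u] low_part_measurable[OF u]
  have fin: "AE x in lborel. ?W x < \<infinity>" by (rule weak_bound_AE_finite[OF W _ L]) (use m in simp)
  define v where "v x = low_part u j x + (\<Sum>i. piece u (j + int i) x)" for x
  have [measurable]: "v \<in> borel_measurable borel" unfolding v_def[abs_def] by measurable
  have sm: "summable (\<lambda>i. norm (piece u (j + int i) x))" and enn: "ennreal (\<Sum>i. norm (piece u (j + int i) x)) = ?W x"
    if "?W x < \<infinity>" for x
  proof -
    show s: "summable (\<lambda>i. norm (piece u (j + int i) x))"
      using that by (intro summable_suminf_not_top) auto
    show "ennreal (\<Sum>i. norm (piece u (j + int i) x)) = ?W x"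
      using s by (intro suminf_ennreal_eq[symmetric]) (auto intro: summable_sums)
  qed
  have lim: "(\<lambda>N. low_part u (j + int N) x) \<longlonglongrightarrow> v x" if "?W x < \<infinity>" for x
    unfolding low_part_add v_def using summable_LIMSEQ[OF summable_norm_cancel[OF sm[OF that]]] by (intro tendsto_intros)
  define S where "S = (Ak + Mk * tail_const p) * (K * (2 powr real_of_int j) powr (real CARD('n) / p))"
  have S: "norm (low_part u j x) \<le> S" for x using low_part_bound by (simp add: S_def)
  have S0: "0 \<le> S" using S[of 0] norm_ge_zero order_trans by blast
  have AEuv: "AE x in lborel. u x - v x = 0"
  proof (rule AE_eq_zero_of_cutoff_integrals)
    fix R and f :: "real^'n \<Rightarrow> real" assume f: "cutoff R f"
    note [measurable] = cutoffD(5)[OF f]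
    let ?c = "\<lambda>N. 2 powr real_of_int (j + int N)"
    have c: "0 < 2 powr real_of_int j" "2 powr real_of_int j \<le> ?c N" for N by auto
    have cl: "filterlim ?c at_top sequentially"
    proof -
      have "filterlim (\<lambda>N. (2::real) ^ N) at_top sequentially"
        by (rule filterlim_at_infinity_imp_filterlim_at_top[OF filterlim_realpow_sequentially_gt1]) auto
      then have "filterlim (\<lambda>N. 2 powr real_of_int j * (2::real) ^ N) at_top sequentially"
        by (intro filterlim_tendsto_pos_mult_at_top[OF tendsto_const]) auto
      then show ?thesis by (simp add: powr_add powr_realpow)
    qed
    note ai = approximate_identity_pairing[OF wu p K u _ k(2) k(1,3) f c cl]
    have ui: "integrable lborel (\<lambda>x. u x * of_real (f x))" by (rule ai(1)) simp
    have ul: "(\<lambda>N. LINT x|lborel. low_part u (j + int N) x * of_real (f x)) \<longlonglongrightarrow> (LINT x|lborel. u x * of_real (f x))"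
      unfolding low_part_def by (rule ai(2)) simp
    have Wf: "(\<integral>\<^sup>+x. ?W x * ennreal (f x) \<partial>lborel) < \<infinity>"
    proof -
      have "(\<integral>\<^sup>+x. ?W x * ennreal (f x) \<partial>lborel)
        \<le> ennreal 1 * (\<integral>\<^sup>+y. ennreal (f y) \<partial>lborel) + ennreal (1 * (tail_const m * L powr m * 1 powr (1 - m)))"
        using cutoffD(3)[OF f] by (intro weak_bound_pairing[OF W m L]) (auto intro: ennreal_leI)
      also have "\<dots> < \<infinity>"
        using nn_integral_cutoff_le[OF f] emeasure_lborel_cball_finite[of 0 R]
        by (auto simp: ennreal_add_less_top intro: le_less_trans)
      finally show ?thesis .
    qed
    \<comment> \<open>Where the sum is infinite, \<open>enn2real\<close> returns 0; the domination
      below is claimed only off that null set.\<close>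
    let ?dom = "\<lambda>x. (S + enn2real (?W x)) * f x"
    have dom_i: "integrable lborel ?dom"
    proof (rule integrableI_bounded)
      have "(\<integral>\<^sup>+x. ennreal (norm (?dom x)) \<partial>lborel) \<le> (\<integral>\<^sup>+x. ennreal S * ennreal (f x) + ?W x * ennreal (f x) \<partial>lborel)"
      proof (rule nn_integral_mono)
        fix x
        have "ennreal (norm (?dom x)) = ennreal S * ennreal (f x) + ennreal (enn2real (?W x)) * ennreal (f x)"
          using S0 cutoffD(2)[OF f, of x] by (simp add: abs_mult distrib_right ennreal_mult)
        also have "\<dots> \<le> ennreal S * ennreal (f x) + ?W x * ennreal (f x)"
          by (intro add_left_mono mult_right_mono) (auto simp: ennreal_enn2real_if)
        finally show "ennreal (norm (?dom x)) \<le> ennreal S * ennreal (f x) + ?W x * ennreal (f x)" .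
      qed
      also have "\<dots> = ennreal S * (\<integral>\<^sup>+x. ennreal (f x) \<partial>lborel) + (\<integral>\<^sup>+x. ?W x * ennreal (f x) \<partial>lborel)"
        by (simp add: nn_integral_add nn_integral_cmult)
      also have "\<dots> < \<infinity>"
        using Wf nn_integral_cutoff_le[OF f] emeasure_lborel_cball_finite[of 0 R]
        by (auto simp: ennreal_add_less_top ennreal_mult_less_top intro: le_less_trans)
      finally show "(\<integral>\<^sup>+x. ennreal (norm (?dom x)) \<partial>lborel) < \<infinity>" .
    qed measurable
    have dominated: "AE x in lborel. norm (low_part u (j + int N) x * of_real (f x)) \<le> ?dom x" for N
      using fin
    proof eventually_elim
      fix x assume x: "?W x < \<infinity>"
      have "norm (low_part u (j + int N) x) \<le> norm (low_part u j x) + norm (\<Sum>i<N. piece u (j + int i) x)"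
        unfolding low_part_add by (rule norm_triangle_ineq)
      also have "\<dots> \<le> S + (\<Sum>i<N. norm (piece u (j + int i) x))"
        by (intro add_mono S norm_sum)
      also have "\<dots> \<le> S + (\<Sum>i. norm (piece u (j + int i) x))"
        by (intro add_left_mono sum_le_suminf sm[OF x]) auto
      also have "(\<Sum>i. norm (piece u (j + int i) x)) = enn2real (?W x)"
        unfolding enn[OF x, symmetric] by (simp add: suminf_nonneg sm[OF x])
      finally show "norm (low_part u (j + int N) x * of_real (f x)) \<le> ?dom x"
        using cutoffD(2)[OF f, of x] by (simp add: norm_mult mult_right_mono)
    qed
    have limf: "AE x in lborel. (\<lambda>N. low_part u (j + int N) x * of_real (f x)) \<longlonglongrightarrow> v x * of_real (f x)"
      using fin by eventually_elim (intro tendsto_intros lim)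
    have m: "(\<lambda>x. v x * of_real (f x)) \<in> borel_measurable lborel"
      "\<And>N. (\<lambda>x. low_part u (j + int N) x * of_real (f x)) \<in> borel_measurable lborel" by measurable
    have vi: "integrable lborel (\<lambda>x. v x * of_real (f x))"
      by (rule integrable_dominated_convergence[OF m dom_i limf dominated])
    have "(\<lambda>N. LINT x|lborel. low_part u (j + int N) x * of_real (f x)) \<longlonglongrightarrow> (LINT x|lborel. v x * of_real (f x))"
      by (rule integral_dominated_convergence[OF m dom_i limf dominated])
    then have "(LINT x|lborel. u x * of_real (f x)) = (LINT x|lborel. v x * of_real (f x))"
      using ul LIMSEQ_unique by blast
    then show "integrable lborel (\<lambda>x. (u x - v x) * of_real (f x))" "(LINT x|lborel. (u x - v x) * of_real (f x)) = 0"
      using ui vi by (simp_all add: left_diff_distrib)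
  qed measurable
  from fin AEuv show ?thesis
  proof eventually_elim
    fix x assume x: "?W x < \<infinity>" "u x - v x = 0"
    then have "norm (u x) \<le> norm (low_part u j x) + norm (\<Sum>i. piece u (j + int i) x)"
      by (simp add: v_def norm_triangle_ineq)
    also have "\<dots> \<le> norm (low_part u j x) + (\<Sum>i. norm (piece u (j + int i) x))"
      by (intro add_left_mono summable_norm sm[OF x(1)])
    finally have "ennreal (norm (u x)) \<le> ennreal (norm (low_part u j x) + (\<Sum>i. norm (piece u (j + int i) x)))"
      by (rule ennreal_leI)
    then show "ennreal (norm (u x)) \<le> ennreal (norm (low_part u j x)) + ?W x"
      using enn[OF x(1)] suminf_nonneg[OF sm[OF x(1)]] by (simp add: ennreal_plus)
  qed
qed

end

text \<open>The representation of \<open>D\<close> is used twice. Pointwise, the dilation factor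
  2^(jn/r) cancels against the constant of \<open>g\<close> and leaves a multiple of B. In weak L^r,
  \<open>weak_young\<close> loses no power of 2^j, since dilation preserves the mass of the kernel.
  The maximum covers both constants, and raising the exponent with s = 2^(jn/r) yields the factor
  2^(-jn).\<close>

lemma piece_distribution:
  fixes g :: "real^'n \<Rightarrow> complex"
  assumes [measurable]: "g \<in> borel_measurable borel"
    and wg: "weak_bound r (2 powr (- real_of_int j * real CARD('n) / r) * B) (\<lambda>x. ennreal (norm (g x)))"
    and r: "1 < r" "r \<le> m" and B: "0 < B"
    and D: "\<And>x. D x = conv g (dilated_kernel (2 powr real_of_int j) h') x"
    and \<alpha>: "0 < \<alpha>"
  shows "emeasure lborel {x. ennreal \<alpha> < ennreal (norm (D x))}
    \<le> ennreal (2 powr (- real_of_int j * real CARD('n))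
        * (max (Ah' + Mh' * tail_const r) (tail_const r powr (1 / r) * (2 * Ah')) * B / \<alpha>) powr m)"
proof -
  let ?c = "2 powr real_of_int j" let ?n = "real CARD('n)" let ?s = "2 powr (real_of_int j * real CARD('n) / r)"
  let ?C = "tail_const r powr (1 / r) * (2 * Ah')" let ?L = "2 powr (- real_of_int j * real CARD('n) / r) * B"
  let ?M = "max (Ah' + Mh' * tail_const r) ?C"
  have L: "0 < ?L" using B by simp
  have sL: "?s * ?L = B" by (simp add: powr_add[symmetric] mult.assoc[symmetric])
  have C: "0 < ?C" using kernel_mass(3) tail_const_pos[OF r(1)] by simp
  have "(\<integral>\<^sup>+x. ennreal (norm (dilated_kernel ?c h' x)) \<partial>lborel) = (\<integral>\<^sup>+x. ennreal (norm (h' x)) \<partial>lborel)"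
    by (subst nn_integral_lborel_affine[where c = ?c and t = 0 and f = "\<lambda>x. ennreal (norm (h' x))"])
      (auto simp: dilated_kernel_def norm_mult norm_power ennreal_mult nn_integral_cmult)
  then have "weak_bound r (?C * ?L) (\<lambda>x. \<integral>\<^sup>+y. ennreal (norm (g y)) * ennreal (norm (dilated_kernel ?c h' (x - y))) \<partial>lborel)"
    using kernel_mass(4) by (intro weak_young[OF wg r(1) L _ _ kernel_mass(3)]) auto
  then have wb: "emeasure lborel {x. ennreal \<beta> < (\<integral>\<^sup>+y. ennreal (norm (g y)) * ennreal (norm (dilated_kernel ?c h' (x - y))) \<partial>lborel)}
      \<le> ennreal ((?C * ?L / \<beta>) powr r)" if "0 < \<beta>" for \<beta>
    using that by (rule weak_boundD(2))
  have c0: "0 < ?c" by simp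
  note ci = conv_integrable[OF wg r(1) L c0 assms(1) _ h'(2) kernel_mass(4) less_imp_le[OF kernel_mass(3)]]
  have nD: "ennreal (norm (D x)) \<le> (\<integral>\<^sup>+y. ennreal (norm (g y)) * ennreal (norm (dilated_kernel ?c h' (x - y))) \<partial>lborel)" for x
    unfolding D conv_def using integral_norm_bound_ennreal[OF ci(1)] by (simp add: norm_mult ennreal_mult)
  have Dm: "(\<lambda>x. ennreal (norm (D x))) \<in> borel_measurable borel"
  proof -
    have "D = conv g (dilated_kernel ?c h')" using D by auto
    then have "D \<in> borel_measurable borel" by (simp add: borel_measurable_conv borel_measurable_dilated_kernel)
    then show ?thesis by measurable
  qed
  have wD: "weak_bound r (?C * ?L) (\<lambda>x. ennreal (norm (D x)))"
    unfolding weak_bound_def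
  proof (intro conjI allI impI Dm)
    fix \<beta> :: real assume \<beta>: "0 < \<beta>"
    have "emeasure lborel {x. ennreal \<beta> < ennreal (norm (D x))}
      \<le> emeasure lborel {x. ennreal \<beta> < (\<integral>\<^sup>+y. ennreal (norm (g y)) * ennreal (norm (dilated_kernel ?c h' (x - y))) \<partial>lborel)}"
    proof (rule emeasure_mono)
      show "{x. ennreal \<beta> < (\<integral>\<^sup>+y. ennreal (norm (g y)) * ennreal (norm (dilated_kernel ?c h' (x - y))) \<partial>lborel)} \<in> sets lborel"
        by measurable
    qed (use nD less_le_trans in blast)
    then show "emeasure lborel {x. ennreal \<beta> < ennreal (norm (D x))} \<le> ennreal ((?C * ?L / \<beta>) powr r)"
      using wb[OF \<beta>] by (rule order_trans)
  qed
  have "norm (D x) \<le> ?M * B" for x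
  proof -
    have "norm (D x) \<le> (Ah' + Mh' * tail_const r) * (?L * ?c powr (?n / r))"
      unfolding D by (rule ci(2)) simp
    also have "?L * ?c powr (?n / r) = B"
      using sL by (simp add: powr_powr mult.commute)
    also have "(Ah' + Mh' * tail_const r) * B \<le> ?M * B" using B by (intro mult_right_mono) auto
    finally show ?thesis .
  qed
  moreover have "?s * (?C * ?L) \<le> ?M * B"
  proof -
    have "?s * (?C * ?L) = ?C * B" using sL by (simp add: mult.left_commute)
    also have "\<dots> \<le> ?M * B" using B by (intro mult_right_mono) auto
    finally show ?thesis .
  qed
  ultimately have "emeasure lborel {x. ennreal \<alpha> < ennreal (norm (D x))} \<le> ennreal (?s powr (- r) * (?M * B / \<alpha>) powr m)"
    using C L \<alpha> r by (intro weak_bound_raise_exponent[OF wD r(2)]) (auto intro: ennreal_leI)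
  also have "?s powr (- r) = 2 powr (- real_of_int j * ?n)" using r by (simp add: powr_powr)
  finally show ?thesis .
qed

theorem distribution_estimate:
  assumes p: "1 < p" and r: "1 < r" "r \<le> m"
  obtains C where "0 < C"
    "\<And>u g K B \<alpha>. u \<in> borel_measurable borel \<Longrightarrow> weak_bound p K (\<lambda>x. ennreal (norm (u x))) \<Longrightarrow> 0 < K \<Longrightarrow> 0 < B \<Longrightarrow>
      (\<And>j. g j \<in> borel_measurable borel) \<Longrightarrow>
      (\<And>j::int. weak_bound r (2 powr (- real_of_int j * real CARD('n) / r) * B) (\<lambda>x. ennreal (norm (g j x)))) \<Longrightarrow>
      (\<And>j x. conv u (dilated_kernel (2 powr real_of_int j) h) x = conv (g j) (dilated_kernel (2 powr real_of_int j) h') x) \<Longrightarrow>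
      0 < \<alpha> \<Longrightarrow>
      emeasure lborel {x. ennreal \<alpha> < ennreal (norm (u x))} \<le> ennreal (C * (K / \<alpha>) powr p * (B / \<alpha>) powr m)"
proof -
  let ?n = "real CARD('n)"
  define M where "M = max (Ah' + Mh' * tail_const r) (tail_const r powr (1 / r) * (2 * Ah'))"
  have M: "0 < M" using kernel_mass(3) tail_const_pos[OF r(1)] by (simp add: M_def less_max_iff_disj)
  have m: "1 < m" "0 < m" using r by auto
  define \<theta> where "\<theta> = 2 powr (- ?n)"
  have \<theta>: "0 < \<theta>" "\<theta> < 1" by (auto simp: \<theta>_def powr_less_one)
  obtain G where G: "0 < G"
    "\<And>(F :: nat \<Rightarrow> real^'n \<Rightarrow> ennreal) a B \<alpha>.
      (\<And>i. F i \<in> borel_measurable borel) \<Longrightarrow> 0 \<le> a \<Longrightarrow> 0 < B \<Longrightarrow> 0 < \<alpha> \<Longrightarrow>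
      (\<And>i \<beta>. 0 < \<beta> \<Longrightarrow> emeasure lborel {x. ennreal \<beta> < F i x} \<le> ennreal (a * \<theta> ^ i * (B / \<beta>) powr m)) \<Longrightarrow>
      emeasure lborel {x. ennreal \<alpha> < (\<Sum>i. F i x)} \<le> ennreal (G * a * (B / \<alpha>) powr m)"
    using weak_bound_geometric_sum[OF \<theta> m(2), where 'a = "real^'n"] by blast
  \<comment> \<open>The absolute value and the added 1 make \<open>S\<close> positive, so the choice
    of the scale may divide by it.\<close>
  define S where "S = Ak + \<bar>Mk\<bar> * tail_const p + 1"
  have S: "0 < S" "Ak + Mk * tail_const p \<le> S"
  proof -
    have "Mk * tail_const p \<le> \<bar>Mk\<bar> * tail_const p" "0 \<le> \<bar>Mk\<bar> * tail_const p"
      using tail_const_pos[OF p] by (auto intro: mult_right_mono)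
    then show "0 < S" "Ak + Mk * tail_const p \<le> S"
      using kernel_mass(1) unfolding S_def by linarith+
  qed
  define C where "C = G * (2 powr ?n * (2 * S) powr p) * (2 * M) powr m"
  have "emeasure lborel {x. ennreal \<alpha> < ennreal (norm (u x))} \<le> ennreal (C * (K / \<alpha>) powr p * (B / \<alpha>) powr m)"
    if u: "u \<in> borel_measurable borel" and wu: "weak_bound p K (\<lambda>x. ennreal (norm (u x)))" and K: "0 < K" and B: "0 < B"
      and g: "\<And>j. g j \<in> borel_measurable borel"
        "\<And>j::int. weak_bound r (2 powr (- real_of_int j * real CARD('n) / r) * B) (\<lambda>x. ennreal (norm (g j x)))"
      and eq: "\<And>j x. conv u (dilated_kernel (2 powr real_of_int j) h) x = conv (g j) (dilated_kernel (2 powr real_of_int j) h') x"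
      and \<alpha>: "0 < \<alpha>"
    for u :: "real^'n \<Rightarrow> complex" and g K B \<alpha>
  proof -
    note [measurable] = piece_measurable[OF u] u
    \<comment> \<open>\<open>X\<close> solves S K X^(n/p) = \<alpha>/2, so every scale up to
      \<open>X\<close> keeps the low frequencies below \<alpha>/2. The integer j rounds
      \<open>X\<close> down to a power of 2.\<close>
    define X where "X = (\<alpha> / (2 * S * K)) powr (p / ?n)"
    have X: "0 < X" using \<alpha> S K by (simp add: X_def)
    define j where "j = \<lfloor>log 2 X\<rfloor>"
    have j1: "2 powr real_of_int j \<le> X"
    proof -
      have "2 powr real_of_int j \<le> 2 powr (log 2 X)" unfolding j_def by (intro powr_mono) auto
      then show ?thesis using X by simp
    qed
    have j2: "X \<le> 2 * 2 powr real_of_int j"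
    proof -
      have "2 powr (log 2 X) \<le> 2 powr (1 + real_of_int j)" unfolding j_def by (intro powr_mono) linarith+
      then show ?thesis using X by (simp add: powr_add)
    qed
    let ?W = "\<lambda>x. \<Sum>i. ennreal (norm (piece u (j + int i) x))"
    have W: "emeasure lborel {x. ennreal \<beta> < ?W x} \<le> ennreal (G * 2 powr (- real_of_int j * ?n) * (M * B / \<beta>) powr m)"
      if \<beta>: "0 < \<beta>" for \<beta>
    proof (rule G(2))
      fix i :: nat and \<gamma> :: real assume \<gamma>: "0 < \<gamma>"
      have "emeasure lborel {x. ennreal \<gamma> < ennreal (norm (piece u (j + int i) x))}
         \<le> ennreal (2 powr (- real_of_int (j + int i) * ?n) * (M * B / \<gamma>) powr m)"
        unfolding M_def by (rule piece_distribution[OF g r B _ \<gamma>]) (simp only: piece_def eq)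
      also have "2 powr (- real_of_int (j + int i) * ?n) = 2 powr (- real_of_int j * ?n) * \<theta> ^ i"
        by (simp add: \<theta>_def powr_realpow[symmetric] powr_powr powr_add[symmetric] algebra_simps)
      finally show "emeasure lborel {x. ennreal \<gamma> < ennreal (norm (piece u (j + int i) x))}
         \<le> ennreal (2 powr (- real_of_int j * ?n) * \<theta> ^ i * (M * B / \<gamma>) powr m)" .
    qed (use \<beta> M B in auto)
    \<comment> \<open>The estimate just obtained for the sum of the pieces is rewritten as a weak
      bound with exponent m and constant \<open>L\<close>, the form in which the decomposition of
      \<open>u\<close> takes it.\<close>
    define Y where "Y = G * 2 powr (- real_of_int j * ?n)"
    have Y: "0 < Y" using G(1) by (simp add: Y_def)
    define L where "L = Y powr (1 / m) * (M * B)"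
    have L: "0 < L" using Y M B by (simp add: L_def)
    have "weak_bound m L ?W"
      unfolding weak_bound_def
    proof (intro conjI allI impI)
      fix \<beta> :: real assume \<beta>: "0 < \<beta>"
      have "(L / \<beta>) powr m = G * 2 powr (- real_of_int j * ?n) * (M * B / \<beta>) powr m"
      proof -
        have "L / \<beta> = Y powr (1 / m) * (M * B / \<beta>)" by (simp add: L_def)
        then have "(L / \<beta>) powr m = (Y powr (1 / m)) powr m * (M * B / \<beta>) powr m"
          using M B \<beta> by (simp only: powr_mult)
        then show ?thesis using m Y by (simp add: powr_powr Y_def)
      qed
      then show "emeasure lborel {x. ennreal \<beta> < ?W x} \<le> ennreal ((L / \<beta>) powr m)" using W[OF \<beta>] by simp
    qed measurable
    note AE = AE_norm_le_low_part_plus_pieces[OF u wu p K this m(1) L]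
    have low: "norm (low_part u j x) \<le> \<alpha> / 2" for x
    proof -
      have "norm (low_part u j x) \<le> (Ak + Mk * tail_const p) * (K * (2 powr real_of_int j) powr (?n / p))"
        by (rule low_part_bound[OF u wu p K])
      also have "\<dots> \<le> S * (K * X powr (?n / p))"
        using S K p j1 by (intro mult_mono mult_left_mono powr_mono2) auto
      also have "X powr (?n / p) = \<alpha> / (2 * S * K)"
        using p \<alpha> S K by (simp add: X_def powr_powr)
      finally show ?thesis using S K by simp
    qed
    have "emeasure lborel {x. ennreal \<alpha> < ennreal (norm (u x))} \<le> emeasure lborel {x. ennreal (\<alpha> / 2) < ?W x}"
    proof (rule emeasure_mono_AE)
      show "AE x in lborel. x \<in> {x. ennreal \<alpha> < ennreal (norm (u x))} \<longrightarrow> x \<in> {x. ennreal (\<alpha> / 2) < ?W x}"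
        using AE
      proof eventually_elim
        fix x assume x: "ennreal (norm (u x)) \<le> ennreal (norm (low_part u j x)) + ?W x"
        show "x \<in> {x. ennreal \<alpha> < ennreal (norm (u x))} \<longrightarrow> x \<in> {x. ennreal (\<alpha> / 2) < ?W x}"
        proof (intro impI CollectI, rule ccontr)
          assume 1: "x \<in> {x. ennreal \<alpha> < ennreal (norm (u x))}" and 2: "\<not> ennreal (\<alpha> / 2) < ?W x"
          have "ennreal (norm (low_part u j x)) + ?W x \<le> ennreal (\<alpha> / 2) + ennreal (\<alpha> / 2)"
            using 2 low by (intro add_mono ennreal_leI) auto
          also have "\<dots> = ennreal \<alpha>" using \<alpha> by (simp add: ennreal_plus[symmetric] del: ennreal_plus)
          finally show False using x 1 by (auto dest: order_trans)
        qed
      qed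
    qed measurable
    also have "\<dots> \<le> ennreal (G * 2 powr (- real_of_int j * ?n) * (M * B / (\<alpha> / 2)) powr m)"
      using \<alpha> by (intro W) simp
    also have "\<dots> \<le> ennreal (C * (K / \<alpha>) powr p * (B / \<alpha>) powr m)"
    proof (rule ennreal_leI)
      \<comment> \<open>Rounding costs at most a factor 2 in the scale, hence 2^n here. Inserting
        \<open>X\<close> turns 2^(-jn) into a multiple of (K / \<alpha>)^p: this is how the weak L^p
        norm enters the final bound.\<close>
      have "2 powr (- real_of_int j * ?n) = (2 powr real_of_int j) powr (- ?n)" by (simp add: powr_powr)
      also have "\<dots> \<le> (X / 2) powr (- ?n)"
        using j2 X by (intro powr_mono2') auto
      also have "\<dots> = 2 powr ?n * X powr (- ?n)" using X by (simp add: powr_divide powr_minus_divide)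
      also have "X powr (- ?n) = (2 * S * K / \<alpha>) powr p"
      proof -
        have "X powr (- ?n) = (\<alpha> / (2 * S * K)) powr (- p)" by (simp add: X_def powr_powr)
        also have "\<dots> = (2 * S * K / \<alpha>) powr p"
          using \<alpha> S K by (simp add: powr_minus powr_divide)
        finally show ?thesis .
      qed
      also have "\<dots> = (2 * S) powr p * (K / \<alpha>) powr p"
        using S K \<alpha> powr_mult[of "2 * S" "K / \<alpha>" p] by simp
      finally have 1: "2 powr (- real_of_int j * ?n) \<le> 2 powr ?n * ((2 * S) powr p * (K / \<alpha>) powr p)" .
      have 2: "(M * B / (\<alpha> / 2)) powr m = (2 * M) powr m * (B / \<alpha>) powr m"
        using M B \<alpha> powr_mult[of "2 * M" "B / \<alpha>" m] by (simp add: mult_ac)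
      have "G * 2 powr (- real_of_int j * ?n) * (M * B / (\<alpha> / 2)) powr m
          \<le> G * (2 powr ?n * ((2 * S) powr p * (K / \<alpha>) powr p)) * ((2 * M) powr m * (B / \<alpha>) powr m)"
        unfolding 2 using G(1) by (intro mult_right_mono mult_left_mono 1) auto
      then show "G * 2 powr (- real_of_int j * ?n) * (M * B / (\<alpha> / 2)) powr m \<le> C * (K / \<alpha>) powr p * (B / \<alpha>) powr m"
        by (simp add: C_def mult_ac)
    qed
    finally show ?thesis .
  qed
  moreover have "0 < C" using G(1) S M by (simp add: C_def)
  ultimately show thesis using that by blast
qed

end

section \<open>Lorentz norms and distribution functions\<close>

lemma enn2real_one_divide: "0 < p \<Longrightarrow> enn2real (1 / ennreal p) = 1 / p"
  using divide_ennreal[of 1 p] by simp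

text \<open>If the inequality failed, some t would lie strictly between (K / \<alpha>)^p and the
  distribution function at \<alpha>. By monotonicity the rearrangement at t is then at least
  \<alpha>, so t^(1/p) \<alpha> is at most K, contrary to the choice of t.\<close>

lemma lorentz_weak_distribution:
  fixes F :: "real^'n \<Rightarrow> ennreal"
  assumes [measurable]: "F \<in> borel_measurable lebesgue" and p: "0 < p" and \<alpha>: "0 < \<alpha>" and K: "0 \<le> K"
    and norm_le: "lorentz_ennorm (ennreal p) \<infinity> F \<le> ennreal K"
  shows "distribution_fun F \<alpha> \<le> ennreal ((K / \<alpha>) powr p)"
proof (rule ccontr)
  assume "\<not> distribution_fun F \<alpha> \<le> ennreal ((K / \<alpha>) powr p)"
  then obtain z where z: "ennreal ((K / \<alpha>) powr p) < z" "z < distribution_fun F \<alpha>"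
    using dense not_le by metis
  then obtain t where t: "z = ennreal t" "0 \<le> t" by (cases z) auto
  have tK: "(K / \<alpha>) powr p < t" using z(1) t by (simp add: ennreal_less_iff)
  then have t0: "0 < t" by (meson le_less_trans powr_ge_zero)
  have "ennreal \<alpha> \<le> decreasing_rearrangement F t"
    unfolding decreasing_rearrangement_def
  proof (rule INF_greatest)
    fix \<beta> assume \<beta>: "\<beta> \<in> {\<beta>. 0 < \<beta> \<and> distribution_fun F \<beta> \<le> ennreal t}"
    show "ennreal \<alpha> \<le> ennreal \<beta>"
    proof (rule ccontr)
      assume "\<not> ennreal \<alpha> \<le> ennreal \<beta>"
      then have "ennreal \<beta> \<le> ennreal \<alpha>" by simp
      have "{x \<in> space lebesgue. ennreal \<beta> < F x} \<in> sets lebesgue" by measurable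
      then have "distribution_fun F \<alpha> \<le> distribution_fun F \<beta>"
        unfolding distribution_fun_def
        using \<open>ennreal \<beta> \<le> ennreal \<alpha>\<close> by (intro emeasure_mono) (auto dest: le_less_trans)
      then show False using \<beta> z(2) t by auto
    qed
  qed
  then have "ennreal (t powr (1 / p)) * ennreal \<alpha> \<le> ennreal (t powr (1 / p)) * decreasing_rearrangement F t"
    by (intro mult_left_mono) auto
  also have "\<dots> \<le> (SUP t\<in>{0<..}. ennreal (t powr (1 / p)) * decreasing_rearrangement F t)"
    using t0 by (intro SUP_upper) auto
  also have "\<dots> \<le> ennreal K"
    using norm_le p by (simp add: lorentz_ennorm_def enn2real_one_divide)
  finally have "t powr (1 / p) * \<alpha> \<le> K"
    using K \<alpha> by (simp add: ennreal_mult'[symmetric])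
  then have "t powr (1 / p) \<le> K / \<alpha>" using \<alpha> by (simp add: field_simps)
  then have "(t powr (1 / p)) powr p \<le> (K / \<alpha>) powr p"
    using p by (intro powr_mono2) auto
  then show False using tK t0 p by (simp add: powr_powr)
qed

section \<open>Interpolation between weak Lebesgue spaces\<close>

lemma decreasing_rearrangement_le:
  "0 < \<beta> \<Longrightarrow> distribution_fun F \<beta> \<le> ennreal t \<Longrightarrow> decreasing_rearrangement F t \<le> ennreal \<beta>"
  unfolding decreasing_rearrangement_def by (rule INF_lower) simp

lemma ennreal_powr_le:
  assumes "x \<le> ennreal y" "0 \<le> y" "0 \<le> a"
  shows "ennreal_powr x a \<le> ennreal (y powr a)"
proof -
  obtain z where z: "x = ennreal z" "0 \<le> z" using assms(1) by (cases x) (auto simp: top_unique)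
  then have "z \<le> y" using assms by simp
  then show ?thesis using z assms by (simp add: ennreal_powr_def powr_mono2 ennreal_leI)
qed

text \<open>The measure dt / t is invariant under dilation, which is why the bound does not depend
  on \<open>t0\<close>. It is the finite integral behind every finite second Lorentz index.\<close>

lemma nn_integral_powr_two_sided:
  fixes a b t0 :: real
  assumes a: "0 < a" and b: "0 < b" and t0: "0 < t0"
  shows "(\<integral>\<^sup>+t\<in>{0<..}. ennreal ((if t \<le> t0 then (t / t0) powr a else (t / t0) powr (- b)) * (1 / t)) \<partial>lborel)
    \<le> ennreal (1 / a + 1 / b)"
proof -
  have "((\<lambda>t. t0 powr (- a) * t powr (a - 1)) has_integral t0 powr (- a) * (t0 powr (a - 1 + 1) / (a - 1 + 1))) {0..t0}"
    using a t0 by (intro has_integral_mult_right has_integral_powr_from_0) auto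
  then have h1: "((\<lambda>t. t0 powr (- a) * t powr (a - 1)) has_integral 1 / a) {0..t0}"
    using a t0 by (simp add: powr_minus)
  have "((\<lambda>t. t0 powr b * t powr (- b - 1)) has_integral t0 powr b * (- (t0 powr (- b - 1 + 1)) / (- b - 1 + 1))) {t0..}"
    using b t0 by (intro has_integral_mult_right has_integral_powr_to_inf) auto
  then have h2: "((\<lambda>t. t0 powr b * t powr (- b - 1)) has_integral 1 / b) {t0..}"
    using b t0 by (simp add: powr_minus)
  have i1: "(\<integral>\<^sup>+t. ennreal (indicator {0..t0} t * (t0 powr (- a) * t powr (a - 1))) \<partial>lborel) = ennreal (1 / a)"
    by (rule nn_integral_has_integral_lborel[OF _ _
          has_integral_eq[OF _ has_integral_restrict_UNIV[THEN iffD2, OF h1]]]) auto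
  have i2: "(\<integral>\<^sup>+t. ennreal (indicator {t0..} t * (t0 powr b * t powr (- b - 1))) \<partial>lborel) = ennreal (1 / b)"
    by (rule nn_integral_has_integral_lborel[OF _ _
          has_integral_eq[OF _ has_integral_restrict_UNIV[THEN iffD2, OF h2]]]) auto
  have "(\<integral>\<^sup>+t\<in>{0<..}. ennreal ((if t \<le> t0 then (t / t0) powr a else (t / t0) powr (- b)) * (1 / t)) \<partial>lborel)
      \<le> (\<integral>\<^sup>+t. ennreal (indicator {0..t0} t * (t0 powr (- a) * t powr (a - 1)))
          + ennreal (indicator {t0..} t * (t0 powr b * t powr (- b - 1))) \<partial>lborel)"
  proof (rule nn_integral_mono)
    fix t :: real
    show "ennreal ((if t \<le> t0 then (t / t0) powr a else (t / t0) powr (- b)) * (1 / t)) * indicator {0<..} t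
      \<le> ennreal (indicator {0..t0} t * (t0 powr (- a) * t powr (a - 1)))
          + ennreal (indicator {t0..} t * (t0 powr b * t powr (- b - 1)))"
    proof (cases "0 < t")
      case True
      have "(t / t0) powr a * (1 / t) = t0 powr (- a) * t powr (a - 1)"
        "(t / t0) powr (- b) * (1 / t) = t0 powr b * t powr (- b - 1)"
        using True t0 by (simp_all add: powr_divide powr_diff powr_minus_divide)
      then show ?thesis using True by (auto simp: indicator_def)
    qed simp
  qed
  also have "\<dots> = ennreal (1 / a) + ennreal (1 / b)"
    by (subst nn_integral_add) (auto simp: i1 i2)
  finally show ?thesis using a b by (simp add: ennreal_plus[symmetric] del: ennreal_plus)
qed

text \<open>Interpolation between weak spaces; \<open>t\<^sub>0 = (K / B)\<^sup>p\<close> is, up to a constant, the point where the two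
  bounds of the decreasing rearrangement coincide.\<close>

lemma lorentz_interpolation:
  fixes p q s C :: real and l :: ennreal
  assumes p: "0 < p" "p < q" "q < s" and C: "0 < C" and l: "1 \<le> l"
  obtains C' where "0 < C'"
    "\<And>(F :: real^'n \<Rightarrow> ennreal) K B. 0 < K \<Longrightarrow> 0 < B \<Longrightarrow>
      (\<And>\<alpha>. 0 < \<alpha> \<Longrightarrow> distribution_fun F \<alpha> \<le> ennreal ((K / \<alpha>) powr p)) \<Longrightarrow>
      (\<And>\<alpha>. 0 < \<alpha> \<Longrightarrow> distribution_fun F \<alpha> \<le> ennreal (C * (K / \<alpha>) powr p * (B / \<alpha>) powr (s - p))) \<Longrightarrow>
      lorentz_ennorm (ennreal q) l F \<le> ennreal (C' * (K powr (p / q) * B powr (1 - p / q)))"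
proof -
  \<comment> \<open>The two bounds of the rearrangement carry the constants 1 and C^(1/s); the
    maximum serves both.\<close>
  define c where "c = max 1 (C powr (1 / s))"
  have c: "1 \<le> c" "C powr (1 / s) \<le> c" "0 < c" by (auto simp: c_def less_max_iff_disj)
  \<comment> \<open>For t^(1/q) times the rearrangement, the bound with exponent \<open>s\<close>
    gives growth like t^a and the weak L^p bound gives decay like t^(-b). Both exponents are
    positive because p < q < s.\<close>
  define a where "a = 1 / q - 1 / s"
  define b where "b = 1 / p - 1 / q"
  have ab: "0 < a" "0 < b" using p by (auto simp: a_def b_def field_simps)
  define C' where "C' = (if l = \<infinity> then c else c * (1 / (a * enn2real l) + 1 / (b * enn2real l)) powr (1 / enn2real l))"
  have l0: "0 < enn2real l" if "l \<noteq> \<infinity>"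
    using l that by (cases l) (auto simp: ennreal_1[symmetric] simp del: ennreal_1)
  have C': "0 < C'"
  proof (cases "l = \<infinity>")
    case False
    have "0 < 1 / (a * enn2real l) + 1 / (b * enn2real l)"
      by (intro add_pos_pos divide_pos_pos mult_pos_pos ab l0 False) auto
    then have "0 < (1 / (a * enn2real l) + 1 / (b * enn2real l)) powr (1 / enn2real l)" by simp
    then show ?thesis using c False unfolding C'_def by simp
  qed (use c in \<open>simp add: C'_def\<close>)
  show thesis
  proof (rule that[OF C'])
    fix F :: "real^'n \<Rightarrow> ennreal" and K B :: real
    assume K: "0 < K" and B: "0 < B" and F1: "\<And>\<alpha>. 0 < \<alpha> \<Longrightarrow> distribution_fun F \<alpha> \<le> ennreal ((K / \<alpha>) powr p)"
      and F2: "\<And>\<alpha>. 0 < \<alpha> \<Longrightarrow> distribution_fun F \<alpha> \<le> ennreal (C * (K / \<alpha>) powr p * (B / \<alpha>) powr (s - p))"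
    define \<kappa> where "\<kappa> = K / B"
    have \<kappa>: "0 < \<kappa>" "K = \<kappa> * B" using K B by (auto simp: \<kappa>_def)
    define N where "N = \<kappa> powr (p / q) * B"
    have N: "0 < N" "K powr (p / q) * B powr (1 - p / q) = N"
      using \<kappa> B by (auto simp: N_def powr_mult mult.assoc powr_add[symmetric])
    define t0 where "t0 = \<kappa> powr p"
    have t0: "0 < t0" using \<kappa> by (simp add: t0_def)
    define \<Phi> where "\<Phi> t = ennreal (t powr enn2real (1 / ennreal q)) * decreasing_rearrangement F t" for t
    have \<Phi>1: "\<Phi> t \<le> ennreal (c * N * (t / t0) powr (- b))" if t: "0 < t" for t
    proof -
      have "decreasing_rearrangement F t \<le> ennreal (K * t powr (- (1 / p)))"
      proof (rule decreasing_rearrangement_le)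
        show "0 < K * t powr (- (1 / p))" using K t by simp
        have "(K / (K * t powr (- (1 / p)))) powr p = t"
          using K t p by (simp add: powr_minus_divide powr_powr)
        then show "distribution_fun F (K * t powr (- (1 / p))) \<le> ennreal t"
          using F1[of "K * t powr (- (1 / p))"] K t by simp
      qed
      then have "\<Phi> t \<le> ennreal (t powr (1 / q)) * ennreal (K * t powr (- (1 / p)))"
        unfolding \<Phi>_def using p by (simp add: enn2real_one_divide mult_left_mono)
      also have "\<dots> = ennreal (t powr (1 / q) * (K * t powr (- (1 / p))))" by (simp add: ennreal_mult'[symmetric])
      also have "t powr (1 / q) * (K * t powr (- (1 / p))) = N * (t / t0) powr (- b)"
      proof -
        have "t powr (1 / q) * (K * t powr (- (1 / p))) = K * t powr (- b)"
          using t by (simp add: b_def powr_add[symmetric])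
        moreover have "N * t0 powr b = K"
        proof -
          have "p / q + p * b = 1" using p by (simp add: b_def field_simps)
          then have "\<kappa> powr (p / q) * (\<kappa> powr p) powr b = \<kappa>"
            using \<kappa>(1) by (simp only: powr_powr powr_add[symmetric]) simp
          moreover have "N * t0 powr b = \<kappa> powr (p / q) * (\<kappa> powr p) powr b * B"
            by (simp only: N_def t0_def mult_ac)
          ultimately show ?thesis by (simp only: \<kappa>(2))
        qed
        ultimately show ?thesis using t t0 by (simp add: powr_divide powr_minus_divide)
      qed
      also have "\<dots> \<le> c * N * (t / t0) powr (- b)" using c N by (intro mult_right_mono) auto
      finally show ?thesis using ennreal_leI order_trans by blast
    qed
    have \<Phi>2: "\<Phi> t \<le> ennreal (c * N * (t / t0) powr a)" if t: "0 < t" for t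
    proof -
      \<comment> \<open>The level at which the second bound of the distribution function equals t,
        that is, the solution of C (K/\<beta>)^p (B/\<beta>)^(s-p) = t, written with K = \<kappa>
        B.\<close>
      define \<beta> where "\<beta> = C powr (1 / s) * (\<kappa> powr (p / s) * B) * t powr (- (1 / s))"
      have \<beta>: "0 < \<beta>" using C \<kappa> B t by (simp add: \<beta>_def)
      have "decreasing_rearrangement F t \<le> ennreal \<beta>"
      proof (rule decreasing_rearrangement_le[OF \<beta>])
        have "C * (K / \<beta>) powr p * (B / \<beta>) powr (s - p) = C * \<kappa> powr p * B powr s / \<beta> powr s"
          using \<kappa> B \<beta> by (simp add: powr_divide powr_mult powr_diff)
        also have "\<beta> powr s = C * \<kappa> powr p * B powr s / t"
        proof -
          have "s \<noteq> 0" using p by simp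
          then show ?thesis using C \<kappa> B t by (simp add: \<beta>_def powr_mult powr_powr powr_divide powr_minus_divide)
        qed
        also have "C * \<kappa> powr p * B powr s / (C * \<kappa> powr p * B powr s / t) = t" using C \<kappa> B by simp
        finally show "distribution_fun F \<beta> \<le> ennreal t" using F2[OF \<beta>] by simp
      qed
      then have "\<Phi> t \<le> ennreal (t powr (1 / q)) * ennreal \<beta>"
        unfolding \<Phi>_def using p by (simp add: enn2real_one_divide mult_left_mono)
      also have "\<dots> = ennreal (t powr (1 / q) * \<beta>)" by (simp add: ennreal_mult'[symmetric])
      also have "t powr (1 / q) * \<beta> = C powr (1 / s) * (N * (t / t0) powr a)"
      proof -
        have e1: "t powr (1 / q) * \<beta> = C powr (1 / s) * (\<kappa> powr (p / s) * B) * t powr a"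
          using t by (simp add: \<beta>_def a_def powr_diff powr_minus divide_inverse)
        have e2: "N * t0 powr (- a) = \<kappa> powr (p / s) * B"
        proof -
          have "p / q + p * (- a) = p / s" using p by (simp add: a_def field_simps)
          then have "\<kappa> powr (p / q) * (\<kappa> powr p) powr (- a) = \<kappa> powr (p / s)"
            by (simp only: powr_powr powr_add[symmetric])
          moreover have "N * t0 powr (- a) = \<kappa> powr (p / q) * (\<kappa> powr p) powr (- a) * B"
            by (simp only: N_def t0_def mult_ac)
          ultimately show ?thesis by simp
        qed
        have e3: "(t / t0) powr a = t powr a * t0 powr (- a)"
          using t t0 by (simp add: powr_divide powr_minus_divide)
        show ?thesis unfolding e1 e3 e2[symmetric] by (simp only: mult_ac)
      qed
      also have "\<dots> \<le> c * (N * (t / t0) powr a)" using c N by (intro mult_right_mono) auto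
      finally show ?thesis by (metis ennreal_leI order_trans mult.assoc)
    qed
    show "lorentz_ennorm (ennreal q) l F \<le> ennreal (C' * (K powr (p / q) * B powr (1 - p / q)))"
    proof (cases "l = \<infinity>")
      case True
      have "\<Phi> t \<le> ennreal (c * N)" if t: "0 < t" for t
      proof (cases "t \<le> t0")
        case True
        have "(t / t0) powr a \<le> 1" using True t t0 ab by (intro powr_le1) auto
        then have "c * N * (t / t0) powr a \<le> c * N" using c N by (simp add: mult_left_le)
        then show ?thesis using \<Phi>2[OF t] by (meson ennreal_leI order_trans)
      next
        case False
        have "(t / t0) powr (- b) \<le> 1 powr (- b)" using False t t0 ab by (intro powr_mono2') auto
        then have "c * N * (t / t0) powr (- b) \<le> c * N" using c N by (simp add: mult_left_le)
        then show ?thesis using \<Phi>1[OF t] by (meson ennreal_leI order_trans)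
      qed
      then have "(SUP t\<in>{0<..}. \<Phi> t) \<le> ennreal (c * N)" by (intro SUP_least) auto
      then show ?thesis using True by (simp add: lorentz_ennorm_def \<Phi>_def C'_def N(2))
    next
      case False
      define \<nu> where "\<nu> = enn2real l"
      have \<nu>: "0 < \<nu>" using l0[OF False] by (simp add: \<nu>_def)
      let ?G = "\<lambda>t. (if t \<le> t0 then (t / t0) powr (a * \<nu>) else (t / t0) powr (- (b * \<nu>))) * (1 / t)"
      have "(\<integral>\<^sup>+t\<in>{0<..}. ennreal_powr (\<Phi> t) \<nu> * ennreal (1 / t) \<partial>lborel)
          \<le> (\<integral>\<^sup>+t. ennreal ((c * N) powr \<nu>) * (ennreal (?G t) * indicator {0<..} t) \<partial>lborel)"
      proof (rule nn_integral_mono)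
        fix t :: real
        show "ennreal_powr (\<Phi> t) \<nu> * ennreal (1 / t) * indicator {0<..} t
          \<le> ennreal ((c * N) powr \<nu>) * (ennreal (?G t) * indicator {0<..} t)"
        proof (cases "0 < t")
          case True
          let ?g = "if t \<le> t0 then (t / t0) powr a else (t / t0) powr (- b)"
          have "\<Phi> t \<le> ennreal (c * N * ?g)" using \<Phi>1[OF True] \<Phi>2[OF True] by simp
          then have "ennreal_powr (\<Phi> t) \<nu> \<le> ennreal ((c * N * ?g) powr \<nu>)"
            using c N \<nu> by (intro ennreal_powr_le) auto
          also have "(c * N * ?g) powr \<nu> = (c * N) powr \<nu> * (if t \<le> t0 then (t / t0) powr (a * \<nu>) else (t / t0) powr (- (b * \<nu>)))"
            using c N by (simp add: powr_mult powr_powr)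
          finally have "ennreal_powr (\<Phi> t) \<nu> * ennreal (1 / t) \<le> ennreal ((c * N) powr \<nu> * (if t \<le> t0 then (t / t0) powr (a * \<nu>) else (t / t0) powr (- (b * \<nu>)))) * ennreal (1 / t)"
            by (rule mult_right_mono) simp
          also have "\<dots> = ennreal ((c * N) powr \<nu>) * ennreal (?G t)"
            using True by (simp add: ennreal_mult'[symmetric] ennreal_mult''[symmetric] mult.assoc)
          finally show ?thesis using True by simp
        qed simp
      qed
      also have "\<dots> = ennreal ((c * N) powr \<nu>) * (\<integral>\<^sup>+t\<in>{0<..}. ennreal (?G t) \<partial>lborel)"
        by (rule nn_integral_cmult) measurable
      also have "\<dots> \<le> ennreal ((c * N) powr \<nu>) * ennreal (1 / (a * \<nu>) + 1 / (b * \<nu>))"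
        using ab \<nu> t0 by (intro mult_left_mono nn_integral_powr_two_sided) auto
      also have "\<dots> = ennreal ((c * N) powr \<nu> * (1 / (a * \<nu>) + 1 / (b * \<nu>)))"
        by (simp add: ennreal_mult'[symmetric])
      finally have "ennreal_powr (\<integral>\<^sup>+t\<in>{0<..}. ennreal_powr (\<Phi> t) \<nu> * ennreal (1 / t) \<partial>lborel) (1 / \<nu>)
          \<le> ennreal (((c * N) powr \<nu> * (1 / (a * \<nu>) + 1 / (b * \<nu>))) powr (1 / \<nu>))"
        using ab \<nu> by (intro ennreal_powr_le) auto
      also have "((c * N) powr \<nu> * (1 / (a * \<nu>) + 1 / (b * \<nu>))) powr (1 / \<nu>) = C' * N"
      proof -
        define Y where "Y = 1 / (a * \<nu>) + 1 / (b * \<nu>)"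
        have "C' = c * Y powr (1 / \<nu>)" using False by (simp add: C'_def \<nu>_def Y_def)
        moreover have "((c * N) powr \<nu>) powr (1 / \<nu>) = c * N" using c N \<nu> by (simp add: powr_powr)
        moreover have "0 \<le> Y" using ab \<nu> by (simp add: Y_def)
        then have "((c * N) powr \<nu> * Y) powr (1 / \<nu>) = ((c * N) powr \<nu>) powr (1 / \<nu>) * Y powr (1 / \<nu>)"
          by (simp only: powr_mult powr_ge_zero)
        ultimately show ?thesis unfolding Y_def[symmetric] by (simp only: mult_ac)
      qed
      finally have "ennreal_powr (\<integral>\<^sup>+t\<in>{0<..}. ennreal_powr (\<Phi> t) \<nu> * ennreal (1 / t) \<partial>lborel) (1 / \<nu>) \<le> ennreal (C' * N)" .
      moreover have "lorentz_ennorm (ennreal q) l F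
          = ennreal_powr (\<integral>\<^sup>+t\<in>{0<..}. ennreal_powr (\<Phi> t) \<nu> * ennreal (1 / t) \<partial>lborel) (1 / \<nu>)"
        unfolding lorentz_ennorm_def \<Phi>_def \<nu>_def if_not_P[OF False] by (rule refl)
      ultimately show ?thesis unfolding N(2) by simp
    qed
  qed
qed

text \<open>The distribution estimates require positive constants, while the actual norms may
  vanish. Positive exponents make the product continuous up to 0, so the strict majorants may
  decrease to the norms.\<close>

lemma le_powr_product_of_all_greater:
  fixes K B C a b :: real and X :: ennreal
  assumes K: "0 \<le> K" and B: "0 \<le> B" and a: "0 < a" and b: "0 < b"
    and le: "\<And>K' B'. K < K' \<Longrightarrow> B < B' \<Longrightarrow> X \<le> ennreal (C * (K' powr a * B' powr b))"
  shows "X \<le> ennreal (C * (K powr a * B powr b))"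
proof (rule LIMSEQ_le_const)
  have lim: "(\<lambda>n. 1 / real (Suc n)) \<longlonglongrightarrow> 0"
    using LIMSEQ_inverse_real_of_nat by (simp add: inverse_eq_divide)
  have "(\<lambda>n. (L + 1 / real (Suc n)) powr e) \<longlonglongrightarrow> (L + 0) powr e" if "0 \<le> L" "0 < e" for L e :: real
    using that by (intro tendsto_powr' tendsto_intros lim) (auto intro!: always_eventually)
  then have l: "(\<lambda>n. (L + 1 / real (Suc n)) powr e) \<longlonglongrightarrow> L powr e" if "0 \<le> L" "0 < e" for L e :: real
    using that by simp
  show "(\<lambda>n. ennreal (C * ((K + 1 / real (Suc n)) powr a * (B + 1 / real (Suc n)) powr b)))
      \<longlonglongrightarrow> ennreal (C * (K powr a * B powr b))"
    by (intro tendsto_ennrealI tendsto_mult tendsto_const l K B a b)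
  show "\<exists>n0. \<forall>n\<ge>n0. X \<le> ennreal (C * ((K + 1 / real (Suc n)) powr a * (B + 1 / real (Suc n)) powr b))"
    using le by auto
qed

section \<open>Littlewood--Paley kernels\<close>

text \<open>The Lorentz spaces are built on Lebesgue measurability, whereas convolutions and Fubini
  are carried out on Borel product spaces. Real and imaginary parts are replaced separately.\<close>

lemma lebesgue_borel_representative:
  fixes u :: "'a::euclidean_space \<Rightarrow> complex"
  assumes "u \<in> borel_measurable lebesgue"
  obtains u' where "u' \<in> borel_measurable borel" "AE x in lborel. u x = u' x"
proof -
  have "(\<lambda>x. Re (u x)) \<in> borel_measurable lebesgue" "(\<lambda>x. Im (u x)) \<in> borel_measurable lebesgue"
    using assms by measurable
  from this[THEN completion_ex_borel_measurable_real]
  obtain v w where v: "v \<in> borel_measurable lborel" "AE x in lborel. Re (u x) = v x"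
    and w: "w \<in> borel_measurable lborel" "AE x in lborel. Im (u x) = w x"
    by (elim bexE)
  have "(\<lambda>x. Complex (v x) (w x)) \<in> borel_measurable borel"
    using v(1) w(1) by (simp add: Complex_eq) measurable
  moreover have "AE x in lborel. u x = Complex (v x) (w x)"
    using v(2) w(2) by eventually_elim (simp add: complex_eq_iff)
  ultimately show thesis by (rule that)
qed

lemma distr_of_eq_lborel:
  assumes [measurable]: "u' \<in> borel_measurable borel" "u \<in> borel_measurable lebesgue" "\<psi> \<in> borel_measurable borel"
    and AE: "AE x in lborel. u x = u' x"
  shows "distr_of u \<psi> = (LINT x|lborel. u' x * \<psi> x)"
proof -
  have [measurable]: "\<psi> \<in> borel_measurable lebesgue" "u' \<in> borel_measurable lebesgue"
    using assms(1,3) by (auto intro: measurable_completion)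
  have "AE x in lebesgue. u x * \<psi> x = u' x * \<psi> x"
    using AE_completion[OF AE] by eventually_elim simp
  then have "distr_of u \<psi> = (LINT x|lebesgue. u' x * \<psi> x)"
    unfolding distr_of_def by (intro integral_cong_AE) measurable
  also have "\<dots> = (LINT x|lborel. u' x * \<psi> x)" by (intro integral_completion) measurable
  finally show ?thesis .
qed

text \<open>The convolution theorem in dual form, carrying a multiplier on the test function over to
  a kernel. After Fubini and a translation by \<open>y\<close>, the inner integral is the inversion
  formula for \<open>\<Phi>\<close>.\<close>

lemma fourier_inverse_fourier_conv:
  fixes \<Phi> \<psi> :: "real^'n \<Rightarrow> complex"
  assumes \<Phi>: "schwartz \<Phi>" and \<psi>: "schwartz \<psi>"
  shows "(LINT x|lborel. inverse_fourier \<Phi> (x - y) * fourier \<psi> x) = fourier (\<lambda>\<xi>. \<Phi> \<xi> * \<psi> \<xi>) y"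
proof -
  have [measurable]: "\<Phi> \<in> borel_measurable borel" "\<psi> \<in> borel_measurable borel"
    using assms by (auto intro: schwartz_borel_measurable)
  have [measurable]: "inverse_fourier \<Phi> \<in> borel_measurable borel"
    by (intro inverse_fourier_borel_measurable) measurable
  let ?F = "\<lambda>x \<xi>. inverse_fourier \<Phi> (x - y) * (cis (- (\<xi> \<bullet> x)) * \<psi> \<xi>)"
  have fin: "(\<integral>\<^sup>+x. \<integral>\<^sup>+\<xi>. norm (?F x \<xi>) \<partial>lborel \<partial>lborel) < \<infinity>"
  proof -
    have "(\<integral>\<^sup>+x. \<integral>\<^sup>+\<xi>. norm (?F x \<xi>) \<partial>lborel \<partial>lborel)
      = (\<integral>\<^sup>+x. ennreal (norm (inverse_fourier \<Phi> (x - y))) \<partial>lborel) * (\<integral>\<^sup>+\<xi>. ennreal (norm (\<psi> \<xi>)) \<partial>lborel)"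
      by (simp add: norm_mult ennreal_mult nn_integral_cmult nn_integral_multc)
    also have "(\<integral>\<^sup>+x. ennreal (norm (inverse_fourier \<Phi> (x - y))) \<partial>lborel) = (\<integral>\<^sup>+x. ennreal (norm (inverse_fourier \<Phi> x)) \<partial>lborel)"
      by (rule nn_integral_lborel_translate) measurable
    also have "\<dots> * (\<integral>\<^sup>+\<xi>. ennreal (norm (\<psi> \<xi>)) \<partial>lborel) < \<infinity>"
      using schwartz_inverse_fourier_integrable[OF \<Phi>] schwartz_integrable[OF \<psi>]
      by (auto simp: integrable_iff_bounded ennreal_mult_less_top)
    finally show ?thesis .
  qed
  have "(LINT x|lborel. inverse_fourier \<Phi> (x - y) * fourier \<psi> x) = (LINT x|lborel. LINT \<xi>|lborel. ?F x \<xi>)"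
    by (simp add: fourier_lborel)
  also have "\<dots> = (LINT \<xi>|lborel. LINT x|lborel. ?F x \<xi>)"
    by (rule lborel_Fubini(3)[symmetric, OF _ fin]) measurable
  also have "\<dots> = (LINT \<xi>|lborel. cis (- (\<xi> \<bullet> y)) * (\<Phi> \<xi> * \<psi> \<xi>))"
  proof (intro Bochner_Integration.integral_cong refl)
    fix \<xi>
    have "(LINT x|lborel. ?F x \<xi>) = (LINT x|lborel. ?F (x + y) \<xi>)"
      by (rule integral_lborel_translate[symmetric]) measurable
    also have "\<dots> = (LINT x|lborel. cis (- (\<xi> \<bullet> y)) * \<psi> \<xi> * (cis (- (x \<bullet> \<xi>)) * inverse_fourier \<Phi> x))"
    proof (intro Bochner_Integration.integral_cong refl)
      fix x
      have "cis (- (\<xi> \<bullet> (x + y))) = cis (- (\<xi> \<bullet> y)) * cis (- (x \<bullet> \<xi>))"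
      proof -
        have "- (\<xi> \<bullet> (x + y)) = - (\<xi> \<bullet> y) + - (x \<bullet> \<xi>)"
          by (simp add: inner_add_right inner_commute[of x \<xi>])
        then show ?thesis by (simp only: cis_mult)
      qed
      then show "?F (x + y) \<xi> = cis (- (\<xi> \<bullet> y)) * \<psi> \<xi> * (cis (- (x \<bullet> \<xi>)) * inverse_fourier \<Phi> x)"
        by (simp only: add_diff_cancel_right' mult_ac)
    qed
    also have "\<dots> = cis (- (\<xi> \<bullet> y)) * \<psi> \<xi> * \<Phi> \<xi>"
      by (simp only: integral_mult_right_zero schwartz_fourier_inverse_fourier[OF \<Phi>])
    finally show "(LINT x|lborel. ?F x \<xi>) = cis (- (\<xi> \<bullet> y)) * (\<Phi> \<xi> * \<psi> \<xi>)" by (simp only: mult_ac)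
  qed
  also have "\<dots> = fourier (\<lambda>\<xi>. \<Phi> \<xi> * \<psi> \<xi>) y" by (rule fourier_lborel[symmetric]) measurable
  finally show ?thesis .
qed

lemma schwartz_inverse_fourier_mass:
  fixes f :: "real^'n \<Rightarrow> complex"
  assumes "schwartz f"
  shows "(\<integral>\<^sup>+x. ennreal (norm (inverse_fourier f x)) \<partial>lborel) \<le> ennreal (LINT x|lborel. norm (inverse_fourier f x))"
  using schwartz_inverse_fourier_integrable[OF assms] by (simp add: nn_integral_eq_integral)

lemma powr_neg_int: "2 powi (- j) = 1 / (2 powr real_of_int j :: real)"
  by (simp add: powr_real_of_int' power_int_minus divide_inverse)

lemma tempered_fun_of_bounded:
  assumes [measurable]: "g \<in> borel_measurable borel" and M: "\<And>x. norm (g x) \<le> M"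
  shows "tempered_fun g"
  unfolding tempered_fun_def
proof (intro conjI allI impI)
  show "g \<in> borel_measurable lebesgue" by (auto intro: measurable_completion)
  fix \<psi> :: "real^'a \<Rightarrow> complex" assume \<psi>: "schwartz \<psi>"
  have [measurable]: "\<psi> \<in> borel_measurable borel" using schwartz_borel_measurable[OF \<psi>] .
  have "integrable lborel (\<lambda>x. of_real M * \<psi> x)" by (intro integrable_mult_right schwartz_integrable \<psi>)
  then have "integrable lborel (\<lambda>x. g x * \<psi> x)"
  proof (rule Bochner_Integration.integrable_bound)
    show "AE x in lborel. norm (g x * \<psi> x) \<le> norm (of_real M * \<psi> x)"
    proof (rule AE_I2)
      fix x
      have "norm (g x) \<le> \<bar>M\<bar>" using M[of x] by linarith
      then show "norm (g x * \<psi> x) \<le> norm (of_real M * \<psi> x)" by (simp add: norm_mult mult_right_mono)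
    qed
  qed measurable
  then show "integrable lebesgue (\<lambda>x. g x * \<psi> x)" by (subst integrable_completion) auto
qed

text \<open>A witness for the choice in \<open>LP_block\<close>: the convolution with the kernel of
  the multiplier is a bounded function with the required action on test functions. The weak L^p
  bound supplies the absolute convergence for Fubini, through the dilation estimate at scale
  1.\<close>

lemma LP_block_exists:
  fixes u u' :: "real^'n \<Rightarrow> complex"
  assumes \<Phi>: "schwartz \<Phi>"
    and u: "u \<in> borel_measurable lebesgue" "u' \<in> borel_measurable borel" "AE x in lborel. u x = u' x"
    and wu: "weak_bound p K (\<lambda>x. ennreal (norm (u' x)))" and p: "1 < p" and K: "0 < K"
  shows "tempered_fun (conv u' (inverse_fourier \<Phi>))"
    and "\<And>\<psi>. schwartz \<psi> \<Longrightarrow> distr_of (conv u' (inverse_fourier \<Phi>)) (fourier \<psi>) = distr_of u (fourier (\<lambda>\<xi>. \<Phi> \<xi> * \<psi> \<xi>))"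
proof -
  let ?k = "inverse_fourier \<Phi>" let ?g = "conv u' ?k"
  have \<Phi>m [measurable]: "\<Phi> \<in> borel_measurable borel" using schwartz_borel_measurable[OF \<Phi>] .
  have km [measurable]: "?k \<in> borel_measurable borel" by (rule inverse_fourier_borel_measurable) measurable
  note u(2) [measurable]
  have gm [measurable]: "?g \<in> borel_measurable borel" by (intro borel_measurable_conv) measurable
  obtain M where M: "0 < M" "\<And>x. norm (?k x) \<le> M" using schwartz_inverse_fourier_bounded[OF \<Phi>] by blast
  define A where "A = (LINT x|lborel. norm (?k x))"
  have A: "(\<integral>\<^sup>+x. ennreal (norm (?k x)) \<partial>lborel) \<le> ennreal A" "0 \<le> A"
    using schwartz_inverse_fourier_mass[OF \<Phi>] by (auto simp: A_def)
  have d1: "dilated_kernel 1 ?k = ?k" by (auto simp: dilated_kernel_def)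
  let ?B = "(A + M * tail_const p) * (K * 1 powr (real CARD('n) / p))"
  note b = conv_dilated_kernel_bound[OF wu p K zero_less_one km M(2) A, unfolded d1]
  have gb: "norm (?g x) \<le> ?B" for x
    using conv_integrable(2)[OF wu p K zero_less_one u(2) km M(2) A] unfolding d1 by blast
  show "tempered_fun ?g" by (rule tempered_fun_of_bounded[OF gm gb])
  fix \<psi> :: "real^'n \<Rightarrow> complex" assume \<psi>: "schwartz \<psi>"
  have [measurable]: "\<psi> \<in> borel_measurable borel" using schwartz_borel_measurable[OF \<psi>] .
  have f\<psi> [measurable]: "fourier \<psi> \<in> borel_measurable borel" by (rule borel_measurable_fourier) measurable
  let ?F = "\<lambda>x y. u' y * ?k (x - y) * fourier \<psi> x"
  have fin: "(\<integral>\<^sup>+x. \<integral>\<^sup>+y. norm (?F x y) \<partial>lborel \<partial>lborel) < \<infinity>"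
  proof -
    have "(\<integral>\<^sup>+x. \<integral>\<^sup>+y. norm (?F x y) \<partial>lborel \<partial>lborel) \<le> (\<integral>\<^sup>+x. ennreal ?B * ennreal (norm (fourier \<psi> x)) \<partial>lborel)"
    proof (rule nn_integral_mono)
      fix x
      have "(\<integral>\<^sup>+y. norm (?F x y) \<partial>lborel) = (\<integral>\<^sup>+y. ennreal (norm (u' y * ?k (x - y))) \<partial>lborel) * ennreal (norm (fourier \<psi> x))"
        by (subst nn_integral_multc[symmetric]) (auto simp: norm_mult ennreal_mult)
      also have "\<dots> \<le> ennreal ?B * ennreal (norm (fourier \<psi> x))"
        by (intro mult_right_mono b) auto
      finally show "(\<integral>\<^sup>+y. norm (?F x y) \<partial>lborel) \<le> ennreal ?B * ennreal (norm (fourier \<psi> x))" .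
    qed
    also have "\<dots> < \<infinity>"
      using schwartz_fourier_integrable[OF \<psi>]
      by (auto simp: nn_integral_cmult integrable_iff_bounded ennreal_mult_less_top)
    finally show ?thesis .
  qed
  have "distr_of ?g (fourier \<psi>) = (LINT x|lborel. ?g x * fourier \<psi> x)"
    by (rule distr_of_eq_lborel) (auto intro: measurable_completion)
  also have "\<dots> = (LINT x|lborel. LINT y|lborel. ?F x y)"
    by (simp add: conv_def)
  also have "\<dots> = (LINT y|lborel. LINT x|lborel. ?F x y)"
    by (rule lborel_Fubini(3)[symmetric, OF _ fin]) measurable
  also have "\<dots> = (LINT y|lborel. u' y * fourier (\<lambda>\<xi>. \<Phi> \<xi> * \<psi> \<xi>) y)"
    by (simp add: mult.assoc fourier_inverse_fourier_conv[OF \<Phi> \<psi>])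
  also have "\<dots> = distr_of u (fourier (\<lambda>\<xi>. \<Phi> \<xi> * \<psi> \<xi>))"
    by (rule distr_of_eq_lborel[symmetric, OF u(2,1) _ u(3)]) (intro borel_measurable_fourier, measurable)
  finally show "distr_of ?g (fourier \<psi>) = distr_of u (fourier (\<lambda>\<xi>. \<Phi> \<xi> * \<psi> \<xi>))" .
qed

lemma inverse_fourier_dilated_kernel:
  fixes f :: "real^'n \<Rightarrow> complex"
  assumes "f \<in> borel_measurable borel" "0 < c"
  shows "inverse_fourier (\<lambda>\<xi>. f ((1 / c) *\<^sub>R \<xi>)) = dilated_kernel c (inverse_fourier f)"
  using inverse_fourier_dilation[OF assms] by (auto simp: dilated_kernel_def)

lemma schwartz_of_bounded_support:
  assumes "smooth f" "\<And>x. f x \<noteq> 0 \<Longrightarrow> norm x \<le> R"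
  shows "schwartz f"
proof (rule schwartz_of_compact_support[OF assms(1)])
  have "bounded {x. f x \<noteq> 0}" using assms(2) by (auto simp: bounded_iff)
  then show "compact (closure {x. f x \<noteq> 0})" by (simp add: compact_closure)
qed

lemma test_fun_off_origin_of_support:
  assumes "smooth f" "\<And>x. f x \<noteq> 0 \<Longrightarrow> norm x \<le> R" "0 < \<delta>" "\<And>x. f x \<noteq> 0 \<Longrightarrow> \<delta> \<le> norm x"
  shows "test_fun_off_origin f"
proof -
  have "bounded {x. f x \<noteq> 0}" using assms(2) by (auto simp: bounded_iff)
  moreover have "closure {x. f x \<noteq> 0} \<subseteq> {x. \<delta> \<le> norm x}"
    using assms(4) by (intro closure_minimal closed_Collect_le continuous_intros) auto
  ultimately show ?thesis using assms(1,3) by (auto simp: test_fun_off_origin_def compact_closure)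
qed

section \<open>From Lorentz norms to weak bounds of Borel representatives\<close>

lemma distribution_fun_representative:
  fixes u u' :: "real^'n \<Rightarrow> complex"
  assumes [measurable]: "u \<in> borel_measurable lebesgue" "u' \<in> borel_measurable borel" and AE: "AE x in lborel. u x = u' x"
  shows "distribution_fun (\<lambda>x. ennreal (norm (u x))) \<alpha> = emeasure lborel {x. ennreal \<alpha> < ennreal (norm (u' x))}"
proof -
  have [measurable]: "u' \<in> borel_measurable lebesgue" by (auto intro: measurable_completion)
  have A: "{x \<in> space lebesgue. ennreal \<alpha> < ennreal (norm (u x))} \<in> sets lebesgue"
    "{x \<in> space lebesgue. ennreal \<alpha> < ennreal (norm (u' x))} \<in> sets lebesgue" by measurable
  have "distribution_fun (\<lambda>x. ennreal (norm (u x))) \<alpha> = emeasure lebesgue {x. ennreal \<alpha> < ennreal (norm (u' x))}"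
    unfolding distribution_fun_def
    using A AE_completion[OF AE] by (intro emeasure_eq_AE) (auto elim: eventually_mono)
  also have "\<dots> = emeasure lborel {x. ennreal \<alpha> < ennreal (norm (u' x))}"
  proof -
    have "{x \<in> space lborel. ennreal \<alpha> < ennreal (norm (u' x))} \<in> sets lborel" by measurable
    then show ?thesis by simp
  qed
  finally show ?thesis .
qed

lemma weak_bound_of_distribution_fun:
  fixes u u' :: "real^'n \<Rightarrow> complex"
  assumes u: "u \<in> borel_measurable lebesgue" "u' \<in> borel_measurable borel" "AE x in lborel. u x = u' x"
    and "\<And>\<alpha>. 0 < \<alpha> \<Longrightarrow> distribution_fun (\<lambda>x. ennreal (norm (u x))) \<alpha> \<le> ennreal ((K / \<alpha>) powr p)"
  shows "weak_bound p K (\<lambda>x. ennreal (norm (u' x)))"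
proof -
  note u(2) [measurable]
  have "(\<lambda>x. ennreal (norm (u' x))) \<in> borel_measurable borel" by measurable
  then show ?thesis using assms(4) by (simp add: weak_bound_def distribution_fun_representative[OF u])
qed

lemma weak_bound_of_lorentz_norm:
  fixes u u' :: "real^'n \<Rightarrow> complex"
  assumes u: "u \<in> borel_measurable lebesgue" "u' \<in> borel_measurable borel" "AE x in lborel. u x = u' x"
    and "0 < p" "0 \<le> K" and le: "lorentz_norm (ennreal p) \<infinity> u \<le> ennreal K"
  shows "weak_bound p K (\<lambda>x. ennreal (norm (u' x)))"
proof (rule weak_bound_of_distribution_fun[OF u])
  fix \<alpha> :: real assume "0 < \<alpha>"
  moreover have "(\<lambda>x. ennreal (norm (u x))) \<in> borel_measurable lebesgue" using u(1) by measurable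
  ultimately show "distribution_fun (\<lambda>x. ennreal (norm (u x))) \<alpha> \<le> ennreal ((K / \<alpha>) powr p)"
    using assms by (intro lorentz_weak_distribution) (auto simp: lorentz_norm_def)
qed

section \<open>Low-frequency multiplier and kernels of a Littlewood--Paley function\<close>

locale littlewood_paley_function =
  fixes \<phi> :: "real^'n \<Rightarrow> real"
  assumes \<phi>: "littlewood_paley \<phi>"
begin

lemma \<phi>_smooth: "smooth \<phi>"
  and closure_support_\<phi>: "closure {\<xi>. \<phi> \<xi> \<noteq> 0} \<subseteq> {\<xi>. 3 / 4 \<le> norm \<xi> \<and> norm \<xi> \<le> 8 / 3}"
  and partition_of_unity: "\<forall>\<xi>. \<xi> \<noteq> 0 \<longrightarrow> ((\<lambda>j::int. \<phi> ((2 powi (- j)) *\<^sub>R \<xi>)) has_sum 1) UNIV"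
proof -
  note * = \<phi>[unfolded littlewood_paley_def]
  show "smooth \<phi>" using * by (rule conjunct1)
  note ** = *[THEN conjunct2, THEN conjunct2, THEN conjunct2]
  show "closure {\<xi>. \<phi> \<xi> \<noteq> 0} \<subseteq> {\<xi>. 3 / 4 \<le> norm \<xi> \<and> norm \<xi> \<le> 8 / 3}"
    using ** by (rule conjunct1)
  show "\<forall>\<xi>. \<xi> \<noteq> 0 \<longrightarrow> ((\<lambda>j::int. \<phi> ((2 powi (- j)) *\<^sub>R \<xi>)) has_sum 1) UNIV"
    using ** by (rule conjunct2)
qed

lemma \<phi>_support:
  assumes "\<phi> \<xi> \<noteq> 0"
  shows "3 / 4 \<le> norm \<xi>" "norm \<xi> \<le> 8 / 3"
proof -
  have "\<xi> \<in> {\<xi>. \<phi> \<xi> \<noteq> 0}" using assms by simp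
  then show "3 / 4 \<le> norm \<xi>" "norm \<xi> \<le> 8 / 3" using subsetD[OF closure_support_\<phi> subsetD[OF closure_subset]] by simp_all
qed

lemma \<phi>_zero: "norm \<xi> < 3 / 4 \<Longrightarrow> \<phi> \<xi> = 0" "8 / 3 < norm \<xi> \<Longrightarrow> \<phi> \<xi> = 0"
  using \<phi>_support[of \<xi>] by fastforce+

text \<open>In this annulus only j = 0 and j = 1 survive in the partition of unity: for j < 0 the
  argument has norm above 8/3, for j at least 2 it has norm below 3/4.\<close>

lemma \<phi>_add_dilate_eq_1:
  assumes "4 / 3 < norm \<xi>" "norm \<xi> < 3"
  shows "\<phi> \<xi> + \<phi> ((1 / 2) *\<^sub>R \<xi>) = 1"
proof -
  let ?f = "\<lambda>j::int. \<phi> ((2 powi (- j)) *\<^sub>R \<xi>)"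
  have "\<xi> \<noteq> 0" using assms by auto
  then have s: "(?f has_sum 1) UNIV" using partition_of_unity by simp
  have z: "?f j = 0" if "j \<notin> {0, 1}" for j
  proof (cases "j < 0")
    case True
    have "2 * (4 / 3) < (2::real) powi (- j) * norm \<xi>"
    proof -
      have "(2::real) powi 1 \<le> 2 powi (- j)" using True by (intro power_int_increasing) auto
      then have "2 * norm \<xi> \<le> 2 powi (- j) * norm \<xi>" by (intro mult_right_mono) auto
      then show ?thesis using assms(1) by linarith
    qed
    then show ?thesis by (intro \<phi>_zero(2)) simp
  next
    case False
    then have j: "2 \<le> j" using that by auto
    have "(2::real) powi (- j) * norm \<xi> < 3 / 4"
    proof -
      have "(2::real) powi (- j) \<le> 2 powi (- 2)" using j by (intro power_int_increasing) auto
      also have "(2::real) powi (- 2) = 1 / 4" by (simp add: power_int_minus)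
      finally have "2 powi (- j) * norm \<xi> \<le> 1 / 4 * norm \<xi>" by (intro mult_right_mono) auto
      then show ?thesis using assms(2) by linarith
    qed
    then show ?thesis by (intro \<phi>_zero(1)) simp
  qed
  have "(?f has_sum 1) {0, 1}"
    using s by (rule has_sum_cong_neutral[THEN iffD1, rotated -1]) (use z in auto)
  then have "sum ?f {0, 1} = 1"
    using has_sum_finite[of "{0, 1}" ?f] has_sum_unique by blast
  then show ?thesis by (simp add: power_int_minus inverse_eq_divide)
qed

text \<open>Away from the origin this is the sum of \<phi>(2^(-j) \<xi>) over all j < 0, continued
  by 1 at the origin. For |\<xi>| < 3 the partition of unity turns that infinite sum into 1 minus
  two terms. It vanishes for |\<xi>| > 4/3, so the cut at radius 2 lies where both descriptions
  agree.\<close>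

definition \<theta> :: "real^'n \<Rightarrow> real" where
  "\<theta> \<xi> = (if norm \<xi> < 2 then 1 - \<phi> \<xi> - \<phi> ((1 / 2) *\<^sub>R \<xi>) else 0)"

lemma \<theta>_inside: "norm \<xi> < 3 \<Longrightarrow> \<theta> \<xi> = 1 - \<phi> \<xi> - \<phi> ((1 / 2) *\<^sub>R \<xi>)"
  using \<phi>_add_dilate_eq_1[of \<xi>] by (auto simp: \<theta>_def)

lemma \<theta>_outside: "4 / 3 < norm \<xi> \<Longrightarrow> \<theta> \<xi> = 0"
  using \<phi>_add_dilate_eq_1[of \<xi>] by (auto simp: \<theta>_def)

lemma \<theta>_smooth: "smooth \<theta>"
proof (rule smooth_glue_zero[where a = "4 / 3" and b = 3])
  show "smooth (\<lambda>\<xi>. 1 - \<phi> \<xi> - \<phi> ((1 / 2) *\<^sub>R \<xi>))"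
    by (intro smooth_diff smooth_const \<phi>_smooth smooth_dilation)
qed (auto simp: \<theta>_inside \<theta>_outside)

lemma \<theta>_one: "norm \<xi> < 3 / 4 \<Longrightarrow> \<theta> \<xi> = 1"
  using \<phi>_zero(1)[of \<xi>] \<phi>_zero(1)[of "(1 / 2) *\<^sub>R \<xi>"] by (simp add: \<theta>_def)

lemma \<theta>_telescope: "\<theta> ((1 / 2) *\<^sub>R \<xi>) - \<theta> \<xi> = \<phi> \<xi>"
proof (cases "norm \<xi> < 3")
  case True
  have "\<phi> ((1 / 2) *\<^sub>R (1 / 2) *\<^sub>R \<xi>) = 0" using True by (intro \<phi>_zero(1)) simp
  then show ?thesis using True \<theta>_inside[of \<xi>] \<theta>_inside[of "(1 / 2) *\<^sub>R \<xi>"] by simp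
next
  case False
  then show ?thesis using \<theta>_outside[of \<xi>] \<theta>_outside[of "(1 / 2) *\<^sub>R \<xi>"] \<phi>_zero(2)[of \<xi>] by simp
qed

abbreviation "\<phi>c \<equiv> \<lambda>\<xi>. complex_of_real (\<phi> \<xi>)"
abbreviation "\<theta>c \<equiv> \<lambda>\<xi>. complex_of_real (\<theta> \<xi>)"

lemma schwartz_dilation_of_bounded_support:
  fixes f :: "real^'n \<Rightarrow> real"
  assumes "smooth f" "\<And>x. f x \<noteq> 0 \<Longrightarrow> norm x \<le> R" "0 < c"
  shows "schwartz (\<lambda>\<xi>. complex_of_real (f ((1 / c) *\<^sub>R \<xi>)))"
proof (rule schwartz_of_bounded_support[where R = "c * R"])
  show "smooth (\<lambda>\<xi>. complex_of_real (f ((1 / c) *\<^sub>R \<xi>)))"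
    by (intro smooth_of_real smooth_dilation assms)
  show "norm x \<le> c * R" if "complex_of_real (f ((1 / c) *\<^sub>R x)) \<noteq> 0" for x
    using assms(2)[of "(1 / c) *\<^sub>R x"] that assms(3) by (simp add: field_simps)
qed

lemma schwartz_\<phi>: "0 < c \<Longrightarrow> schwartz (\<lambda>\<xi>. \<phi>c ((1 / c) *\<^sub>R \<xi>))"
  using schwartz_dilation_of_bounded_support[OF \<phi>_smooth \<phi>_support(2)] by blast

lemma schwartz_\<theta>: "0 < c \<Longrightarrow> schwartz (\<lambda>\<xi>. \<theta>c ((1 / c) *\<^sub>R \<xi>))"
  using \<theta>_outside by (intro schwartz_dilation_of_bounded_support[OF \<theta>_smooth, of "4 / 3"]) (auto simp: not_less[symmetric])

lemma \<phi>c_schwartz: "schwartz \<phi>c" using schwartz_\<phi>[of 1] by simp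
lemma \<theta>c_schwartz: "schwartz \<theta>c" using schwartz_\<theta>[of 1] by simp

text \<open>The unit mass of the low-frequency kernel is the value \<theta>(0) = 1, by Fourier
  inversion, and the telescoping relation is \<open>\<theta>_telescope\<close> rescaled by c under
  the inverse transform.\<close>

lemma kernels:
  assumes \<eta>: "schwartz \<eta>"
  obtains Mk Mh' where
    "littlewood_paley_kernels (inverse_fourier \<theta>c) (inverse_fourier \<phi>c) (inverse_fourier \<eta>) Mk Mh'"
proof -
  obtain Mk where Mk: "\<And>x. norm (inverse_fourier \<theta>c x) \<le> Mk" using schwartz_inverse_fourier_bounded[OF \<theta>c_schwartz] by blast
  obtain Mh' where Mh': "\<And>x. norm (inverse_fourier \<eta> x) \<le> Mh'" using schwartz_inverse_fourier_bounded[OF \<eta>] by blast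
  have "littlewood_paley_kernels (inverse_fourier \<theta>c) (inverse_fourier \<phi>c) (inverse_fourier \<eta>) Mk Mh'"
  proof (unfold_locales)
    show "(LINT x|lborel. inverse_fourier \<theta>c x) = 1"
      using schwartz_fourier_inverse_fourier[OF \<theta>c_schwartz, of 0] \<theta>_one[of 0] by simp
    fix c :: real and x :: "real^'n" assume c: "0 < c"
    have d: "dilated_kernel b (inverse_fourier \<theta>c) x = inverse_fourier (\<lambda>\<xi>. \<theta>c ((1 / b) *\<^sub>R \<xi>)) x" if "0 < b" for b
      using inverse_fourier_dilated_kernel[OF schwartz_borel_measurable[OF \<theta>c_schwartz] that] by simp
    have i: "integrable lborel (\<lambda>\<xi>. cis (x \<bullet> \<xi>) * \<theta>c ((1 / b) *\<^sub>R \<xi>))" if "0 < b" for b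
      by (intro integrable_cis_mult schwartz_integrable schwartz_\<theta> that) measurable
    have "dilated_kernel (2 * c) (inverse_fourier \<theta>c) x - dilated_kernel c (inverse_fourier \<theta>c) x
      = of_real (1 / (2 * pi) ^ CARD('n)) * (LINT \<xi>|lborel. cis (x \<bullet> \<xi>) * \<theta>c ((1 / (2 * c)) *\<^sub>R \<xi>) - cis (x \<bullet> \<xi>) * \<theta>c ((1 / c) *\<^sub>R \<xi>))"
    proof -
      have "0 < 2 * c" using c by simp
      from Bochner_Integration.integral_diff[OF i[OF this] i[OF c]] show ?thesis
        unfolding d[OF \<open>0 < 2 * c\<close>] d[OF c] inverse_fourier_def by (simp only: right_diff_distrib)
    qed
    also have "\<dots> = inverse_fourier (\<lambda>\<xi>. \<phi>c ((1 / c) *\<^sub>R \<xi>)) x"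
      unfolding inverse_fourier_def
    proof (intro arg_cong2[where f = "(*)"] Bochner_Integration.integral_cong refl)
      fix \<xi> :: "real^'n"
      have "\<theta> ((1 / (2 * c)) *\<^sub>R \<xi>) - \<theta> ((1 / c) *\<^sub>R \<xi>) = \<phi> ((1 / c) *\<^sub>R \<xi>)"
        using \<theta>_telescope[of "(1 / c) *\<^sub>R \<xi>"] by simp
      then show "cis (x \<bullet> \<xi>) * \<theta>c ((1 / (2 * c)) *\<^sub>R \<xi>) - cis (x \<bullet> \<xi>) * \<theta>c ((1 / c) *\<^sub>R \<xi>)
        = cis (x \<bullet> \<xi>) * \<phi>c ((1 / c) *\<^sub>R \<xi>)"
        by (simp only: right_diff_distrib[symmetric] of_real_diff[symmetric])
    qed
    also have "\<dots> = dilated_kernel c (inverse_fourier \<phi>c) x"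
      using inverse_fourier_dilated_kernel[OF schwartz_borel_measurable[OF \<phi>c_schwartz] c] by simp
    finally show "dilated_kernel (2 * c) (inverse_fourier \<theta>c) x - dilated_kernel c (inverse_fourier \<theta>c) x
      = dilated_kernel c (inverse_fourier \<phi>c) x" .
  qed (use Mk Mh' schwartz_inverse_fourier_integrable \<theta>c_schwartz \<phi>c_schwartz \<eta> in blast)+
  then show thesis by (rule that)
qed

text \<open>The common form into which all three norms are brought. The functions g may depend on j,
  but the multiplier \<open>\<eta>\<close> may not, which keeps the constants uniform in j.\<close>

definition piece_bound :: "(real^'n \<Rightarrow> complex) \<Rightarrow> real \<Rightarrow> real \<Rightarrow> (real^'n \<Rightarrow> complex) \<Rightarrow> bool" where
  "piece_bound \<eta> r B u' \<longleftrightarrow> (\<forall>j::int. \<exists>g. g \<in> borel_measurable borel \<and>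
    weak_bound r (2 powr (- real_of_int j * real CARD('n) / r) * B) (\<lambda>x. ennreal (norm (g x))) \<and>
    (\<forall>x. conv u' (dilated_kernel (2 powr real_of_int j) (inverse_fourier \<phi>c)) x
       = conv g (dilated_kernel (2 powr real_of_int j) (inverse_fourier \<eta>)) x))"

text \<open>The bound on the pieces is asked only for B' > B. This leaves room for a norm defined by
  an infimum that no representative is known to attain, and for B = 0, where the estimates need a
  positive constant.\<close>

theorem lorentz_estimate:
  fixes p q r :: real and l :: ennreal
  assumes \<eta>: "schwartz \<eta>" and p: "1 < p" "p < q" and r: "1 < r" and l: "1 \<le> l"
  obtains C where "0 < C"
    "\<And>u B. u \<in> lorentz_space (ennreal p) \<infinity> \<Longrightarrow> 0 \<le> B \<Longrightarrow>
      (\<And>u' B' K. B < B' \<Longrightarrow> u' \<in> borel_measurable borel \<Longrightarrow> AE x in lborel. u x = u' x \<Longrightarrow>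
        0 < K \<Longrightarrow> weak_bound p K (\<lambda>x. ennreal (norm (u' x))) \<Longrightarrow> piece_bound \<eta> r B' u') \<Longrightarrow>
      lorentz_norm (ennreal q) l u
        \<le> ennreal C * ennreal_powr (lorentz_norm (ennreal p) \<infinity> u) (p / q) * ennreal (B powr (1 - p / q))"
proof -
  obtain Mk Mh' where "littlewood_paley_kernels (inverse_fourier \<theta>c) (inverse_fourier \<phi>c) (inverse_fourier \<eta>) Mk Mh'"
    by (rule kernels[OF \<eta>])
  then interpret L: littlewood_paley_kernels "inverse_fourier \<theta>c" "inverse_fourier \<phi>c" "inverse_fourier \<eta>" Mk Mh' .
  \<comment> \<open>The exponent must be at least r for the blocks, and p + m must exceed q for the
    interpolation.\<close>
  define m where "m = max r q"
  have m: "r \<le> m" "q \<le> m" by (auto simp: m_def)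
  obtain C1 where C1: "0 < C1"
    "\<And>u g K B \<alpha>. u \<in> borel_measurable borel \<Longrightarrow> weak_bound p K (\<lambda>x. ennreal (norm (u x))) \<Longrightarrow> 0 < K \<Longrightarrow> 0 < B \<Longrightarrow>
      (\<And>j. g j \<in> borel_measurable borel) \<Longrightarrow>
      (\<And>j::int. weak_bound r (2 powr (- real_of_int j * real CARD('n) / r) * B) (\<lambda>x. ennreal (norm (g j x)))) \<Longrightarrow>
      (\<And>j x. conv u (dilated_kernel (2 powr real_of_int j) (inverse_fourier \<phi>c)) x = conv (g j) (dilated_kernel (2 powr real_of_int j) (inverse_fourier \<eta>)) x) \<Longrightarrow>
      0 < \<alpha> \<Longrightarrow>
      emeasure lborel {x. ennreal \<alpha> < ennreal (norm (u x))} \<le> ennreal (C1 * (K / \<alpha>) powr p * (B / \<alpha>) powr m)"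
    using L.distribution_estimate[OF p(1) r m(1)] by blast
  have pm: "0 < p" "q < p + m" using p m by auto
  obtain C where C: "0 < C"
    "\<And>(F :: real^'n \<Rightarrow> ennreal) K B. 0 < K \<Longrightarrow> 0 < B \<Longrightarrow>
      (\<And>\<alpha>. 0 < \<alpha> \<Longrightarrow> distribution_fun F \<alpha> \<le> ennreal ((K / \<alpha>) powr p)) \<Longrightarrow>
      (\<And>\<alpha>. 0 < \<alpha> \<Longrightarrow> distribution_fun F \<alpha> \<le> ennreal (C1 * (K / \<alpha>) powr p * (B / \<alpha>) powr (p + m - p))) \<Longrightarrow>
      lorentz_ennorm (ennreal q) l F \<le> ennreal (C * (K powr (p / q) * B powr (1 - p / q)))"
    using lorentz_interpolation[OF pm(1) p(2) pm(2) C1(1) l, where ?'n = 'n] by blast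
  show thesis
  proof (rule that[OF C(1)])
    fix u B
    assume u: "u \<in> lorentz_space (ennreal p) \<infinity>" and B: "0 \<le> B"
      and pb: "\<And>u' B' K. B < B' \<Longrightarrow> u' \<in> borel_measurable borel \<Longrightarrow> AE x in lborel. u x = u' x \<Longrightarrow>
        0 < K \<Longrightarrow> weak_bound p K (\<lambda>x. ennreal (norm (u' x))) \<Longrightarrow> piece_bound \<eta> r B' u'"
    have um: "u \<in> borel_measurable lebesgue" and fin: "lorentz_norm (ennreal p) \<infinity> u < \<infinity>"
      using u by (auto simp: lorentz_space_def)
    define K where "K = enn2real (lorentz_norm (ennreal p) \<infinity> u)"
    have K: "0 \<le> K" "lorentz_norm (ennreal p) \<infinity> u = ennreal K"
      using fin by (auto simp: K_def)
    obtain u' where u': "u' \<in> borel_measurable borel" "AE x in lborel. u x = u' x"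
      by (rule lebesgue_borel_representative[OF um])
    have "lorentz_norm (ennreal q) l u \<le> ennreal (C * (K powr (p / q) * B powr (1 - p / q)))"
    proof (rule le_powr_product_of_all_greater[OF K(1) B])
      show "0 < p / q" "0 < 1 - p / q" using p by (auto simp: field_simps)
      fix K' B' assume K': "K < K'" and B': "B < B'"
      have pos: "0 < K'" "0 < B'" using K' B' K(1) B by linarith+
      have w: "weak_bound p K' (\<lambda>x. ennreal (norm (u' x)))"
        using p K K' by (intro weak_bound_of_lorentz_norm[OF um u']) (auto intro: ennreal_leI)
      obtain g where g: "\<And>j. g j \<in> borel_measurable borel"
        "\<And>j::int. weak_bound r (2 powr (- real_of_int j * real CARD('n) / r) * B') (\<lambda>x. ennreal (norm (g j x)))"
        "\<And>j x. conv u' (dilated_kernel (2 powr real_of_int j) (inverse_fourier \<phi>c)) x = conv (g j) (dilated_kernel (2 powr real_of_int j) (inverse_fourier \<eta>)) x"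
        using pb[OF B' u' pos(1) w] unfolding piece_bound_def by metis
      show "lorentz_norm (ennreal q) l u \<le> ennreal (C * (K' powr (p / q) * B' powr (1 - p / q)))"
        unfolding lorentz_norm_def
      proof (rule C(2)[OF pos])
        fix \<alpha> :: real assume \<alpha>: "0 < \<alpha>"
        show "distribution_fun (\<lambda>x. ennreal (norm (u x))) \<alpha> \<le> ennreal ((K' / \<alpha>) powr p)"
          unfolding distribution_fun_representative[OF um u'] using weak_boundD(2)[OF w \<alpha>] .
        show "distribution_fun (\<lambda>x. ennreal (norm (u x))) \<alpha> \<le> ennreal (C1 * (K' / \<alpha>) powr p * (B' / \<alpha>) powr (p + m - p))"
          unfolding distribution_fun_representative[OF um u'] using C1(2)[OF u'(1) w pos g \<alpha>] by simp
      qed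
    qed
    also have "\<dots> = ennreal C * ennreal_powr (lorentz_norm (ennreal p) \<infinity> u) (p / q) * ennreal (B powr (1 - p / q))"
      using C(1) K by (simp add: ennreal_powr_def ennreal_mult mult.assoc)
    finally show "lorentz_norm (ennreal q) l u
        \<le> ennreal C * ennreal_powr (lorentz_norm (ennreal p) \<infinity> u) (p / q) * ennreal (B powr (1 - p / q))" .
  qed
qed

end

section \<open>Blocks and the operator Lambda as convolutions\<close>

context littlewood_paley_function
begin

lemma is_LP_block_iff:
  "is_LP_block \<phi> j T S \<longleftrightarrow> (\<forall>\<psi>. schwartz \<psi> \<longrightarrow>
    fourier_distr S \<psi> = fourier_distr T (\<lambda>\<xi>. \<phi>c ((1 / 2 powr real_of_int j) *\<^sub>R \<xi>) * \<psi> \<xi>))"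
  by (simp only: is_LP_block_def powr_neg_int)

text \<open>Since \<phi>(\<xi>) = |\<xi>|^s \<eta>(\<xi>), this multiplier recovers the blocks of u
  from Lambda^s u. It is smooth because \<phi> vanishes near the origin.\<close>

definition \<eta> :: "real \<Rightarrow> real^'n \<Rightarrow> complex" where
  "\<eta> s \<xi> = of_real (norm \<xi> powr (- s) * \<phi> \<xi>)"

lemma smooth_norm_powr_\<phi>: "smooth (\<lambda>\<xi>. norm \<xi> powr a * \<phi> \<xi>)"
proof (rule smooth_norm_powr_mult[OF \<phi>_smooth])
  show "0 \<notin> closure {\<xi>. \<phi> \<xi> \<noteq> 0}" using closure_support_\<phi> by auto
qed

context
  fixes p K :: real and u u' :: "real^'n \<Rightarrow> complex"
  assumes u: "u \<in> borel_measurable lebesgue" "u' \<in> borel_measurable borel" "AE x in lborel. u x = u' x"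
    and wu: "weak_bound p K (\<lambda>x. ennreal (norm (u' x)))" and p: "1 < p" and K: "0 < K"
begin

lemma LP_block_represents:
  "tempered_fun (LP_block \<phi> j (distr_of u))"
  "is_LP_block \<phi> j (distr_of u) (distr_of (LP_block \<phi> j (distr_of u)))"
proof -
  let ?\<Phi> = "\<lambda>\<xi>. \<phi>c ((1 / 2 powr real_of_int j) *\<^sub>R \<xi>)"
  have \<Phi>: "schwartz ?\<Phi>" by (rule schwartz_\<phi>) simp
  note ex = LP_block_exists[OF \<Phi> u wu p K]
  have "tempered_fun (conv u' (inverse_fourier ?\<Phi>)) \<and>
      is_LP_block \<phi> j (distr_of u) (distr_of (conv u' (inverse_fourier ?\<Phi>)))"
    using ex by (simp add: is_LP_block_iff fourier_distr_def)
  then have "tempered_fun (LP_block \<phi> j (distr_of u)) \<and>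
      is_LP_block \<phi> j (distr_of u) (distr_of (LP_block \<phi> j (distr_of u)))"
    unfolding LP_block_def
    by (rule someI[where P = "\<lambda>g. tempered_fun g \<and> is_LP_block \<phi> j (distr_of u) (distr_of g)"])
  then show "tempered_fun (LP_block \<phi> j (distr_of u))"
    "is_LP_block \<phi> j (distr_of u) (distr_of (LP_block \<phi> j (distr_of u)))" by auto
qed

lemma LP_block_measurable: "LP_block \<phi> j (distr_of u) \<in> borel_measurable lebesgue"
  using LP_block_represents(1) by (simp add: tempered_fun_def)

text \<open>Testing against \<open>f(\<xi>) e\<^bsup>ix\<xi>\<^esup> / (2\<pi>)\<^sup>n\<close> turns the weak identities defining the blocks and \<open>\<Lambda>\<^sup>s\<close>
  into pointwise identities between convolutions.\<close>

lemma conv_eq_of_distr_eq: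
  assumes g: "g \<in> borel_measurable lebesgue" "g' \<in> borel_measurable borel" "AE x in lborel. g x = g' x"
    and f: "f \<in> borel_measurable borel" "f' \<in> borel_measurable borel"
    and eq: "distr_of g (fourier (\<lambda>\<xi>. of_real (1 / (2 * pi) ^ CARD('n)) * (cis (x \<bullet> \<xi>) * f' \<xi>)))
      = distr_of u (fourier (\<lambda>\<xi>. of_real (1 / (2 * pi) ^ CARD('n)) * (cis (x \<bullet> \<xi>) * f \<xi>)))"
  shows "conv u' (inverse_fourier f) x = conv g' (inverse_fourier f') x"
proof -
  note f [measurable]
  have e: "fourier (\<lambda>\<xi>. of_real (1 / (2 * pi) ^ CARD('n)) * (cis (x \<bullet> \<xi>) * h \<xi>)) = (\<lambda>y. inverse_fourier h (x - y))"
    if "h \<in> borel_measurable borel" for h :: "real^'n \<Rightarrow> complex"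
    using fourier_modulate[OF that] by auto
  have m: "(\<lambda>y. inverse_fourier h (x - y)) \<in> borel_measurable borel" if "h \<in> borel_measurable borel"
    for h :: "real^'n \<Rightarrow> complex"
    using measurable_compose[OF _ inverse_fourier_borel_measurable[OF that], of "\<lambda>y. x - y" borel] by simp
  show ?thesis
    using eq unfolding e[OF f(1)] e[OF f(2)] distr_of_eq_lborel[OF g(2,1) m[OF f(2)] g(3)]
      distr_of_eq_lborel[OF u(2,1) m[OF f(1)] u(3)] conv_def by simp
qed

text \<open>The multiplier \<theta>(\<xi>/4) is 1 on the support of \<phi>, since |\<xi>| at most
  8/3 gives |\<xi>/4| < 3/4. Inserting it therefore changes nothing, and it writes the piece of u as
  a smoothing of its own block, which allows a sup bound to be read off the weak L^r norm of the
  block.\<close>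

lemma LP_block_conv_eq:
  assumes g': "g' \<in> borel_measurable borel" "AE x in lborel. LP_block \<phi> j (distr_of u) x = g' x"
  shows "conv u' (dilated_kernel (2 powr real_of_int j) (inverse_fourier \<phi>c)) x
    = conv g' (dilated_kernel (2 powr real_of_int j) (inverse_fourier (\<lambda>\<xi>. \<theta>c ((1 / 4) *\<^sub>R \<xi>)))) x"
proof -
  let ?c = "2 powr real_of_int j" let ?a = "complex_of_real (1 / (2 * pi) ^ CARD('n))"
  let ?f = "\<lambda>\<xi>. \<phi>c ((1 / ?c) *\<^sub>R \<xi>)" let ?f' = "\<lambda>\<xi>. \<theta>c ((1 / 4) *\<^sub>R ((1 / ?c) *\<^sub>R \<xi>))"
  let ?\<psi> = "\<lambda>\<xi>. ?a * (cis (x \<bullet> \<xi>) * ?f' \<xi>)"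
  have c: "0 < ?c" by simp
  have \<theta>4: "schwartz (\<lambda>\<xi>. \<theta>c ((1 / 4) *\<^sub>R \<xi>))" by (rule schwartz_\<theta>) simp
  have \<psi>: "schwartz ?\<psi>"
  proof (rule schwartz_of_bounded_support[where R = "4 * ?c * (4 / 3)"])
    show "smooth ?\<psi>"
      by (intro smooth_cmult smooth_mult smooth_cis smooth_of_real smooth_dilation[of "\<lambda>\<xi>. \<theta> ((1 / 4) *\<^sub>R \<xi>)"] smooth_dilation \<theta>_smooth)
    show "norm \<xi> \<le> 4 * ?c * (4 / 3)" if "?\<psi> \<xi> \<noteq> 0" for \<xi>
      using \<theta>_outside[of "(1 / 4) *\<^sub>R ((1 / ?c) *\<^sub>R \<xi>)"] that c by (force simp: field_simps not_less[symmetric])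
  qed
  have "\<phi>c ((1 / ?c) *\<^sub>R \<xi>) * ?\<psi> \<xi> = ?a * (cis (x \<bullet> \<xi>) * ?f \<xi>)" for \<xi>
  proof (cases "\<phi> ((1 / ?c) *\<^sub>R \<xi>) = 0")
    case False
    have "\<theta> ((1 / 4) *\<^sub>R ((1 / ?c) *\<^sub>R \<xi>)) = 1"
    proof -
      have "norm ((1 / 4) *\<^sub>R v) < 3 / 4" if "norm v \<le> 8 / 3" for v :: "real^'n" using that by simp
      from this[OF \<phi>_support(2)[OF False]] show ?thesis by (rule \<theta>_one)
    qed
    then show ?thesis by simp
  qed simp
  then have "distr_of (LP_block \<phi> j (distr_of u)) (fourier ?\<psi>) = distr_of u (fourier (\<lambda>\<xi>. ?a * (cis (x \<bullet> \<xi>) * ?f \<xi>)))"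
    using LP_block_represents(2)[of j] \<psi> by (simp only: is_LP_block_iff fourier_distr_def)
  then have "conv u' (inverse_fourier ?f) x = conv g' (inverse_fourier ?f') x"
    using schwartz_borel_measurable[OF schwartz_\<phi>[OF c]]
      measurable_compose[OF _ schwartz_borel_measurable[OF \<theta>4], of "\<lambda>\<xi>. (1 / ?c) *\<^sub>R \<xi>" borel]
    by (intro conv_eq_of_distr_eq[OF LP_block_measurable g']) auto
  then show ?thesis
    by (simp only: inverse_fourier_dilated_kernel[OF schwartz_borel_measurable[OF \<phi>c_schwartz] c]
        inverse_fourier_dilated_kernel[OF schwartz_borel_measurable[OF \<theta>4] c])
qed

lemma LP_block_piece_bound:
  assumes "\<And>j \<alpha>. 0 < \<alpha> \<Longrightarrow> distribution_fun (\<lambda>x. ennreal (norm (LP_block \<phi> j (distr_of u) x))) \<alpha>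
      \<le> ennreal ((2 powr (- real_of_int j * real CARD('n) / r) * B / \<alpha>) powr r)"
  shows "piece_bound (\<lambda>\<xi>. \<theta>c ((1 / 4) *\<^sub>R \<xi>)) r B u'"
  unfolding piece_bound_def
proof
  fix j
  obtain g' where g': "g' \<in> borel_measurable borel" "AE x in lborel. LP_block \<phi> j (distr_of u) x = g' x"
    by (rule lebesgue_borel_representative[OF LP_block_measurable])
  have "weak_bound r (2 powr (- real_of_int j * real CARD('n) / r) * B) (\<lambda>x. ennreal (norm (g' x)))"
    by (rule weak_bound_of_distribution_fun[OF LP_block_measurable g' assms])
  then show "\<exists>g. g \<in> borel_measurable borel \<and>
    weak_bound r (2 powr (- real_of_int j * real CARD('n) / r) * B) (\<lambda>x. ennreal (norm (g x))) \<and>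
    (\<forall>x. conv u' (dilated_kernel (2 powr real_of_int j) (inverse_fourier \<phi>c)) x
       = conv g (dilated_kernel (2 powr real_of_int j) (inverse_fourier (\<lambda>\<xi>. \<theta>c ((1 / 4) *\<^sub>R \<xi>)))) x)"
    using g'(1) LP_block_conv_eq[OF g'] by blast
qed

lemma besov_piece_bound:
  assumes r: "1 < r" and B: "0 \<le> B" and le: "besov_lorentz_norm \<phi> (real CARD('n) / r) r (distr_of u) \<le> ennreal B"
  shows "piece_bound (\<lambda>\<xi>. \<theta>c ((1 / 4) *\<^sub>R \<xi>)) r B u'"
proof (rule LP_block_piece_bound)
  fix j :: int and \<alpha> :: real assume \<alpha>: "0 < \<alpha>"
  let ?g = "LP_block \<phi> j (distr_of u)" let ?s = "2 powr (real_of_int j * (real CARD('n) / r))"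
  let ?t = "2 powr (- real_of_int j * real CARD('n) / r)"
  have ts: "?t * ?s = 1" by (simp add: powr_add[symmetric])
  have "ennreal ?s * lorentz_norm (ennreal r) \<infinity> ?g \<le> ennreal B"
    using le unfolding besov_lorentz_norm_def by (meson SUP_upper UNIV_I order_trans)
  then have "ennreal ?t * (ennreal ?s * lorentz_norm (ennreal r) \<infinity> ?g) \<le> ennreal ?t * ennreal B"
    by (rule mult_left_mono) simp
  then have "lorentz_norm (ennreal r) \<infinity> ?g \<le> ennreal (?t * B)"
    unfolding mult.assoc[symmetric] ennreal_mult'[symmetric, OF powr_ge_zero] ts by simp
  then show "distribution_fun (\<lambda>x. ennreal (norm (?g x))) \<alpha> \<le> ennreal ((?t * B / \<alpha>) powr r)"
    using r B \<alpha> LP_block_measurable[of j]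
    by (intro lorentz_weak_distribution) (auto simp: lorentz_norm_def)
qed

lemma triebel_lizorkin_piece_bound:
  assumes r: "1 < r" and B: "0 \<le> B"
    and le: "triebel_lizorkin_lorentz_norm \<phi> (real CARD('n) / r) r (distr_of u) \<le> ennreal B"
  shows "piece_bound (\<lambda>\<xi>. \<theta>c ((1 / 4) *\<^sub>R \<xi>)) r B u'"
proof (rule LP_block_piece_bound)
  fix j :: int and \<alpha> :: real assume \<alpha>: "0 < \<alpha>"
  let ?g = "\<lambda>j. LP_block \<phi> j (distr_of u)" let ?s = "\<lambda>j::int. 2 powr (real_of_int j * (real CARD('n) / r))"
  let ?t = "2 powr (- real_of_int j * real CARD('n) / r)"
  define F where "F x = (SUP j::int. ennreal (?s j * norm (?g j x)))" for x
  have [measurable]: "?g j \<in> borel_measurable lebesgue" for j by (rule LP_block_measurable)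
  have F [measurable]: "F \<in> borel_measurable lebesgue" unfolding F_def[abs_def] by measurable
  have ts: "?t * ?s j = 1" by (simp add: powr_add[symmetric])
  have "{x \<in> space lebesgue. ennreal (?s j * \<alpha>) < F x} \<in> sets lebesgue" by measurable
  then have S: "{x. ennreal (?s j * \<alpha>) < F x} \<in> sets lebesgue"
    by (simp only: space_completion space_lborel space_borel UNIV_I simp_thms)
  have "{x. ennreal \<alpha> < ennreal (norm (?g j x))} \<subseteq> {x. ennreal (?s j * \<alpha>) < F x}"
  proof safe
    fix x assume "ennreal \<alpha> < ennreal (norm (?g j x))"
    then have "ennreal (?s j * \<alpha>) < ennreal (?s j * norm (?g j x))"
      using \<alpha> by (simp add: ennreal_less_iff)
    also have "\<dots> \<le> F x" unfolding F_def by (rule SUP_upper) simp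
    finally show "ennreal (?s j * \<alpha>) < F x" .
  qed
  then have "distribution_fun (\<lambda>x. ennreal (norm (?g j x))) \<alpha> \<le> distribution_fun F (?s j * \<alpha>)"
    unfolding distribution_fun_def by (intro emeasure_mono S)
  also have "\<dots> \<le> ennreal ((B / (?s j * \<alpha>)) powr r)"
  proof (rule lorentz_weak_distribution[OF F _ _ B])
    show "lorentz_ennorm (ennreal r) \<infinity> F \<le> ennreal B"
      using le unfolding triebel_lizorkin_lorentz_norm_def F_def[abs_def] .
  qed (use r \<alpha> in simp_all)
  also have "B / (?s j * \<alpha>) = ?t * B / \<alpha>"
  proof -
    have "?s j \<noteq> 0" by simp
    then have "?t = 1 / ?s j" using ts by (simp only: eq_divide_eq) simp
    then show ?thesis by simp
  qed
  finally show "distribution_fun (\<lambda>x. ennreal (norm (?g j x))) \<alpha> \<le> ennreal ((?t * B / \<alpha>) powr r)" .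
qed

text \<open>Strict inequality extracts a representative \<open>g\<close> of Lambda^s u with norm
  below B from the infimum. The test function used at scale 2^j is supported in an annulus, hence
  admissible in \<open>is_Lambda\<close>, and the powers |\<xi>|^s and |\<xi>|^(-s) cancel to leave
  the block multiplier.\<close>

lemma Lambda_piece_bound:
  assumes r: "1 < r" and B: "0 \<le> B"
    and less: "Lambda_lorentz_norm (real CARD('n) / r) (ennreal r) \<infinity> (distr_of u) < ennreal B"
  shows "piece_bound (\<eta> (real CARD('n) / r)) r B u'"
  unfolding piece_bound_def
proof
  fix j :: int
  let ?s = "real CARD('n) / r" let ?c = "2 powr real_of_int j" let ?a = "complex_of_real (1 / (2 * pi) ^ CARD('n))"
  let ?t = "2 powr (- real_of_int j * real CARD('n) / r)"
  have t: "?c powr (- ?s) = ?t" by (simp add: powr_powr)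
  have c: "0 < ?c" by simp
  obtain g where g: "tempered_fun g" "is_Lambda ?s (distr_of u) (distr_of g)" "lorentz_norm (ennreal r) \<infinity> g < ennreal B"
    using less unfolding Lambda_lorentz_norm_def by (auto simp: INF_less_iff)
  have gm: "g \<in> borel_measurable lebesgue" using g(1) by (simp add: tempered_fun_def)
  obtain g' where g': "g' \<in> borel_measurable borel" "AE x in lborel. g x = g' x"
    by (rule lebesgue_borel_representative[OF gm])
  note g'(1) [measurable]
  have wg: "weak_bound r B (\<lambda>x. ennreal (norm (g' x)))"
    using r B g(3) by (intro weak_bound_of_lorentz_norm[OF gm g']) auto
  let ?G = "\<lambda>x. of_real ?t * g' x"
  let ?f = "\<lambda>\<xi>. \<phi>c ((1 / ?c) *\<^sub>R \<xi>)"
  \<comment> \<open>Up to the factor 2^(-js), the function |\<xi>|^(-s) \<phi>(2^(-j) \<xi>) is the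
    2^j-dilate of \<eta>. With s = n/r this is the factor demanded by \<open>piece_bound\<close>; it
    is moved from the kernel to \<open>?G\<close>.\<close>
  let ?f' = "\<lambda>\<xi>. of_real ?t * \<eta> ?s ((1 / ?c) *\<^sub>R \<xi>)"
  have [measurable]: "\<eta> ?s \<in> borel_measurable borel"
    unfolding \<eta>_def[abs_def] by (intro smooth_borel_measurable smooth_of_real smooth_norm_powr_\<phi>)
  have f'_eq: "?f' \<xi> = of_real (norm \<xi> powr (- ?s) * \<phi> ((1 / ?c) *\<^sub>R \<xi>))" for \<xi>
  proof -
    have "norm \<xi> = ?c * norm ((1 / ?c) *\<^sub>R \<xi>)" by simp
    then have "norm \<xi> powr (- ?s) = ?t * norm ((1 / ?c) *\<^sub>R \<xi>) powr (- ?s)"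
      unfolding t[symmetric] by (metis norm_ge_zero powr_ge_zero powr_mult)
    then show ?thesis by (simp add: \<eta>_def mult.assoc)
  qed
  have "conv u' (dilated_kernel ?c (inverse_fourier \<phi>c)) x = conv ?G (dilated_kernel ?c (inverse_fourier (\<eta> ?s))) x" for x
  proof -
    let ?\<psi> = "\<lambda>\<xi>. ?a * (cis (x \<bullet> \<xi>) * ?f' \<xi>)"
    have supp: "3 / 4 * ?c \<le> norm \<xi>" "norm \<xi> \<le> 8 / 3 * ?c" if "?\<psi> \<xi> \<noteq> 0" for \<xi>
    proof -
      have "\<phi> ((1 / ?c) *\<^sub>R \<xi>) \<noteq> 0" using that by (auto simp: \<eta>_def)
      from \<phi>_support[OF this] c show "3 / 4 * ?c \<le> norm \<xi>" "norm \<xi> \<le> 8 / 3 * ?c"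
        by (simp_all add: field_simps)
    qed
    have "smooth ?\<psi>"
      unfolding \<eta>_def
      by (intro smooth_cmult smooth_mult smooth_cis smooth_of_real smooth_dilation[of "\<lambda>\<xi>. norm \<xi> powr (- ?s) * \<phi> \<xi>"] smooth_norm_powr_\<phi>)
    then have "test_fun_off_origin ?\<psi>"
      using supp c by (intro test_fun_off_origin_of_support[where R = "8 / 3 * ?c" and \<delta> = "3 / 4 * ?c"]) auto
    then have "distr_of g (fourier ?\<psi>) = distr_of u (fourier (\<lambda>\<xi>. of_real (norm \<xi> powr ?s) * ?\<psi> \<xi>))"
      using g(2) by (simp only: is_Lambda_def fourier_distr_def)
    also have "(\<lambda>\<xi>. of_real (norm \<xi> powr ?s) * ?\<psi> \<xi>) = (\<lambda>\<xi>. ?a * (cis (x \<bullet> \<xi>) * ?f \<xi>))"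
    proof
      fix \<xi> :: "real^'n"
      have "norm \<xi> powr ?s * (norm \<xi> powr (- ?s) * \<phi> ((1 / ?c) *\<^sub>R \<xi>)) = \<phi> ((1 / ?c) *\<^sub>R \<xi>)"
      \<comment> \<open>At the origin \<open>powr\<close> returns 0, so the powers do not cancel
        there; the identity survives because \<phi> vanishes at 0.\<close>
      proof (cases "\<xi> = 0")
        case True
        then show ?thesis using \<phi>_zero(1)[of 0] by simp
      qed (simp add: powr_minus)
      then have "of_real (norm \<xi> powr ?s) * ?f' \<xi> = ?f \<xi>"
        unfolding f'_eq of_real_mult[symmetric] by (simp only:)
      then show "of_real (norm \<xi> powr ?s) * ?\<psi> \<xi> = ?a * (cis (x \<bullet> \<xi>) * ?f \<xi>)"
      proof -
        have e: "a * (b * (c * d)) = b * (c * (a * d))" for a b c d :: complex by (simp only: mult_ac)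
        show ?thesis
          by (rule trans[OF e]) (simp only: \<open>of_real (norm \<xi> powr ?s) * ?f' \<xi> = ?f \<xi>\<close>)
      qed
    qed
    finally have "conv u' (inverse_fourier ?f) x = conv g' (inverse_fourier ?f') x"
      using schwartz_borel_measurable[OF schwartz_\<phi>[OF c]]
      by (intro conv_eq_of_distr_eq[OF gm g']) (auto, measurable)
    also have "inverse_fourier ?f' = (\<lambda>y. of_real ?t * dilated_kernel ?c (inverse_fourier (\<eta> ?s)) y)"
    proof
      fix y
      have "inverse_fourier ?f' y = of_real ?t * inverse_fourier (\<lambda>\<xi>. \<eta> ?s ((1 / ?c) *\<^sub>R \<xi>)) y"
        by (simp only: inverse_fourier_def mult.left_commute[of _ "of_real ?t"] integral_mult_right_zero)
      then show "inverse_fourier ?f' y = of_real ?t * dilated_kernel ?c (inverse_fourier (\<eta> ?s)) y"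
        using inverse_fourier_dilated_kernel[of "\<eta> ?s" ?c] c by simp
    qed
    also have "conv g' (\<lambda>y. of_real ?t * dilated_kernel ?c (inverse_fourier (\<eta> ?s)) y) x
        = conv ?G (dilated_kernel ?c (inverse_fourier (\<eta> ?s))) x"
      by (simp add: conv_def mult_ac)
    finally show ?thesis
      by (simp only: inverse_fourier_dilated_kernel[OF schwartz_borel_measurable[OF \<phi>c_schwartz] c])
  qed
  moreover have "weak_bound r (?t * B) (\<lambda>x. ennreal (norm (?G x)))"
    unfolding weak_bound_def
  proof (intro conjI allI impI)
    fix \<alpha> :: real assume \<alpha>: "0 < \<alpha>"
    have "{x. ennreal \<alpha> < ennreal (norm (?G x))} = {x. ennreal (\<alpha> / ?t) < ennreal (norm (g' x))}"
      using \<alpha> by (auto simp: norm_mult ennreal_less_iff field_simps)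
    then show "emeasure lborel {x. ennreal \<alpha> < ennreal (norm (?G x))} \<le> ennreal ((?t * B / \<alpha>) powr r)"
      using weak_boundD(2)[OF wg, of "\<alpha> / ?t"] \<alpha> by (simp add: mult.commute)
  qed measurable
  ultimately show "\<exists>g. g \<in> borel_measurable borel \<and> weak_bound r (?t * B) (\<lambda>x. ennreal (norm (g x))) \<and>
    (\<forall>x. conv u' (dilated_kernel ?c (inverse_fourier \<phi>c)) x = conv g (dilated_kernel ?c (inverse_fourier (\<eta> ?s))) x)"
    by (intro exI[of _ ?G]) auto
qed

end

lemma schwartz_\<eta>: "schwartz (\<eta> s)"
proof (rule schwartz_of_bounded_support[where R = "8 / 3"])
  show "smooth (\<eta> s)" unfolding \<eta>_def[abs_def] by (intro smooth_of_real smooth_norm_powr_\<phi>)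
  show "norm \<xi> \<le> 8 / 3" if "\<eta> s \<xi> \<noteq> 0" for \<xi> using that \<phi>_support(2)[of \<xi>] by (auto simp: \<eta>_def)
qed

end

theorem corollary1p3:
  fixes p q r :: real and l :: ennreal and \<phi> :: "real^'n \<Rightarrow> real"
  assumes "littlewood_paley \<phi>"
    and "1 < p" and "p < q" and "1 < r" and "1 \<le> l"
  shows "\<exists>C::real. C > 0 \<and> (\<forall>u :: real^'n \<Rightarrow> complex. u \<in> lorentz_space (ennreal p) \<infinity> \<longrightarrow>
    (Lambda_lorentz_norm (real CARD('n) / r) (ennreal r) \<infinity> (distr_of u) < \<infinity> \<longrightarrow>
      lorentz_norm (ennreal q) l u \<le> ennreal C
        * ennreal_powr (lorentz_norm (ennreal p) \<infinity> u) (p / q)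
        * ennreal_powr (Lambda_lorentz_norm (real CARD('n) / r) (ennreal r) \<infinity> (distr_of u)) (1 - p / q)) \<and>
    (triebel_lizorkin_lorentz_norm \<phi> (real CARD('n) / r) r (distr_of u) < \<infinity> \<longrightarrow>
      lorentz_norm (ennreal q) l u \<le> ennreal C
        * ennreal_powr (lorentz_norm (ennreal p) \<infinity> u) (p / q)
        * ennreal_powr (triebel_lizorkin_lorentz_norm \<phi> (real CARD('n) / r) r (distr_of u)) (1 - p / q)) \<and>
    (besov_lorentz_norm \<phi> (real CARD('n) / r) r (distr_of u) < \<infinity> \<longrightarrow>
      lorentz_norm (ennreal q) l u \<le> ennreal C
        * ennreal_powr (lorentz_norm (ennreal p) \<infinity> u) (p / q)
        * ennreal_powr (besov_lorentz_norm \<phi> (real CARD('n) / r) r (distr_of u)) (1 - p / q)))"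
proof -
  interpret littlewood_paley_function \<phi> by standard fact
  let ?s = "real CARD('n) / r" let ?\<theta> = "\<lambda>\<xi>. \<theta>c ((1 / 4) *\<^sub>R \<xi>)"
  have \<theta>4: "schwartz ?\<theta>" by (rule schwartz_\<theta>) simp
  \<comment> \<open>The inequality with an arbitrary finite quantity \<open>X\<close> in place of
    the norm, so that each of the three norms becomes an instance. Two multipliers suffice:
    \<open>\<eta> ?s\<close> for Lambda, and \<open>?\<theta>\<close> for both norms built from
    blocks.\<close>
  define good where "good C \<eta> \<longleftrightarrow> (\<forall>(u :: real^'n \<Rightarrow> complex) X. u \<in> lorentz_space (ennreal p) \<infinity> \<longrightarrow> X < \<infinity> \<longrightarrow>
      (\<forall>u' B K. X < ennreal B \<longrightarrow> u' \<in> borel_measurable borel \<longrightarrow> (AE x in lborel. u x = u' x) \<longrightarrow>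
        0 < K \<longrightarrow> weak_bound p K (\<lambda>x. ennreal (norm (u' x))) \<longrightarrow> piece_bound \<eta> r B u') \<longrightarrow>
      lorentz_norm (ennreal q) l u
        \<le> ennreal C * ennreal_powr (lorentz_norm (ennreal p) \<infinity> u) (p / q) * ennreal_powr X (1 - p / q))" for C :: real and \<eta>
  have ex: "\<exists>C>0. good C \<eta>" if \<eta>: "schwartz \<eta>" for \<eta>
  proof -
    obtain C where C: "0 < C"
      "\<And>u B. u \<in> lorentz_space (ennreal p) \<infinity> \<Longrightarrow> 0 \<le> B \<Longrightarrow>
        (\<And>u' B' K. B < B' \<Longrightarrow> u' \<in> borel_measurable borel \<Longrightarrow> AE x in lborel. u x = u' x \<Longrightarrow>
          0 < K \<Longrightarrow> weak_bound p K (\<lambda>x. ennreal (norm (u' x))) \<Longrightarrow> piece_bound \<eta> r B' u') \<Longrightarrow>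
        lorentz_norm (ennreal q) l u
          \<le> ennreal C * ennreal_powr (lorentz_norm (ennreal p) \<infinity> u) (p / q) * ennreal (B powr (1 - p / q))"
      using lorentz_estimate[OF \<eta> assms(2-5)] by blast
    have "good C \<eta>"
      unfolding good_def
    proof (intro allI impI)
      fix u :: "real^'n \<Rightarrow> complex" and X :: ennreal
      assume u: "u \<in> lorentz_space (ennreal p) \<infinity>" and X: "X < \<infinity>"
        and H: "\<forall>u' B K. X < ennreal B \<longrightarrow> u' \<in> borel_measurable borel \<longrightarrow> (AE x in lborel. u x = u' x) \<longrightarrow>
          0 < K \<longrightarrow> weak_bound p K (\<lambda>x. ennreal (norm (u' x))) \<longrightarrow> piece_bound \<eta> r B u'"
      obtain B where B: "X = ennreal B" "0 \<le> B" using X by (cases X) auto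
      have "lorentz_norm (ennreal q) l u
          \<le> ennreal C * ennreal_powr (lorentz_norm (ennreal p) \<infinity> u) (p / q) * ennreal (B powr (1 - p / q))"
        using H B by (intro C(2)[OF u B(2)]) (auto simp: ennreal_less_iff)
      then show "lorentz_norm (ennreal q) l u
          \<le> ennreal C * ennreal_powr (lorentz_norm (ennreal p) \<infinity> u) (p / q) * ennreal_powr X (1 - p / q)"
        using B by (simp add: ennreal_powr_def)
    qed
    then show ?thesis using C(1) by blast
  qed
  obtain C1 where C1: "0 < C1" "good C1 (\<eta> ?s)" using ex[OF schwartz_\<eta>] by blast
  obtain C2 where C2: "0 < C2" "good C2 ?\<theta>" using ex[OF \<theta>4] by blast
  \<comment> \<open>The right-hand sides increase with the constant, so the larger of the two
    constants serves all three inequalities.\<close>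
  have mono: "a \<le> ennreal (max C1 C2) * b * c" if "a \<le> ennreal C * b * c" "C \<le> max C1 C2" for a b c C
    using that(1) by (rule order_trans) (intro mult_right_mono ennreal_leI that; simp)
  show ?thesis
  proof (intro exI[of _ "max C1 C2"] conjI allI impI)
    show "0 < max C1 C2" using C1 by simp
    fix u :: "real^'n \<Rightarrow> complex" assume u: "u \<in> lorentz_space (ennreal p) \<infinity>"
    have um: "u \<in> borel_measurable lebesgue" using u by (simp add: lorentz_space_def)
    \<comment> \<open>As \<open>ennreal\<close> maps negative reals to 0, nothing lies strictly
      below \<open>ennreal B\<close> for B < 0.\<close>
    have B0: "0 \<le> B" if "X < ennreal B" for X B
      using that by (cases "0 \<le> B") (auto simp: ennreal_neg)
    show "lorentz_norm (ennreal q) l u \<le> ennreal (max C1 C2)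
        * ennreal_powr (lorentz_norm (ennreal p) \<infinity> u) (p / q)
        * ennreal_powr (Lambda_lorentz_norm ?s (ennreal r) \<infinity> (distr_of u)) (1 - p / q)"
      if "Lambda_lorentz_norm ?s (ennreal r) \<infinity> (distr_of u) < \<infinity>"
      by (rule mono[OF C1(2)[unfolded good_def, rule_format, OF u that]])
        (use Lambda_piece_bound[OF um _ _ _ assms(2) _ assms(4) B0] in auto)
    show "lorentz_norm (ennreal q) l u \<le> ennreal (max C1 C2)
        * ennreal_powr (lorentz_norm (ennreal p) \<infinity> u) (p / q)
        * ennreal_powr (triebel_lizorkin_lorentz_norm \<phi> ?s r (distr_of u)) (1 - p / q)"
      if "triebel_lizorkin_lorentz_norm \<phi> ?s r (distr_of u) < \<infinity>"
      by (rule mono[OF C2(2)[unfolded good_def, rule_format, OF u that]])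
        (use triebel_lizorkin_piece_bound[OF um _ _ _ assms(2) _ assms(4) B0] less_imp_le in auto)
    show "lorentz_norm (ennreal q) l u \<le> ennreal (max C1 C2)
        * ennreal_powr (lorentz_norm (ennreal p) \<infinity> u) (p / q)
        * ennreal_powr (besov_lorentz_norm \<phi> ?s r (distr_of u)) (1 - p / q)"
      if "besov_lorentz_norm \<phi> ?s r (distr_of u) < \<infinity>"
      by (rule mono[OF C2(2)[unfolded good_def, rule_format, OF u that]])
        (use besov_piece_bound[OF um _ _ _ assms(2) _ assms(4) B0] less_imp_le in auto)
  qed
qed

end
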